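(* Let $\mathfrak H$ be a complex Hilbert space, let $Y,(L_l)_{l\ge1}$ satisfy the Premise with equality, i.e. $\langle u,Yu\rangle+\langle Yu,u\rangle+\sum_l\langle L_lu,L_lu\rangle=0$ for all $u\in D(Y)$, and let $(T(t))_{t\ge0}$ be the associated minimal quantum dynamical semigroup on $\mathcal L(\mathfrak H)$. Then $(T(t))_{t\ge0}$ is conservative if and only if its predual semigroup $(S(t))_{t\ge0}$ is honest.
   Context: Inner products are linear in the second variable. $\mathcal L(\mathfrak H)$: bounded operators; $\mathfrak T(\mathfrak H)$: trace class operators with trace norm, the predual of $\mathcal L(\mathfrak H)$ via $(\rho,x)\mapsto\mathrm{Tr}(\rho x)$; $\mathfrak T_s(\mathfrak H)$: the real ordered Banach space of self-adjoint trace class operators, whose complexification is $\mathfrak T(\mathfrak H)$. $R(\lambda,Y)=(\lambda-Y)^{-1}$. Premise: $Y$ generates a $C_0$-semigroup of contractions $(P(t))_{t\ge0}$ on $\mathfrak H$; $(L_l)_{l\ge1}$ are linear operators with $D(L_l)\supseteq D(Y)$ and $\langle u,Yu\rangle+\langle Yu,u\rangle+\sum_{l}\langle L_lu,L_lu\rangle\le0$ for all $u\in D(Y)$. For $x\in\mathcal L(\mathfrak H)$ and $u,v\in D(Y)$: $\Upsilon(x)[v,u]=\langle v,xYu\rangle+\langle Yv,xu\rangle+\sum_l\langle L_lv,xL_lu\rangle$. A quantum dynamical semigroup on $\mathcal L(\mathfrak H)$ is a one-parameter semigroup $(\mathcal T(t))_{t\ge0}$ of bounded operators on $\mathcal L(\mathfrak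 H)$, $\mathcal T(0)=I$, with each $\mathcal T(t)$ completely positive and $\sigma$-weakly continuous, and $t\mapsto\mathcal T(t)x$ $\sigma$-weakly continuous for each $x$. It is conservative if $\mathcal T(t)\mathbf 1=\mathbf 1$ for all $t\ge0$. Its predual semigroup $(\mathcal S(t))_{t\ge0}$ on $\mathfrak T(\mathfrak H)$ is given by $\mathrm{Tr}((\mathcal S(t)\rho)x)=\mathrm{Tr}(\rho\,\mathcal T(t)x)$ and is a $C_0$-semigroup. Minimal quantum dynamical semigroup (existence known): the quantum dynamical semigroup $(T(t))_{t\ge0}$ with $T(t)\mathbf 1\le\mathbf 1$ satisfying (E) $\langle v,(T(t)x)u\rangle=\langle v,xu\rangle+\int_0^t\Upsilon(T(s)x)[v,u]\,ds$ for all $u,v\in D(Y)$, $x\in\mathcal L(\mathfrak H)$, $t\ge0$, which is minimal: $T(t)x\le U(t)x$ for all $x\in\mathcal L(\mathfrak H)_+$, $t\ge0$, and every quantum dynamical semigroup $U$ satisfying (E). Operators $A,B$: $A$ is the generator of the contraction $C_0$-semigroup $\rho\mapsto P(t)\rho P(t)^*$ on $\mathfrak T_s(\mathfrak H)$. Let $\pi(\rho)=R(1,Y)\rho R(1,Y)^*$ (injective) and $\mathcal D_s=\pi(\mathfrak T_s(\mathfrak H))$, a core for $A$. On $\mathcal D_s$ put $B\rho=\sum_lL_lR(1,Y)\,\pi^{-1}(\rho)\,(L_lR(1,Y))^*$ (trace norm convergent). $BR(1,A)|_{\mathcal D_s}$ extends uniquely to a bounded operator $J_1$ on $\mathfrak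 T_s(\mathfrak H)$, and $B$ is extended to $D(A)$ by $B\rho=J_1(I-A)\rho$. One has $B\rho\ge0$ and $\mathrm{Tr}(A\rho+B\rho)\le0$ for $\rho\in D(A)_+$. Honesty: the generator $G$ of $(S(t))_{t\ge0}$ (restricted to $\mathfrak T_s(\mathfrak H)$) extends $A+B$ and $R(\lambda,G)\rho=\sum_{k\ge0}R(\lambda,A)(BR(\lambda,A))^k\rho$ for $\lambda>0$ (i.e. $S$ is the perturbed semigroup of Kato's Theorem for $A,B$). Put $a(\rho)=-\mathrm{Tr}(A\rho+B\rho)$, $\rho\in D(A)$, and $\bar a(R(\lambda,G)\rho)=\sum_{k\ge0}a\big(R(\lambda,A)(BR(\lambda,A))^k\rho\big)$, $\rho\in\mathfrak T_s(\mathfrak H)$ (well defined on $D(G)$, independent of $\lambda>0$). $(S(t))_{t\ge0}$ is honest if $\|S(t)\rho\|_{tr}-\|\rho\|_{tr}=-\bar a\big(\int_0^tS(s)\rho\,ds\big)$ for all $t\ge0$, $0\le\rho\in\mathfrak T_s(\mathfrak H)$. *)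

theory Defs
  imports "HOL-Analysis.Analysis"
begin

section \<open>Complex Hilbert spaces\<close>

class complex_space = real_vector +
  fixes scaleC :: "complex \<Rightarrow> 'a \<Rightarrow> 'a"  (infixr \<open>*\<^sub>C\<close> 75)
  assumes scaleC_add_right: "a *\<^sub>C (x + y) = a *\<^sub>C x + a *\<^sub>C y"
    and scaleC_add_left: "(a + b) *\<^sub>C x = a *\<^sub>C x + b *\<^sub>C x"
    and scaleC_scaleC [simp]: "a *\<^sub>C b *\<^sub>C x = (a * b) *\<^sub>C x"
    and scaleC_of_real: "complex_of_real r *\<^sub>C x = r *\<^sub>R x"

class complex_hilbert = real_inner + complete_space + complex_space +
  fixes cinner :: "'a \<Rightarrow> 'a \<Rightarrow> complex"
  assumes cinner_commute: "cinner x y = cnj (cinner y x)"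
    and cinner_add_right: "cinner x (y + z) = cinner x y + cinner x z"
    and cinner_scaleC_right [simp]: "cinner x (c *\<^sub>C y) = c * cinner x y"
    and Re_cinner: "Re (cinner x y) = inner x y"

subclass (in complex_hilbert) banach ..

definition csubspace :: "'a::complex_space set \<Rightarrow> bool" where
  "csubspace D \<longleftrightarrow> 0 \<in> D \<and> (\<forall>x\<in>D. \<forall>y\<in>D. x + y \<in> D) \<and> (\<forall>c. \<forall>x\<in>D. c *\<^sub>C x \<in> D)"

definition bounded_clinear ::
    "('a::{complex_space, real_normed_vector} \<Rightarrow> 'b::{complex_space, real_normed_vector}) \<Rightarrow> bool" where
  "bounded_clinear f \<longleftrightarrow> bounded_linear f \<and> (\<forall>c x. f (c *\<^sub>C x) = c *\<^sub>C f x)"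

lemma scaleC_one [simp]: "1 *\<^sub>C (x::'a::complex_space) = x"
  using scaleC_of_real[of 1 x] by simp

lemma scaleC_zero_left [simp]: "0 *\<^sub>C (x::'a::complex_space) = 0"
  using scaleC_of_real[of 0 x] by simp

lemma scaleC_zero_right [simp]: "c *\<^sub>C (0::'a::complex_space) = 0"
  using scaleC_add_right[of c 0 0] by simp

lemma scaleC_minus_one: "(-1) *\<^sub>C (x::'a::complex_space) = - x"
  using scaleC_of_real[of "-1" x] by simp

lemma scaleC_minus_right: "c *\<^sub>C (- x) = - (c *\<^sub>C (x::'a::complex_space))"
  using scaleC_add_right[of c x "-x"] by (simp add: eq_neg_iff_add_eq_0 add.commute)

lemma cinner_add_left: "cinner (x + y) z = cinner x z + cinner (y::'a::complex_hilbert) z"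
  by (metis cinner_add_right cinner_commute complex_cnj_add)

lemma cinner_scaleC_left [simp]: "cinner (c *\<^sub>C x) y = cnj c * cinner (x::'a::complex_hilbert) y"
  by (metis cinner_commute cinner_scaleC_right complex_cnj_mult)

lemma cinner_scaleR_right [simp]: "cinner x (r *\<^sub>R y) = of_real r * cinner (x::'a::complex_hilbert) y"
  by (metis cinner_scaleC_right scaleC_of_real)

lemma cinner_scaleR_left [simp]: "cinner (r *\<^sub>R x) y = of_real r * cinner (x::'a::complex_hilbert) y"
  by (metis cinner_scaleC_left scaleC_of_real complex_cnj_complex_of_real)

lemma cinner_zero_right [simp]: "cinner x (0::'a::complex_hilbert) = 0"
  using cinner_scaleC_right[of x 0 0] by simp

lemma cinner_zero_left [simp]: "cinner (0::'a::complex_hilbert) x = 0"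
  using cinner_scaleC_left[of 0 0 x] by simp

lemma cinner_minus_right [simp]: "cinner x (- y) = - cinner (x::'a::complex_hilbert) y"
  using cinner_scaleC_right[of x "-1" y] by (simp add: scaleC_minus_one)

lemma cinner_minus_left [simp]: "cinner (- x) y = - cinner (x::'a::complex_hilbert) y"
  using cinner_scaleC_left[of "-1" x y] by (simp add: scaleC_minus_one)

lemma cinner_diff_right: "cinner x (y - z) = cinner x y - cinner (x::'a::complex_hilbert) z"
  using cinner_add_right[of x y "-z"] by simp

lemma cinner_diff_left: "cinner (x - y) z = cinner x z - cinner (y::'a::complex_hilbert) z"
  using cinner_add_left[of x "-y" z] by simp

lemma cinner_self: "cinner x x = of_real ((norm (x::'a::complex_hilbert))\<^sup>2)"
proof -
  have "Im (cinner x x) = 0"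
    using cinner_commute[of x x] by (simp add: complex_eq_iff)
  then show ?thesis
    by (simp add: complex_eq_iff Re_cinner power2_norm_eq_inner)
qed

lemma Im_cinner: "Im (cinner x y) = inner (\<i> *\<^sub>C x) (y::'a::complex_hilbert)"
  by (simp add: Re_cinner[symmetric])

lemma norm_scaleC [simp]: "norm (c *\<^sub>C x) = cmod c * norm (x::'a::complex_hilbert)"
proof -
  have "complex_of_real ((norm (c *\<^sub>C x))\<^sup>2) = (cnj c * c) * of_real ((norm x)\<^sup>2)"
    unfolding cinner_self[symmetric] by simp
  also have "\<dots> = of_real ((cmod c * norm x)\<^sup>2)"
    using complex_norm_square[of c] by (simp add: power_mult_distrib mult.commute)
  finally have "(norm (c *\<^sub>C x))\<^sup>2 = (cmod c * norm x)\<^sup>2"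
    unfolding of_real_eq_iff .
  then show ?thesis
    by (rule power2_eq_imp_eq) auto
qed

lemma cinner_Cauchy_Schwarz: "cmod (cinner x y) \<le> norm x * norm (y::'a::complex_hilbert)"
proof (cases "cinner x y = 0")
  case False
  define c where "c = cnj (cinner x y) / of_real (cmod (cinner x y))"
  have c: "cmod c = 1" using False by (simp add: c_def norm_divide)
  have "c * cinner x y = of_real (cmod (cinner x y))"
    using False complex_norm_square[of "cinner x y"]
    by (simp add: c_def field_simps power2_eq_square)
  then have "cmod (cinner x y) = Re (cinner x (c *\<^sub>C y))"
    by simp
  also have "\<dots> \<le> norm x * norm (c *\<^sub>C y)"
    unfolding Re_cinner by (rule norm_cauchy_schwarz)
  finally show ?thesis by (simp add: c)
qed simp

lemma bounded_bilinear_cinner: "bounded_bilinear (cinner :: 'a::complex_hilbert \<Rightarrow> 'a \<Rightarrow> complex)"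
  by unfold_locales
     (auto simp: cinner_add_left cinner_add_right scaleR_conv_of_real
        intro!: exI[of _ 1] cinner_Cauchy_Schwarz)

lemma bounded_linear_scaleC: "bounded_linear (\<lambda>x::'a::complex_hilbert. c *\<^sub>C x)"
  by (rule bounded_linear_intro[where K = "cmod c"])
     (auto simp: scaleC_add_right mult.commute simp flip: scaleC_of_real)

lemmas tendsto_cinner [tendsto_intros] = bounded_bilinear.tendsto[OF bounded_bilinear_cinner]
lemmas tendsto_scaleC [tendsto_intros] = bounded_linear.tendsto[OF bounded_linear_scaleC]
lemmas continuous_on_cinner [continuous_intros] = bounded_bilinear.continuous_on[OF bounded_bilinear_cinner]
lemmas cinner_sum_left = bounded_bilinear.sum_left[OF bounded_bilinear_cinner]
lemmas cinner_sum_right = bounded_bilinear.sum_right[OF bounded_bilinear_cinner]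

lemma Riesz_real:
  fixes \<phi> :: "'a::complex_hilbert \<Rightarrow> real"
  assumes "bounded_linear \<phi>"
  obtains z where "\<And>u. \<phi> u = inner z u"
proof -
  interpret bounded_linear \<phi> by fact
  obtain K where K: "K > 0" "\<And>u. norm (\<phi> u) \<le> norm u * K"
    using pos_bounded by blast
  define J where "J u = (norm u)\<^sup>2 / 2 - \<phi> u" for u
  have Jlow: "J u \<ge> - (K\<^sup>2 / 2)" for u
  proof -
    have "0 \<le> (norm u - K)\<^sup>2 / 2" by simp
    also have "\<dots> = (norm u)\<^sup>2 / 2 - norm u * K + K\<^sup>2 / 2"
      by (simp add: power2_eq_square field_simps)
    finally show ?thesis using K(2)[of u] by (simp add: J_def)
  qed
  define m where "m = Inf (range J)"
  have bdd: "bdd_below (range J)" using Jlow by (auto intro!: bdd_belowI)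
  have mle: "m \<le> J u" for u unfolding m_def by (rule cInf_lower[OF _ bdd]) auto
  have "\<exists>u. J u < m + 1 / real (Suc n)" for n
  proof -
    have "Inf (range J) < m + 1 / real (Suc n)" unfolding m_def by simp
    then show ?thesis by (subst (asm) cInf_less_iff[OF _ bdd]) auto
  qed
  then obtain w where w: "\<And>n. J (w n) < m + 1 / real (Suc n)" by metis
  have par: "(norm (x - y))\<^sup>2 / 4 = J x + J y - 2 * J ((1/2) *\<^sub>R (x + y))" for x y
    by (simp add: J_def power2_norm_eq_inner scaleR add inner_add_left inner_add_right
        inner_diff_left inner_diff_right inner_commute field_simps)
  have wd: "(norm (w i - w j))\<^sup>2 \<le> 4 * (1 / real (Suc i) + 1 / real (Suc j))" for i j
    using par[of "w i" "w j"] w[of i] w[of j] mle[of "(1/2) *\<^sub>R (w i + w j)"] by simp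
  have "Cauchy w"
  proof (rule metric_CauchyI)
    fix e :: real assume "e > 0"
    then obtain N where N: "1 / real (Suc N) < e\<^sup>2 / 8"
      using nat_approx_posE[of "e\<^sup>2 / 8"] by auto
    show "\<exists>M. \<forall>i\<ge>M. \<forall>j\<ge>M. dist (w i) (w j) < e"
    proof (intro exI[of _ N] allI impI)
      fix i j assume ij: "i \<ge> N" "j \<ge> N"
      have "1 / real (Suc i) \<le> 1 / real (Suc N)" "1 / real (Suc j) \<le> 1 / real (Suc N)"
        using ij by (auto simp: field_simps)
      moreover have "x \<le> 4 * (a + b) \<Longrightarrow> a \<le> c \<Longrightarrow> b \<le> c \<Longrightarrow> c < y / 8 \<Longrightarrow> x < y" for a b c x y :: real
        by simp
      ultimately have "(norm (w i - w j))\<^sup>2 < e\<^sup>2" using wd[of i j] N by blast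
      then show "dist (w i) (w j) < e"
        using \<open>e > 0\<close> by (simp add: dist_norm power2_less_imp_less)
    qed
  qed
  then obtain z where z: "w \<longlonglongrightarrow> z" by (auto simp: Cauchy_convergent_iff convergent_def)
  have "(\<lambda>n. J (w n)) \<longlonglongrightarrow> J z"
    unfolding J_def by (intro tendsto_intros tendsto z) auto
  moreover have "(\<lambda>n. m + 1 / real (Suc n)) \<longlonglongrightarrow> m + 0"
    by (intro tendsto_intros LIMSEQ_Suc lim_1_over_n)
  ultimately have Jz: "J z \<le> m"
    using LIMSEQ_le[of "\<lambda>n. J (w n)" "J z" "\<lambda>n. m + 1 / real (Suc n)" "m + 0"] w
    by (auto intro: less_imp_le)
  have "\<phi> u = inner z u" for u
  proof (rule ccontr)
    define d where "d = inner z u - \<phi> u"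
    assume "\<phi> u \<noteq> inner z u"
    then have d: "d \<noteq> 0" by (simp add: d_def)
    have u: "norm u > 0" using d by (auto simp: d_def zero)
    have "J (z + t *\<^sub>R u) = J z + t * d + t\<^sup>2 * (norm u)\<^sup>2 / 2" for t
    proof -
      have "(norm (z + t *\<^sub>R u))\<^sup>2 = (norm z)\<^sup>2 + 2 * t * inner z u + t\<^sup>2 * (norm u)\<^sup>2"
        unfolding power2_norm_eq_inner
        by (simp add: inner_add_left inner_add_right inner_commute power2_eq_square algebra_simps)
      then show ?thesis
        by (simp add: J_def d_def add scaleR field_simps)
    qed
    then have "0 \<le> t * d + t\<^sup>2 * (norm u)\<^sup>2 / 2" for t
      using mle[of "z + t *\<^sub>R u"] Jz by (smt (verit))
    from this[of "- d / (norm u)\<^sup>2"] have "0 \<le> - (d\<^sup>2 / (norm u)\<^sup>2) / 2"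
      using u by (simp add: field_simps power2_eq_square)
    then show False using d u by (simp add: field_simps)
  qed
  then show ?thesis by (rule that)
qed

section \<open>Bounded operators\<close>

typedef (overloaded) 'a bop = "{f :: 'a::complex_hilbert \<Rightarrow> 'a. bounded_clinear f}"
  morphisms bop_apply Bop
  by (auto simp: bounded_clinear_def intro!: exI[of _ "\<lambda>x. x"] bounded_linear_intros)

setup_lifting type_definition_bop

declare [[coercion "bop_apply :: 'a::complex_hilbert bop \<Rightarrow> 'a \<Rightarrow> 'a"]]

lemma bop_eqI: "(\<And>u. bop_apply x u = bop_apply y u) \<Longrightarrow> x = y"
  by transfer auto

lemma bop_linear: "bounded_linear (bop_apply x)"
  by transfer (simp add: bounded_clinear_def)

lemma bop_scaleC [simp]: "bop_apply x (c *\<^sub>C u) = c *\<^sub>C bop_apply x u"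
  by transfer (simp add: bounded_clinear_def)

instantiation bop :: (complex_hilbert) real_normed_vector
begin

lift_definition zero_bop :: "'a bop" is "\<lambda>u. 0"
  by (simp add: bounded_clinear_def)
lift_definition plus_bop :: "'a bop \<Rightarrow> 'a bop \<Rightarrow> 'a bop" is "\<lambda>f g u. f u + g u"
  by (simp add: bounded_clinear_def bounded_linear_add scaleC_add_right)
lift_definition uminus_bop :: "'a bop \<Rightarrow> 'a bop" is "\<lambda>f u. - f u"
  by (simp add: bounded_clinear_def bounded_linear_minus scaleC_minus_right)
definition minus_bop :: "'a bop \<Rightarrow> 'a bop \<Rightarrow> 'a bop" where "minus_bop x y = x + - y"
lift_definition scaleR_bop :: "real \<Rightarrow> 'a bop \<Rightarrow> 'a bop" is "\<lambda>r f u. r *\<^sub>R f u"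
  unfolding bounded_clinear_def
  by (auto simp: mult.commute bounded_linear_const_scaleR simp flip: scaleC_of_real
      intro: bounded_linear_compose[OF bounded_linear_scaleC])
lift_definition norm_bop :: "'a bop \<Rightarrow> real" is onorm .
definition dist_bop :: "'a bop \<Rightarrow> 'a bop \<Rightarrow> real" where "dist_bop x y = norm (x - y)"
definition sgn_bop :: "'a bop \<Rightarrow> 'a bop" where "sgn_bop x = inverse (norm x) *\<^sub>R x"
definition uniformity_bop :: "('a bop \<times> 'a bop) filter" where
  "uniformity_bop = (INF e\<in>{0<..}. principal {(x, y). dist x y < e})"
definition open_bop :: "'a bop set \<Rightarrow> bool" where
  "open_bop S = (\<forall>x\<in>S. \<forall>\<^sub>F (x', y) in uniformity. x' = x \<longrightarrow> y \<in> S)"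

instance
proof
  fix x y :: "'a bop" and r :: real
  show "norm x = 0 \<longleftrightarrow> x = 0"
    by transfer (auto simp: bounded_clinear_def onorm_eq_0)
  show "norm (x + y) \<le> norm x + norm y"
    by transfer (auto simp: bounded_clinear_def onorm_triangle)
  show "norm (r *\<^sub>R x) = \<bar>r\<bar> * norm x"
    by transfer (auto simp: bounded_clinear_def onorm_scaleR)
qed (unfold dist_bop_def open_bop_def sgn_bop_def uniformity_bop_def minus_bop_def,
     (rule refl | (transfer, force simp: algebra_simps))+)

end

instantiation bop :: (complex_hilbert) complex_space
begin

lift_definition scaleC_bop :: "complex \<Rightarrow> 'a bop \<Rightarrow> 'a bop" is "\<lambda>c f u. c *\<^sub>C f u"
  by (auto simp: bounded_clinear_def mult.commute
      intro: bounded_linear_compose[OF bounded_linear_scaleC])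

instance
  by standard (transfer, simp add: scaleC_add_right scaleC_add_left scaleC_of_real)+

end

text \<open>The multiplicative unit cannot be provided through \<^class>\<open>ring_1\<close>, because the Hilbert space
  is allowed to be the zero space.\<close>

instantiation bop :: (complex_hilbert) "{real_normed_algebra, monoid_mult}"
begin

lift_definition times_bop :: "'a bop \<Rightarrow> 'a bop \<Rightarrow> 'a bop" is "\<lambda>f g u. f (g u)"
  by (auto simp: bounded_clinear_def intro: bounded_linear_compose)
lift_definition one_bop :: "'a bop" is "\<lambda>u. u"
  by (auto simp: bounded_clinear_def)

instance
proof
  fix x y :: "'a bop"
  show "norm (x * y) \<le> norm x * norm y"
    by transfer (auto simp: bounded_clinear_def onorm_compose[unfolded o_def])
qed (transfer, force simp: bounded_clinear_def linear_simps)+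

end

lemma bop_zero_apply [simp]: "bop_apply 0 u = 0" by transfer simp
lemma bop_one_apply [simp]: "bop_apply 1 u = u" by transfer simp
lemma bop_add_apply [simp]: "bop_apply (x + y) u = x u + y u" by transfer simp
lemma bop_uminus_apply [simp]: "bop_apply (- x) u = - x u" by transfer simp
lemma bop_diff_apply [simp]: "bop_apply (x - y) u = x u - y u"
  unfolding minus_bop_def bop_add_apply bop_uminus_apply by simp
lemma bop_times_apply [simp]: "bop_apply (x * y) u = x (y u)" by transfer simp
lemma bop_scaleR_apply [simp]: "bop_apply (r *\<^sub>R x) u = r *\<^sub>R x u" by transfer simp
lemma bop_scaleC_apply [simp]: "bop_apply (c *\<^sub>C x) u = c *\<^sub>C x u" by transfer simp

lemma norm_bop: "norm (bop_apply x u) \<le> norm x * norm u"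
  by transfer (simp add: bounded_clinear_def onorm)

lemma norm_bop_bound: "0 \<le> b \<Longrightarrow> (\<And>u. norm (bop_apply x u) \<le> b * norm u) \<Longrightarrow> norm x \<le> b"
  by transfer (rule onorm_bound)

lemma bounded_bilinear_bop_apply: "bounded_bilinear bop_apply"
  by unfold_locales (auto simp: linear_simps[OF bop_linear] intro!: exI[of _ 1] norm_bop)

lemmas bop_simps = linear_simps[OF bop_linear]
lemmas tendsto_bop_apply [tendsto_intros] = bounded_bilinear.tendsto[OF bounded_bilinear_bop_apply]
lemmas continuous_on_bop_apply [continuous_intros] =
  bounded_bilinear.continuous_on[OF bounded_bilinear_bop_apply]

instance bop :: (complex_hilbert) banach
proof
  fix X :: "nat \<Rightarrow> 'a bop"
  assume X: "Cauchy X"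
  have lin: "bounded_linear (bop_apply (X n))" for n by (rule bop_linear)
  define B where "B n = Blinfun (bop_apply (X n))" for n
  have B: "blinfun_apply (B n) u = X n u" for n u
    by (simp add: B_def bounded_linear_Blinfun_apply lin)
  have nB: "norm (B m - B n) \<le> norm (X m - X n)" for m n
    by (rule norm_blinfun_bound) (auto simp: blinfun.diff_left B norm_bop simp flip: bop_diff_apply)
  have "Cauchy B"
    using X nB unfolding Cauchy_iff by (meson le_less_trans)
  then obtain b where b: "B \<longlonglongrightarrow> b" by (auto simp: Cauchy_convergent_iff convergent_def)
  have bu: "(\<lambda>n. X n u) \<longlonglongrightarrow> b u" for u
    using blinfun.tendsto[OF b tendsto_const[of u]] by (simp add: B)
  have "b (c *\<^sub>C u) = c *\<^sub>C b u" for c u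
    using bu[of "c *\<^sub>C u"] tendsto_scaleC[OF bu[of u], of c]
    by (auto intro: LIMSEQ_unique)
  then have cl: "bounded_clinear b" by (simp add: bounded_clinear_def blinfun.bounded_linear_right)
  have Bb: "bop_apply (Bop b) u = b u" for u using cl by (simp add: Bop_inverse)
  have "norm (X n - Bop b) \<le> norm (B n - b)" for n
    by (rule norm_bop_bound) (auto simp: Bb norm_blinfun simp flip: B blinfun.diff_left)
  moreover have "(\<lambda>n. norm (B n - b)) \<longlonglongrightarrow> 0"
    using b by (simp add: LIM_zero tendsto_norm_zero)
  ultimately have "(\<lambda>n. X n - Bop b) \<longlonglongrightarrow> 0"
    by (intro Lim_null_comparison[of "\<lambda>n. X n - Bop b" "\<lambda>n. norm (B n - b)"] always_eventually) auto
  then have "X \<longlonglongrightarrow> Bop b" by (rule LIM_zero_cancel)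
  then show "convergent X" by (auto simp: convergent_def)
qed

definition adj :: "'a::complex_hilbert bop \<Rightarrow> 'a bop"  (\<open>(_\<^sup>\<dagger>)\<close> [1000] 1000) where
  "x\<^sup>\<dagger> = (THE y. \<forall>u v. cinner v (bop_apply y u) = cinner (x v) u)"

lemma cinner_extI: "(\<And>v. cinner v x = cinner v y) \<Longrightarrow> x = (y::'a::complex_hilbert)"
proof -
  assume "\<And>v. cinner v x = cinner v y"
  then have "cinner (x - y) (x - y) = 0" by (simp add: cinner_diff_right)
  then show ?thesis by (simp add: cinner_self)
qed

lemma adj_ex: "\<exists>y. \<forall>u v. cinner v (bop_apply y u) = cinner (bop_apply x v) u"
proof -
  have "\<exists>z. \<forall>v. cinner v z = cinner (x v) u" for u
  proof -
    have "bounded_linear (\<lambda>v. inner (x v) u)"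
      by (intro bounded_linear_intros bop_linear bounded_linear_compose[OF bounded_linear_inner_left bop_linear])
    then obtain z where z: "\<And>v. inner (x v) u = inner z v"
      by (rule Riesz_real) blast
    have "cinner v z = cinner (x v) u" for v
      using z[of v] z[of "\<i> *\<^sub>C v"]
      by (simp add: complex_eq_iff Re_cinner Im_cinner inner_commute)
    then show ?thesis by blast
  qed
  then obtain f where f: "\<And>u v. cinner v (f u) = cinner (x v) u" by metis
  have fadd: "f (u + w) = f u + f w" for u w
    by (rule cinner_extI) (simp add: f cinner_add_right)
  have fC: "f (c *\<^sub>C u) = c *\<^sub>C f u" for c u
    by (rule cinner_extI) (simp add: f)
  have fR: "f (r *\<^sub>R u) = r *\<^sub>R f u" for r u
    by (rule cinner_extI) (simp add: f)
  have "norm (f u) \<le> norm u * norm x" for u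
  proof (cases "f u = 0")
    case False
    have "(norm (f u))\<^sup>2 = cmod (cinner (x (f u)) u)"
      unfolding f[symmetric] cinner_self by (simp flip: of_real_power)
    also have "\<dots> \<le> norm (x (f u)) * norm u" by (rule cinner_Cauchy_Schwarz)
    also have "\<dots> \<le> norm x * norm (f u) * norm u" by (intro mult_right_mono norm_bop) auto
    finally show ?thesis using False by (simp add: power2_eq_square mult_ac)
  qed simp
  then have "bounded_clinear f"
    by (auto simp: bounded_clinear_def fC intro!: bounded_linear_intro[where K = "norm x"] fadd fR)
  then have "\<forall>u v. cinner v (bop_apply (Bop f) u) = cinner (x v) u"
    by (simp add: Bop_inverse f)
  then show ?thesis by blast
qed

lemma adj: "cinner v (x\<^sup>\<dagger> u) = cinner (bop_apply x v) u"
proof -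
  have "\<exists>!y. \<forall>u v. cinner v (bop_apply y u) = cinner (x v) u"
  proof (rule ex_ex1I[OF adj_ex])
    fix y z assume "\<forall>u v. cinner v (bop_apply y u) = cinner (x v) u"
      "\<forall>u v. cinner v (bop_apply z u) = cinner (x v) u"
    then show "y = z" by (intro bop_eqI cinner_extI) simp
  qed
  from theI'[OF this] show ?thesis by (simp add: adj_def)
qed

lemma adj': "cinner (x\<^sup>\<dagger> u) v = cinner u (bop_apply x v)"
  by (metis adj cinner_commute)

lemma adj_eqI: "(\<And>u v. cinner v (bop_apply y u) = cinner (bop_apply x v) u) \<Longrightarrow> x\<^sup>\<dagger> = y"
  by (intro bop_eqI cinner_extI) (simp add: adj)

lemma adj_adj [simp]: "x\<^sup>\<dagger>\<^sup>\<dagger> = (x :: 'a::complex_hilbert bop)"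
  by (rule adj_eqI) (simp add: adj')

lemma adj_mult [simp]: "(x * y)\<^sup>\<dagger> = y\<^sup>\<dagger> * (x\<^sup>\<dagger> :: 'a::complex_hilbert bop)"
  by (rule adj_eqI) (simp add: adj)

lemma adj_add [simp]: "(x + y)\<^sup>\<dagger> = x\<^sup>\<dagger> + (y\<^sup>\<dagger> :: 'a::complex_hilbert bop)"
  by (rule adj_eqI) (simp add: adj cinner_add_left cinner_add_right)

lemma adj_minus [simp]: "(- x)\<^sup>\<dagger> = - (x\<^sup>\<dagger> :: 'a::complex_hilbert bop)"
  by (rule adj_eqI) (simp add: adj)

lemma adj_diff [simp]: "(x - y)\<^sup>\<dagger> = x\<^sup>\<dagger> - (y\<^sup>\<dagger> :: 'a::complex_hilbert bop)"
  by (rule adj_eqI) (simp add: adj cinner_diff_left cinner_diff_right)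

lemma adj_scaleR [simp]: "(r *\<^sub>R x)\<^sup>\<dagger> = r *\<^sub>R (x\<^sup>\<dagger> :: 'a::complex_hilbert bop)"
  by (rule adj_eqI) (simp add: adj)

lemma adj_one [simp]: "(1 :: 'a::complex_hilbert bop)\<^sup>\<dagger> = 1"
  by (rule adj_eqI) simp

lemma adj_zero [simp]: "(0 :: 'a::complex_hilbert bop)\<^sup>\<dagger> = 0"
  by (rule adj_eqI) simp

definition selfadjoint :: "'a::complex_hilbert bop \<Rightarrow> bool" where
  "selfadjoint x \<longleftrightarrow> x\<^sup>\<dagger> = x"

lemma selfadjoint_cinner: "selfadjoint x \<Longrightarrow> cinner u (bop_apply x v) = cinner (bop_apply x u) v"
  by (metis adj selfadjoint_def)

lemma selfadjointI: "(\<And>u v. cinner u (bop_apply x v) = cinner (bop_apply x u) v) \<Longrightarrow> selfadjoint x"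
  by (simp add: selfadjoint_def adj_eqI)

lemma bop_polarization_selfadjoint:
  assumes "\<And>u. cinner u (bop_apply a u) \<in> \<real>"
  shows "selfadjoint a"
proof (rule selfadjointI)
  fix u v
  have *: "cinner w (a w) = cinner (a w) w" for w
    using assms[of w] by (metis Reals_cnj_iff cinner_commute)
  have "cinner u (a v) + cinner v (a u) = cinner (a v) u + cinner (a u) v"
    using *[of "u + v"] *[of u] *[of v] by (simp add: bop_simps cinner_add_left cinner_add_right add.commute)
  moreover have "\<i> * (cinner u (a v) - cinner v (a u)) = \<i> * (cinner (a u) v - cinner (a v) u)"
    using *[of "u + \<i> *\<^sub>C v"] *[of u] *[of v]
    by (simp add: bop_simps cinner_add_left cinner_add_right algebra_simps)
  ultimately show "cinner u (a v) = cinner (a u) v" by (simp add: complex_eq_iff)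
qed

lemma bop_polarization_zero:
  assumes "\<And>u. cinner u (bop_apply a u) = 0"
  shows "a = 0"
proof (intro bop_eqI cinner_extI)
  fix u v
  have "cinner u (a v) + cinner v (a u) = 0"
    using assms[of "u + v"] assms[of u] assms[of v]
    by (simp add: bop_simps cinner_add_left cinner_add_right add.commute)
  moreover have "\<i> * (cinner u (a v) - cinner v (a u)) = 0"
    using assms[of "u + \<i> *\<^sub>C v"] assms[of u] assms[of v]
    by (simp add: bop_simps cinner_add_left cinner_add_right algebra_simps)
  ultimately show "cinner v (a u) = cinner v ((0::'a bop) u)" by simp
qed

instantiation bop :: (complex_hilbert) ordered_real_vector
begin

definition less_eq_bop :: "'a bop \<Rightarrow> 'a bop \<Rightarrow> bool" where
  "x \<le> y \<longleftrightarrow> (\<forall>u. cinner u (bop_apply (y - x) u) \<in> \<real>\<^sub>\<ge>\<^sub>0)"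
definition less_bop :: "'a bop \<Rightarrow> 'a bop \<Rightarrow> bool" where
  "x < (y :: 'a bop) \<longleftrightarrow> x \<le> y \<and> \<not> y \<le> x"

instance
proof
  fix x y z :: "'a bop" and a b :: real
  show "(x < y) = (x \<le> y \<and> \<not> y \<le> x)" by (rule less_bop_def)
  show "x \<le> x" by (simp add: less_eq_bop_def)
  show "x \<le> z" if "x \<le> y" "y \<le> z"
  proof -
    have "cinner u ((z - x) u) = cinner u ((z - y) u) + cinner u ((y - x) u)" for u
      by (simp add: cinner_diff_right)
    then show ?thesis using that
      by (auto simp: less_eq_bop_def simp del: bop_diff_apply intro!: nonneg_Reals_add_I)
  qed
  show "x = y" if "x \<le> y" "y \<le> x"
  proof -
    have "cinner u ((x - y) u) = 0" for u
    proof -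
      have "cinner u ((x - y) u) \<in> \<real>\<^sub>\<ge>\<^sub>0" "- cinner u ((x - y) u) \<in> \<real>\<^sub>\<ge>\<^sub>0"
        using that unfolding less_eq_bop_def by (simp_all add: cinner_diff_right)
      then show ?thesis by (simp add: complex_nonneg_Reals_iff complex_eq_iff)
    qed
    then have "x - y = 0" by (rule bop_polarization_zero)
    then show ?thesis by simp
  qed
  show "x \<le> y \<Longrightarrow> z + x \<le> z + y" by (simp add: less_eq_bop_def)
  have *: "of_real r * z \<in> \<real>\<^sub>\<ge>\<^sub>0" if "0 \<le> r" "z \<in> \<real>\<^sub>\<ge>\<^sub>0" for r :: real and z :: complex
    using that by (auto intro: nonneg_Reals_mult_I)
  show "a *\<^sub>R x \<le> a *\<^sub>R y" if "x \<le> y" "0 \<le> a"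
  proof -
    have "cinner u ((a *\<^sub>R y - a *\<^sub>R x) u) = of_real a * cinner u ((y - x) u)" for u
      by (simp add: cinner_diff_right algebra_simps)
    then show ?thesis using that * by (simp add: less_eq_bop_def)
  qed
  show "a *\<^sub>R x \<le> b *\<^sub>R x" if "a \<le> b" "0 \<le> x"
  proof -
    have "cinner u ((b *\<^sub>R x - a *\<^sub>R x) u) = of_real (b - a) * cinner u ((x - 0) u)" for u
      by (simp add: cinner_diff_right algebra_simps)
    then show ?thesis using that * by (simp add: less_eq_bop_def del: of_real_diff)
  qed
qed

end

lemma bop_pos_iff: "0 \<le> x \<longleftrightarrow> (\<forall>u. cinner u (bop_apply x u) \<in> \<real>\<^sub>\<ge>\<^sub>0)"
  by (simp add: less_eq_bop_def)

lemma bop_pos_selfadjoint: "0 \<le> x \<Longrightarrow> selfadjoint x"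
  by (rule bop_polarization_selfadjoint)
     (use nonneg_Reals_subset_Reals in \<open>unfold bop_pos_iff, blast\<close>)

lemma bop_posI: "selfadjoint x \<Longrightarrow> (\<And>u. 0 \<le> inner u (bop_apply x u)) \<Longrightarrow> 0 \<le> x"
proof -
  assume x: "selfadjoint x" and pos: "\<And>u. 0 \<le> inner u (bop_apply x u)"
  have "Im (cinner u (x u)) = 0" for u
    using arg_cong[OF selfadjoint_cinner[OF x, of u u], of Im]
      arg_cong[OF cinner_commute[of u "x u"], of Im] unfolding cnj.sel by linarith
  then show ?thesis
    using pos by (simp add: bop_pos_iff complex_nonneg_Reals_iff Re_cinner)
qed

lemma bop_pos_inner: "0 \<le> x \<Longrightarrow> 0 \<le> inner u (bop_apply x u)"
  by (simp add: bop_pos_iff complex_nonneg_Reals_iff Re_cinner[symmetric])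

lemma bop_le_inner: "x \<le> y \<Longrightarrow> inner u (bop_apply x u) \<le> inner u (bop_apply y u)"
  using bop_pos_inner[of "y - x" u] by (simp add: inner_diff_right)

lemma bop_sandwich_pos:
  assumes "0 \<le> p" shows "0 \<le> x * p * (x\<^sup>\<dagger> :: 'a::complex_hilbert bop)"
proof -
  have "cinner u ((x * p * x\<^sup>\<dagger>) u) = cinner (x\<^sup>\<dagger> u) (p (x\<^sup>\<dagger> u))" for u
    by (simp add: adj')
  then show ?thesis using assms by (simp add: bop_pos_iff)
qed

section \<open>Orthonormal bases\<close>

definition orthonormal :: "'a::complex_hilbert set \<Rightarrow> bool" where
  "orthonormal E \<longleftrightarrow> (\<forall>e\<in>E. \<forall>f\<in>E. cinner e f = (if e = f then 1 else 0))"

definition is_onb :: "'a::complex_hilbert set \<Rightarrow> bool" where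
  "is_onb E \<longleftrightarrow> orthonormal E \<and> (\<forall>u. (\<forall>e\<in>E. cinner e u = 0) \<longrightarrow> u = 0)"

lemma orthonormal_extend:
  fixes M :: "'a::complex_hilbert set"
  assumes "orthonormal E0" "E0 \<subseteq> M" "csubspace M"
  obtains E where "E0 \<subseteq> E" "E \<subseteq> M" "orthonormal E" "\<And>u. u \<in> M \<Longrightarrow> (\<And>e. e \<in> E \<Longrightarrow> cinner e u = 0) \<Longrightarrow> u = 0"
proof -
  define A where "A = {E. E0 \<subseteq> E \<and> E \<subseteq> M \<and> orthonormal E}"
  have "\<exists>E\<in>A. \<forall>X\<in>A. E \<subseteq> X \<longrightarrow> X = E"
  proof (rule subset_Zorn_nonempty)
    show "A \<noteq> {}" using assms by (auto simp: A_def)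
    fix C assume C: "C \<noteq> {}" "subset.chain A C"
    have "cinner e f = (if e = f then 1 else 0)" if ef: "e \<in> \<Union>C" "f \<in> \<Union>C" for e f
    proof -
      from ef obtain X Y where XY: "e \<in> X" "X \<in> C" "f \<in> Y" "Y \<in> C" by auto
      with C have "X \<subseteq> Y \<or> Y \<subseteq> X" by (auto simp: subset_chain_def)
      then obtain Z where "Z \<in> C" "e \<in> Z" "f \<in> Z" using XY by blast
      moreover have "orthonormal Z" using \<open>Z \<in> C\<close> C by (auto simp: subset_chain_def A_def)
      ultimately show ?thesis by (simp add: orthonormal_def)
    qed
    then have "orthonormal (\<Union>C)" by (simp add: orthonormal_def)
    moreover have "E0 \<subseteq> \<Union>C" "\<Union>C \<subseteq> M"
      using C by (fastforce simp: subset_chain_def A_def)+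
    ultimately show "\<Union>C \<in> A" by (simp add: A_def)
  qed
  then obtain E where E: "E \<in> A" "\<And>X. X \<in> A \<Longrightarrow> E \<subseteq> X \<Longrightarrow> X = E" by blast
  have "u = 0" if u: "u \<in> M" "\<And>e. e \<in> E \<Longrightarrow> cinner e u = 0" for u
  proof (rule ccontr)
    assume "u \<noteq> 0"
    define e where "e = complex_of_real (1 / norm u) *\<^sub>C u"
    have ee: "cinner e e = 1"
      using \<open>u \<noteq> 0\<close> unfolding e_def scaleC_of_real cinner_self by simp
    have "cinner f e = 0" "cinner e f = 0" if "f \<in> E" for f
      using u(2)[OF that] cinner_commute[of u f] by (simp_all add: e_def)
    moreover have "orthonormal E" using E by (simp add: A_def)
    ultimately have "orthonormal (insert e E)" using ee by (auto simp: orthonormal_def)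
    moreover have "e \<in> M" using u assms(3) by (simp add: e_def csubspace_def)
    ultimately have "insert e E \<in> A" using E(1) by (auto simp: A_def)
    then have "e \<in> E" using E(2)[of "insert e E"] by blast
    then have "cinner e e = 0" using u(2)[of e] by (simp add: e_def)
    then show False using ee by simp
  qed
  then show ?thesis using E(1) by (intro that[of E]) (auto simp: A_def)
qed

lemma csubspace_UNIV [simp]: "csubspace UNIV"
  by (simp add: csubspace_def)

lemma onb_extend:
  assumes "orthonormal (E0 :: 'a::complex_hilbert set)"
  obtains E where "E0 \<subseteq> E" "is_onb E"
  using orthonormal_extend[OF assms subset_UNIV csubspace_UNIV] unfolding is_onb_def by (metis UNIV_I)

lemma onb_exists: "\<exists>E :: 'a::complex_hilbert set. is_onb E"
  using onb_extend[of "{} :: 'a set"] by (auto simp: orthonormal_def)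

lemma orthonormal_subset: "orthonormal E \<Longrightarrow> F \<subseteq> E \<Longrightarrow> orthonormal F"
  unfolding orthonormal_def by (meson subsetD)

lemma cinner_orthonormal_sum:
  assumes "orthonormal E" "finite F" "F \<subseteq> E" "e \<in> E"
  shows "cinner e (\<Sum>f\<in>F. c f *\<^sub>C f) = (if e \<in> F then c e else 0)"
proof -
  have "cinner e (\<Sum>f\<in>F. c f *\<^sub>C f) = (\<Sum>f\<in>F. if f = e then c e else 0)"
    unfolding cinner_sum_right
    using assms by (intro sum.cong refl) (auto simp: orthonormal_def subset_iff)
  then show ?thesis using assms by (simp add: sum.delta)
qed

lemma norm_orthonormal_sum:
  assumes "orthonormal E" "finite F" "F \<subseteq> E"
  shows "(norm (\<Sum>f\<in>F. c f *\<^sub>C f))\<^sup>2 = (\<Sum>f\<in>F. (cmod (c f))\<^sup>2)"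
proof -
  let ?v = "\<Sum>f\<in>F. c f *\<^sub>C f"
  have "complex_of_real ((norm ?v)\<^sup>2) = (\<Sum>f\<in>F. cinner (c f *\<^sub>C f) ?v)"
    unfolding cinner_self[symmetric] cinner_sum_left ..
  also have "\<dots> = (\<Sum>f\<in>F. cnj (c f) * c f)"
    using assms by (intro sum.cong refl) (simp add: cinner_orthonormal_sum subset_iff)
  also have "\<dots> = (\<Sum>f\<in>F. complex_of_real ((cmod (c f))\<^sup>2))"
    by (intro sum.cong refl) (simp add: complex_norm_square mult.commute del: of_real_power)
  also have "\<dots> = complex_of_real (\<Sum>f\<in>F. (cmod (c f))\<^sup>2)"
    by simp
  finally show ?thesis unfolding of_real_eq_iff .
qed

lemma Bessel_finite:
  assumes "orthonormal E" "finite F" "F \<subseteq> E"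
  shows "(\<Sum>e\<in>F. (cmod (cinner e u))\<^sup>2) \<le> (norm u)\<^sup>2"
proof -
  let ?v = "\<Sum>f\<in>F. cinner f u *\<^sub>C f"
  have "cinner ?v u = (\<Sum>f\<in>F. complex_of_real ((cmod (cinner f u))\<^sup>2))"
    unfolding cinner_sum_left
    by (intro sum.cong refl) (simp add: complex_norm_square mult.commute flip: of_real_power)
  then have "inner ?v u = (\<Sum>e\<in>F. (cmod (cinner e u))\<^sup>2)"
    by (simp flip: Re_cinner)
  moreover have "(norm ?v)\<^sup>2 = (\<Sum>e\<in>F. (cmod (cinner e u))\<^sup>2)"
    by (rule norm_orthonormal_sum[OF assms])
  moreover have "0 \<le> (norm (u - ?v))\<^sup>2" by simp
  moreover have "(norm (u - ?v))\<^sup>2 = (norm u)\<^sup>2 + (norm ?v)\<^sup>2 - 2 * inner ?v u"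
    by (simp add: power2_norm_eq_inner inner_diff_left inner_diff_right inner_commute)
  ultimately show ?thesis by linarith
qed

lemma orthonormal_projection:
  fixes u :: "'a::complex_hilbert"
  assumes E: "orthonormal E"
  obtains v where "\<And>e. e \<in> E \<Longrightarrow> cinner e v = cinner e u"
    "((\<lambda>e. (cmod (cinner e u))\<^sup>2) has_sum (norm v)\<^sup>2) E"
    "\<And>w. (\<And>e. e \<in> E \<Longrightarrow> cinner e w = 0) \<Longrightarrow> cinner v w = 0"
    "\<And>M. csubspace M \<Longrightarrow> closed M \<Longrightarrow> E \<subseteq> M \<Longrightarrow> v \<in> M"
proof -
  define f where "f e = (cmod (cinner e u))\<^sup>2" for e
  have f0: "f e \<ge> 0" for e by (simp add: f_def)
  have "f summable_on E"
    by (rule nonneg_bdd_above_summable_on)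
       (auto simp: f_def intro!: bdd_aboveI2[where M = "(norm u)\<^sup>2"] Bessel_finite[OF E])
  then obtain S where S: "(f has_sum S) E" by (auto simp: summable_on_def)
  have "\<exists>F. finite F \<and> F \<subseteq> E \<and> (\<forall>X. finite X \<and> F \<subseteq> X \<and> X \<subseteq> E \<longrightarrow> \<bar>sum f X - S\<bar> < 1 / real (Suc n))" for n
  proof -
    have "\<forall>\<^sub>F X in finite_subsets_at_top E. dist (sum f X) S < 1 / real (Suc n)"
      using S unfolding has_sum_def by (rule tendstoD) simp
    then show ?thesis unfolding eventually_finite_subsets_at_top dist_real_def by blast
  qed
  then obtain F0 where F0: "\<And>n. finite (F0 n)" "\<And>n. F0 n \<subseteq> E"
    "\<And>n X. finite X \<Longrightarrow> F0 n \<subseteq> X \<Longrightarrow> X \<subseteq> E \<Longrightarrow> \<bar>sum f X - S\<bar> < 1 / real (Suc n)"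
    by metis
  define F where "F n = (\<Union>k\<le>n. F0 k)" for n
  have F: "finite (F n)" "F n \<subseteq> E" "F0 n \<subseteq> F n" for n
    using F0 by (auto simp: F_def)
  have Fmono: "F m \<subseteq> F n" if "m \<le> n" for m n using that by (force simp: F_def)
  have FS: "\<bar>sum f (F m) - S\<bar> < 1 / real (Suc n)" if "n \<le> m" for m n
    using F0(3)[of "F m" n] F Fmono[OF that] by blast
  define v where "v n = (\<Sum>e\<in>F n. cinner e u *\<^sub>C e)" for n
  have vd: "(norm (v m - v n))\<^sup>2 < 2 / real (Suc n)" if "n \<le> m" for m n
  proof -
    have "v m - v n = (\<Sum>e\<in>F m - F n. cinner e u *\<^sub>C e)"
      unfolding v_def using F Fmono[OF that] by (simp add: sum_diff)
    then have "(norm (v m - v n))\<^sup>2 = sum f (F m - F n)"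
      using norm_orthonormal_sum[OF E, of "F m - F n" "\<lambda>e. cinner e u"] F by (auto simp: f_def)
    also have "\<dots> = sum f (F m) - sum f (F n)"
      using F Fmono[OF that] by (simp add: sum_diff)
    also have "\<dots> < 2 / real (Suc n)"
      using FS[OF that] FS[of n n] by (simp add: abs_less_iff field_simps)
    finally show ?thesis .
  qed
  have lim2: "(\<lambda>n. 2 / real (Suc n)) \<longlonglongrightarrow> 0"
    using tendsto_mult_right_zero[OF LIMSEQ_Suc[OF lim_1_over_n[where 'a=real]], of 2] by simp
  have "Cauchy v"
  proof (rule CauchyI')
    fix r :: real assume r: "r > 0"
    then have "\<forall>\<^sub>F n in sequentially. 2 / real (Suc n) < r\<^sup>2"
      using order_tendstoD(2)[OF lim2, of "r\<^sup>2"] by simp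
    then obtain N where N: "\<And>n. n \<ge> N \<Longrightarrow> 2 / real (Suc n) < r\<^sup>2"
      by (auto simp: eventually_sequentially)
    have "norm (v m - v n) < r" if "m \<ge> N" "n > m" for m n
    proof -
      have "(norm (v m - v n))\<^sup>2 < r\<^sup>2"
        using vd[of m n] N[of m] that by (simp add: norm_minus_commute)
      then show ?thesis using r by (simp add: power2_less_imp_less)
    qed
    then show "\<exists>M. \<forall>m\<ge>M. \<forall>n>m. dist (v m) (v n) < r"
      unfolding dist_norm by blast
  qed
  then obtain w where w: "v \<longlonglongrightarrow> w" by (auto simp: Cauchy_convergent_iff convergent_def)
  have ev: "cinner e (v n) = (if e \<in> F n then cinner e u else 0)" if "e \<in> E" for e n
    unfolding v_def by (rule cinner_orthonormal_sum[OF E F(1,2) that])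
  have 1: "cinner e w = cinner e u" if e: "e \<in> E" for e
  proof (cases "\<exists>N. e \<in> F N")
    case True
    then obtain N where "e \<in> F N" by blast
    then have "\<forall>n\<ge>N. cinner e (v n) = cinner e u" using ev[OF e] Fmono by auto
    then have "(\<lambda>n. cinner e (v n)) \<longlonglongrightarrow> cinner e u"
      by (intro tendsto_eventually) (auto simp: eventually_sequentially)
    moreover have "(\<lambda>n. cinner e (v n)) \<longlonglongrightarrow> cinner e w" by (intro tendsto_intros w)
    ultimately show ?thesis using LIMSEQ_unique by blast
  next
    case False
    have fe: "f e \<le> 2 / real (Suc n)" for n
    proof -
      have "f e = sum f (insert e (F n)) - sum f (F n)" using False F by simp
      moreover have "\<bar>sum f (insert e (F n)) - S\<bar> < 1 / real (Suc n)"
        using F0(3)[of "insert e (F n)" n] F e by blast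
      moreover have "a - b \<le> 2 * c" if "\<bar>a - S\<bar> < c" "\<bar>b - S\<bar> < c" for a b c :: real
        using that by linarith
      ultimately show ?thesis using FS[of n n] by fastforce
    qed
    have "f e \<le> 0" by (rule LIMSEQ_le_const[OF lim2]) (use fe in blast)
    then have "cinner e u = 0" by (simp add: f_def)
    moreover have "(\<lambda>n. cinner e (v n)) \<longlonglongrightarrow> cinner e w" by (intro tendsto_intros w)
    ultimately show ?thesis using ev[OF e] False by (simp add: LIMSEQ_const_iff)
  qed
  have "(\<lambda>n. (norm (v n))\<^sup>2) \<longlonglongrightarrow> (norm w)\<^sup>2" by (intro tendsto_intros w)
  moreover have "(norm (v n))\<^sup>2 = sum f (F n)" for n
    unfolding v_def f_def by (rule norm_orthonormal_sum[OF E F(1,2)])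
  moreover have "(\<lambda>n. sum f (F n)) \<longlonglongrightarrow> S"
  proof (rule LIM_zero_cancel, rule Lim_null_comparison)
    show "\<forall>\<^sub>F n in sequentially. norm (sum f (F n) - S) \<le> 1 / real (Suc n)"
      using FS[OF order_refl] by (intro always_eventually) (simp add: less_imp_le)
    show "(\<lambda>n. 1 / real (Suc n)) \<longlonglongrightarrow> 0" by (rule LIMSEQ_Suc[OF lim_1_over_n])
  qed
  ultimately have "(norm w)\<^sup>2 = S" using LIMSEQ_unique by auto
  then have 2: "((\<lambda>e. (cmod (cinner e u))\<^sup>2) has_sum (norm w)\<^sup>2) E"
    using S by (simp add: f_def[abs_def])
  have 3: "cinner w z = 0" if z: "\<And>e. e \<in> E \<Longrightarrow> cinner e z = 0" for z
  proof -
    have "cinner (v n) z = 0" for n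
      unfolding v_def cinner_sum_left using F(2)[of n] z by (intro sum.neutral) (simp add: subset_iff)
    moreover have "(\<lambda>n. cinner (v n) z) \<longlonglongrightarrow> cinner w z" by (intro tendsto_intros w)
    ultimately show ?thesis by (simp add: LIMSEQ_const_iff)
  qed
  have 4: "w \<in> M" if M: "csubspace M" "closed M" "E \<subseteq> M" for M
  proof -
    have "(\<Sum>e\<in>G. cinner e u *\<^sub>C e) \<in> M" if "finite G" "G \<subseteq> E" for G
      using that M by (induction G rule: finite_induct) (auto simp: csubspace_def)
    then have "v n \<in> M" for n unfolding v_def using F by blast
    then show ?thesis using closed_sequentially[OF M(2)] w by blast
  qed
  show ?thesis by (rule that[of w, OF 1 2 3 4])
qed

lemma Parseval:
  assumes "is_onb E"
  shows "((\<lambda>e. (cmod (cinner e u))\<^sup>2) has_sum (norm u)\<^sup>2) E"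
proof -
  obtain v where v: "\<And>e. e \<in> E \<Longrightarrow> cinner e v = cinner e u"
    "((\<lambda>e. (cmod (cinner e u))\<^sup>2) has_sum (norm v)\<^sup>2) E"
    using orthonormal_projection[of E u] assms unfolding is_onb_def by metis
  have "\<forall>e\<in>E. cinner e (u - v) = 0" using v(1) by (simp add: cinner_diff_right)
  then have "u - v = 0" using assms unfolding is_onb_def by blast
  then show ?thesis using v(2) by simp
qed

text \<open>A maximal orthonormal subset of a closed subspace determines the orthogonal complement.\<close>

lemma orthonormal_total_orthogonal:
  fixes M :: "'a::complex_hilbert set"
  assumes M: "csubspace M" "closed M" and E: "orthonormal E" "E \<subseteq> M"
    and total: "\<And>u. u \<in> M \<Longrightarrow> (\<And>e. e \<in> E \<Longrightarrow> cinner e u = 0) \<Longrightarrow> u = 0"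
    and w: "\<And>e. e \<in> E \<Longrightarrow> cinner e w = 0" and n: "n \<in> M"
  shows "cinner n w = 0"
proof -
  obtain v where v: "\<And>e. e \<in> E \<Longrightarrow> cinner e v = cinner e n"
    "((\<lambda>e. (cmod (cinner e n))\<^sup>2) has_sum (norm v)\<^sup>2) E"
    "\<And>w. (\<And>e. e \<in> E \<Longrightarrow> cinner e w = 0) \<Longrightarrow> cinner v w = 0"
    "\<And>M. csubspace M \<Longrightarrow> closed M \<Longrightarrow> E \<subseteq> M \<Longrightarrow> v \<in> M"
    by (rule orthonormal_projection[OF E(1)]) (assumption | blast)+
  have "v \<in> M" by (rule v(4)[OF M E(2)])
  then have "n + (-1) *\<^sub>C v \<in> M" using n M(1) by (simp add: csubspace_def)
  then have "n - v = 0"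
    by (intro total) (auto simp: scaleC_minus_one cinner_diff_right v(1))
  then show ?thesis using v(3)[of w] w by simp
qed

lemma orthogonal_decomposition:
  fixes M :: "'a::complex_hilbert set"
  assumes M: "csubspace M" "closed M"
  obtains m where "m \<in> M" "\<And>n. n \<in> M \<Longrightarrow> cinner n (u - m) = 0"
proof -
  obtain E where E: "E \<subseteq> M" "orthonormal E" "\<And>u. u \<in> M \<Longrightarrow> (\<And>e. e \<in> E \<Longrightarrow> cinner e u = 0) \<Longrightarrow> u = 0"
    using orthonormal_extend[of "{}" M] M by (auto simp: orthonormal_def)
  obtain v where v: "\<And>e. e \<in> E \<Longrightarrow> cinner e v = cinner e u"
    "\<And>M. csubspace M \<Longrightarrow> closed M \<Longrightarrow> E \<subseteq> M \<Longrightarrow> v \<in> M"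
    using orthonormal_projection[OF E(2), of u] by metis
  show ?thesis
  proof (rule that)
    show "v \<in> M" by (rule v(2)[OF M E(1)])
    fix n assume "n \<in> M"
    show "cinner n (u - v) = 0"
    proof (rule orthonormal_total_orthogonal[OF M E(2,1)])
      show "u = 0" if "u \<in> M" "\<And>e. e \<in> E \<Longrightarrow> cinner e u = 0" for u by (rule E(3)[OF that])
      show "cinner e (u - v) = 0" if "e \<in> E" for e using that by (simp add: cinner_diff_right v(1))
    qed fact
  qed
qed

lemma Hilbert_Schmidt_adj:
  assumes E: "is_onb E" and F: "is_onb F"
    and S: "((\<lambda>e. (norm (bop_apply x e))\<^sup>2) has_sum S) E"
  shows "((\<lambda>f. (norm (x\<^sup>\<dagger> f))\<^sup>2) has_sum S) F"
proof -
  let ?g = "\<lambda>(e, f). (cmod (cinner f (x e)))\<^sup>2"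
  have row: "((\<lambda>f. ?g (e, f)) has_sum (norm (x e))\<^sup>2) F" for e
    using Parseval[OF F, of "x e"] by simp
  have "?g summable_on E \<times> F"
    by (rule summable_on_SigmaI[OF row]) (use S in \<open>auto simp: summable_on_def\<close>)
  then have "(?g has_sum S) (E \<times> F)"
    by (rule has_sum_SigmaI[OF row S])
  then have "((\<lambda>(f, e). ?g (e, f)) has_sum S) (F \<times> E)"
    by (subst (asm) has_sum_swap) simp
  moreover have "((\<lambda>e. (\<lambda>(f, e). ?g (e, f)) (f, e)) has_sum (norm (x\<^sup>\<dagger> f))\<^sup>2) E" for f
  proof -
    have "cmod (cinner f (x e)) = cmod (cinner e (x\<^sup>\<dagger> f))" for e
      by (metis adj' cinner_commute complex_mod_cnj)
    then show ?thesis using Parseval[OF E, of "x\<^sup>\<dagger> f"] by simp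
  qed
  ultimately show ?thesis by (rule has_sum_SigmaD)
qed

section \<open>Square roots and absolute values\<close>

lemma pos_Cauchy_Schwarz:
  assumes "0 \<le> p"
  shows "(inner u (bop_apply p v))\<^sup>2 \<le> inner u (p u) * inner v (p v)"
proof -
  define a b c where abc: "a = inner u (p u)" "b = inner u (p v)" "c = inner v (p v)"
  have sym: "inner v (p u) = b"
    using selfadjoint_cinner[OF bop_pos_selfadjoint[OF assms], of v u]
    by (metis Re_cinner abc(2) inner_commute)
  have q: "0 \<le> a + 2 * t * b + t\<^sup>2 * c" for t
  proof -
    have "inner (u + t *\<^sub>R v) (p (u + t *\<^sub>R v)) = a + 2 * t * b + t\<^sup>2 * c"
      using sym by (simp add: bop_simps inner_add_left inner_add_right abc power2_eq_square algebra_simps)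
    then show ?thesis using bop_pos_inner[OF assms, of "u + t *\<^sub>R v"] by simp
  qed
  have c0: "c \<ge> 0" using bop_pos_inner[OF assms] by (simp add: abc)
  have "b\<^sup>2 \<le> a * c"
  proof (cases "c = 0")
    case True
    have "b = 0"
    proof (rule ccontr)
      assume "b \<noteq> 0"
      then have "2 * (- (a + 1) / (2 * b)) * b = - (a + 1)" by simp
      then show False using q[of "- (a + 1) / (2 * b)"] True by simp
    qed
    then show ?thesis using True by simp
  next
    case False
    then have "c > 0" using c0 by simp
    have "0 \<le> c * (a + 2 * (- b / c) * b + (- b / c)\<^sup>2 * c)" by (rule mult_nonneg_nonneg[OF c0 q])
    also have "\<dots> = a * c - b\<^sup>2" using \<open>c > 0\<close> by (simp add: power2_eq_square field_simps)
    finally show ?thesis by simp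
  qed
  then show ?thesis by (simp add: abc)
qed

lemma pos_norm_apply:
  assumes "0 \<le> p"
  shows "(norm (bop_apply p u))\<^sup>2 \<le> norm p * inner u (p u)"
proof (cases "p u = 0")
  case False
  have sym: "inner u (p (p u)) = (norm (p u))\<^sup>2"
    using selfadjoint_cinner[OF bop_pos_selfadjoint[OF assms], of u "p u"]
    by (metis Re_cinner power2_norm_eq_inner)
  have "((norm (p u))\<^sup>2)\<^sup>2 \<le> inner u (p u) * inner (p u) (p (p u))"
    using pos_Cauchy_Schwarz[OF assms, of u "p u"] sym by simp
  also have "\<dots> \<le> inner u (p u) * (norm p * (norm (p u))\<^sup>2)"
  proof (rule mult_left_mono)
    have "inner (p u) (p (p u)) \<le> norm (p u) * norm (p (p u))" by (rule norm_cauchy_schwarz)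
    also have "\<dots> \<le> norm (p u) * (norm p * norm (p u))" by (intro mult_left_mono norm_bop) auto
    finally show "inner (p u) (p (p u)) \<le> norm p * (norm (p u))\<^sup>2" by (simp add: power2_eq_square mult_ac)
  qed (rule bop_pos_inner[OF assms])
  finally have "(norm (p u))\<^sup>2 * (norm (p u))\<^sup>2 \<le> (norm p * inner u (p u)) * (norm (p u))\<^sup>2"
    by (simp add: power2_eq_square mult_ac)
  then show ?thesis by (rule mult_right_le_imp_le) (use False in simp)
qed (simp add: bop_pos_inner[OF assms])

lemma pos_norm_one_minus:
  assumes "0 \<le> p" "norm p \<le> 1"
  shows "norm (1 - p :: 'a::complex_hilbert bop) \<le> 1"
proof (rule norm_bop_bound)
  fix u
  have "(norm (p u))\<^sup>2 \<le> inner u (p u)"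
    using pos_norm_apply[OF assms(1), of u] mult_right_mono[OF assms(2) bop_pos_inner[OF assms(1), of u]]
    by simp
  moreover have "(norm (u - p u))\<^sup>2 = (norm u)\<^sup>2 - 2 * inner u (p u) + (norm (p u))\<^sup>2"
    by (simp add: power2_norm_eq_inner inner_diff_left inner_diff_right inner_commute)
  ultimately have "(norm (u - p u))\<^sup>2 \<le> (norm u)\<^sup>2"
    using bop_pos_inner[OF assms(1), of u] by linarith
  then have "norm (u - p u) \<le> norm u" by (rule power2_le_imp_le) simp
  then show "norm ((1 - p) u) \<le> 1 * norm u" by simp
qed simp

lemma sqrt_contraction_exists:
  fixes p :: "'a::complex_hilbert bop"
  assumes p: "0 \<le> p" "norm p \<le> 1"
  shows "\<exists>s. 0 \<le> s \<and> s * s = p \<and> (\<forall>a. a * p = p * a \<longrightarrow> a * s = s * a)"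
proof -
  define x where "x = 1 - p"
  have x1: "norm x \<le> 1" unfolding x_def by (rule pos_norm_one_minus[OF p])
  have xs: "selfadjoint x"
    using bop_pos_selfadjoint[OF p(1)] by (simp add: selfadjoint_def x_def)
  define y where "y = rec_nat (0 :: 'a bop) (\<lambda>_ z. (1/2) *\<^sub>R (x + z * z))"
  define r where "r = rec_nat (0 :: real) (\<lambda>_ z. (1 + z * z) / 2)"
  have y0: "y 0 = 0" and yS: "y (Suc n) = (1/2) *\<^sub>R (x + y n * y n)" for n by (simp_all add: y_def)
  have r0: "r 0 = 0" and rS: "r (Suc n) = (1 + r n * r n) / 2" for n by (simp_all add: r_def)
  have r01: "0 \<le> r n \<and> r n \<le> 1" for n
  proof (induction n)
    case (Suc n)
    then have "r n * r n \<le> 1" by (simp add: mult_le_one)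
    then show ?case using Suc by (simp add: rS)
  qed (simp add: r0)
  have yr: "norm (y n) \<le> r n" for n
  proof (induction n)
    case (Suc n)
    have "norm (y (Suc n)) \<le> (norm x + norm (y n) * norm (y n)) / 2"
      using norm_triangle_ineq[of x "y n * y n"] norm_mult_ineq[of "y n" "y n"] by (simp add: yS)
    also have "\<dots> \<le> (1 + r n * r n) / 2"
      using x1 Suc by (intro divide_right_mono add_mono mult_mono) (auto intro: order_trans[OF norm_ge_zero])
    finally show ?case by (simp add: rS)
  qed (simp add: y0 r0)
  have yd: "norm (y (Suc n) - y n) \<le> r (Suc n) - r n" for n
  proof (induction n)
    case 0
    show ?case using x1 by (simp add: yS rS y0 r0)
  next
    case (Suc n)
    let ?a = "y (Suc n)" and ?b = "y n"
    have "y (Suc (Suc n)) - ?a = (1/2) *\<^sub>R (?a * ?a - ?b * ?b)"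
      by (subst yS, subst (3) yS) (simp add: algebra_simps)
    also have "?a * ?a - ?b * ?b = (1/2) *\<^sub>R ((?a - ?b) * (?a + ?b) + (?a + ?b) * (?a - ?b))"
      by (simp add: algebra_simps flip: scaleR_add_left)
    finally have "norm (y (Suc (Suc n)) - ?a) = norm ((?a - ?b) * (?a + ?b) + (?a + ?b) * (?a - ?b)) / 4"
      by simp
    also have "\<dots> \<le> (norm (?a - ?b) * norm (?a + ?b) + norm (?a + ?b) * norm (?a - ?b)) / 4"
      by (intro divide_right_mono order_trans[OF norm_triangle_ineq] add_mono norm_mult_ineq) auto
    also have "\<dots> = norm (?a - ?b) * norm (?a + ?b) / 2" by simp
    also have "\<dots> \<le> (r (Suc n) - r n) * (r (Suc n) + r n) / 2"
      using Suc yr[of n] yr[of "Suc n"] order_trans[OF norm_ge_zero Suc]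
      by (intro divide_right_mono mult_mono order_trans[OF norm_triangle_ineq] add_mono)
         (auto intro: order_trans[OF norm_ge_zero])
    also have "\<dots> = r (Suc (Suc n)) - r (Suc n)"
      by (subst (3) rS, subst (5) rS) (simp add: field_simps)
    finally show ?case .
  qed
  have ydd: "norm (y m - y n) \<le> r m - r n" if "n \<le> m" for m n
    using that
  proof (induction m rule: dec_induct)
    case (step m)
    have "norm (y (Suc m) - y n) \<le> norm (y (Suc m) - y m) + norm (y m - y n)"
      using norm_triangle_ineq[of "y (Suc m) - y m" "y m - y n"] by simp
    then show ?case using yd[of m] step by linarith
  qed simp
  have "incseq r"
    by (rule incseq_SucI) (use order_trans[OF norm_ge_zero yd] in simp)
  then have "convergent r"
    using r01 by (metis incseq_convergent convergentI)
  then have "Cauchy r" by (rule convergent_Cauchy)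
  have "Cauchy y"
  proof (rule CauchyI')
    fix e :: real assume "e > 0"
    then obtain M where M: "\<And>m n. m \<ge> M \<Longrightarrow> n \<ge> M \<Longrightarrow> norm (r m - r n) < e"
      using CauchyD[OF \<open>Cauchy r\<close>] by metis
    have "dist (y m) (y n) < e" if "m \<ge> M" "n > m" for m n
      using M[of n m] ydd[of m n] that by (simp add: dist_norm norm_minus_commute)
    then show "\<exists>M. \<forall>m\<ge>M. \<forall>n>m. dist (y m) (y n) < e" by blast
  qed
  then obtain z where z: "y \<longlonglongrightarrow> z" by (auto simp: Cauchy_convergent_iff convergent_def)
  have "(\<lambda>n. (1/2) *\<^sub>R (x + y n * y n)) \<longlonglongrightarrow> (1/2) *\<^sub>R (x + z * z)"
    by (intro tendsto_intros z)
  moreover have "(\<lambda>n. (1/2) *\<^sub>R (x + y n * y n)) \<longlonglongrightarrow> z"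
    using LIMSEQ_Suc[OF z] by (simp add: yS)
  ultimately have zeq: "z = (1/2) *\<^sub>R (x + z * z)" using LIMSEQ_unique by blast
  then have "2 *\<^sub>R z = 2 *\<^sub>R ((1/2) *\<^sub>R (x + z * z))" by simp
  then have zeq2: "z + z = x + z * z" by (simp add: scaleR_2)
  have z1: "norm z \<le> 1"
  proof (rule LIMSEQ_le_const2[OF tendsto_norm[OF z]])
    show "\<exists>N. \<forall>n\<ge>N. norm (y n) \<le> 1" using yr r01 by (meson order_trans)
  qed
  have ys: "selfadjoint (y n)" for n
    by (induction n) (use xs in \<open>simp_all add: y0 yS selfadjoint_def\<close>)
  have zs: "selfadjoint z"
  proof (rule selfadjointI)
    fix u v
    have "(\<lambda>n. cinner u (y n v)) \<longlonglongrightarrow> cinner u (z v)" "(\<lambda>n. cinner (y n u) v) \<longlonglongrightarrow> cinner (z u) v"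
      by (intro tendsto_intros z)+
    then show "cinner u (z v) = cinner (z u) v"
      using selfadjoint_cinner[OF ys] LIMSEQ_unique by auto
  qed
  have zc: "a * z = z * a" if a: "a * p = p * a" for a
  proof -
    have "a * y n = y n * a" for n
    proof (induction n)
      case (Suc n)
      have "a * (y n * y n) = (y n * y n) * a" using Suc by (metis mult.assoc)
      moreover have "a * x = x * a" using a by (simp add: x_def algebra_simps)
      ultimately show ?case by (simp add: yS algebra_simps)
    qed (simp add: y0)
    then have "(\<lambda>n. a * y n) \<longlonglongrightarrow> z * a" by (simp add: tendsto_mult[OF z tendsto_const])
    moreover have "(\<lambda>n. a * y n) \<longlonglongrightarrow> a * z" by (intro tendsto_intros z)
    ultimately show ?thesis using LIMSEQ_unique by blast
  qed
  have "(1 - z) * (1 - z) = 1 - (z + z) + z * z" by (simp add: algebra_simps)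
  also have "\<dots> = p" unfolding zeq2 by (simp add: x_def)
  finally have "(1 - z) * (1 - z) = p" .
  moreover have "0 \<le> 1 - z"
  proof (rule bop_posI)
    show "selfadjoint (1 - z)" using zs by (simp add: selfadjoint_def)
    fix u
    have "inner u (z u) \<le> norm u * norm (z u)" by (rule norm_cauchy_schwarz)
    also have "\<dots> \<le> norm u * (norm z * norm u)" by (intro mult_left_mono norm_bop) auto
    also have "\<dots> \<le> norm u * (1 * norm u)" by (intro mult_left_mono mult_right_mono z1) auto
    finally show "0 \<le> inner u ((1 - z) u)"
      by (simp add: inner_diff_right flip: power2_eq_square power2_norm_eq_inner)
  qed
  moreover have "a * (1 - z) = (1 - z) * a" if "a * p = p * a" for a
    using zc[OF that] by (simp add: algebra_simps)
  ultimately show ?thesis by blast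
qed

lemma sqrt_exists:
  fixes p :: "'a::complex_hilbert bop"
  assumes p: "0 \<le> p"
  shows "\<exists>s. 0 \<le> s \<and> s * s = p \<and> (\<forall>a. a * p = p * a \<longrightarrow> a * s = s * a)"
proof (cases "p = 0")
  case False
  then have n: "norm p > 0" by simp
  define q where "q = (1 / norm p) *\<^sub>R p"
  have q: "0 \<le> q" "norm q \<le> 1" using p n by (simp_all add: q_def scaleR_nonneg_nonneg)
  have pq: "p = norm p *\<^sub>R q" using n by (simp add: q_def)
  obtain s where s: "0 \<le> s" "s * s = q" "\<And>a. a * q = q * a \<Longrightarrow> a * s = s * a"
    using sqrt_contraction_exists[OF q] by blast
  show ?thesis
  proof (intro exI[of _ "sqrt (norm p) *\<^sub>R s"] conjI allI impI)
    show "0 \<le> sqrt (norm p) *\<^sub>R s" using s(1) by (simp add: scaleR_nonneg_nonneg)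
    show "sqrt (norm p) *\<^sub>R s * sqrt (norm p) *\<^sub>R s = p" using s(2) pq by simp
    fix a assume "a * p = p * a"
    then have "a * q = q * a" by (simp add: q_def)
    then show "a * sqrt (norm p) *\<^sub>R s = sqrt (norm p) *\<^sub>R s * a" using s(3) by simp
  qed
qed (auto intro!: exI[of _ 0])

lemma selfadjoint_square_zero:
  assumes "selfadjoint d" "d * d = (0 :: 'a::complex_hilbert bop)"
  shows "d = 0"
proof (rule bop_eqI)
  fix u
  have "cinner (d u) (d u) = cinner u ((d * d) u)"
    using selfadjoint_cinner[OF assms(1), of u "d u"] by simp
  then show "d u = (0 :: 'a bop) u" by (simp add: assms(2) cinner_self)
qed

lemma adj_times_self_pos: "0 \<le> x\<^sup>\<dagger> * (x :: 'a::complex_hilbert bop)"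
  by (simp add: bop_pos_iff adj cinner_self)

lemma sqrt_unique:
  fixes s t :: "'a::complex_hilbert bop"
  assumes "0 \<le> s" "0 \<le> t" "s * s = t * t"
  shows "s = t"
proof -
  have "0 \<le> s * s"
    using adj_times_self_pos[of s] bop_pos_selfadjoint[OF assms(1)] by (simp add: selfadjoint_def)
  from sqrt_exists[OF this]
  obtain r where r: "0 \<le> r" "r * r = s * s" "\<And>a. a * (s * s) = (s * s) * a \<Longrightarrow> a * r = r * a"
    by blast
  have "q = r" if q: "0 \<le> q" "q * q = s * s" for q
  proof -
    have c: "q * r = r * q" using r(3)[of q] q(2) by (metis mult.assoc)
    define d where "d = q - r"
    have sd: "selfadjoint d"
      using bop_pos_selfadjoint[OF q(1)] bop_pos_selfadjoint[OF r(1)] by (simp add: selfadjoint_def d_def)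
    have "(q + r) * d = 0" using c q(2) r(2) by (simp add: d_def algebra_simps)
    then have "d * q * d + d * r * d = 0"
      by (metis (no_types, lifting) distrib_left distrib_right mult.assoc mult_zero_right)
    moreover have "0 \<le> d * q * d" "0 \<le> d * r * d"
      using bop_sandwich_pos[OF q(1), of d] bop_sandwich_pos[OF r(1), of d] sd by (simp_all add: selfadjoint_def)
    ultimately have "d * q * d = 0" "d * r * d = 0"
      by (simp_all add: add_nonneg_eq_0_iff)
    moreover have "d * (q - r) * d = d * q * d - d * r * d" by (simp add: algebra_simps)
    ultimately have ddd: "d * d * d = 0" by (simp flip: d_def)
    have "(d * d) * (d * d) = 0" using ddd by (metis mult.assoc mult_zero_left)
    moreover have "selfadjoint (d * d)" using sd by (simp add: selfadjoint_def)
    ultimately have "d * d = 0" using selfadjoint_square_zero by blast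
    then have "d = 0" using sd selfadjoint_square_zero by blast
    then show ?thesis by (simp add: d_def)
  qed
  from this[of s] this[of t] show ?thesis using assms by simp
qed

definition abs_op :: "'a::complex_hilbert bop \<Rightarrow> 'a bop" where
  "abs_op x = (THE p. 0 \<le> p \<and> p * p = x\<^sup>\<dagger> * x)"

lemma abs_op:
  fixes x :: "'a::complex_hilbert bop"
  shows "0 \<le> abs_op x" "abs_op x * abs_op x = x\<^sup>\<dagger> * x"
    and "\<And>a. a * (x\<^sup>\<dagger> * x) = (x\<^sup>\<dagger> * x) * a \<Longrightarrow> a * abs_op x = abs_op x * a"
proof -
  obtain s where s: "0 \<le> s" "s * s = x\<^sup>\<dagger> * x" "\<And>a. a * (x\<^sup>\<dagger> * x) = (x\<^sup>\<dagger> * x) * a \<Longrightarrow> a * s = s * a"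
    using sqrt_exists[OF adj_times_self_pos[of x]] by blast
  have eq: "abs_op x = s"
    unfolding abs_op_def
  proof (rule the_equality)
    fix q assume "0 \<le> q \<and> q * q = x\<^sup>\<dagger> * x"
    then show "q = s" using sqrt_unique[of q s] s(1,2) by simp
  qed (simp add: s)
  show "0 \<le> abs_op x" "abs_op x * abs_op x = x\<^sup>\<dagger> * x"
    "\<And>a. a * (x\<^sup>\<dagger> * x) = (x\<^sup>\<dagger> * x) * a \<Longrightarrow> a * abs_op x = abs_op x * a"
    unfolding eq by (rule s, assumption?)+
qed

section \<open>Trace class operators\<close>

definition some_onb :: "'a::complex_hilbert set" where
  "some_onb = (SOME E. is_onb E)"

definition Tr :: "'a::complex_hilbert bop \<Rightarrow> complex" where
  "Tr x = (\<Sum>\<^sub>\<infinity>e\<in>some_onb. cinner e (x e))"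

definition trace_class :: "'a::complex_hilbert bop \<Rightarrow> bool" where
  "trace_class x \<longleftrightarrow> (\<lambda>e. cinner e (abs_op x e)) summable_on some_onb"

definition trace_norm :: "'a::complex_hilbert bop \<Rightarrow> real" where
  "trace_norm x = Re (Tr (abs_op x))"

lemma some_onb: "is_onb some_onb"
  unfolding some_onb_def by (rule someI_ex[OF onb_exists])

lemma pos_cinner_eq: "0 \<le> p \<Longrightarrow> cinner u (bop_apply p u) = of_real (inner u (p u))"
  by (simp add: bop_pos_iff complex_nonneg_Reals_iff complex_eq_iff Re_cinner)

lemma pos_has_sum_onb:
  assumes p: "0 \<le> p" and E: "is_onb E" and F: "is_onb F"
    and S: "((\<lambda>e. inner e (bop_apply p e)) has_sum S) E"
  shows "((\<lambda>e. inner e (bop_apply p e)) has_sum S) F"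
proof -
  obtain s where s: "0 \<le> s" "s * s = p"
    using sqrt_exists[OF p] by blast
  have sa: "s\<^sup>\<dagger> = s" using bop_pos_selfadjoint[OF s(1)] by (simp add: selfadjoint_def)
  have eq: "inner e (p e) = (norm (s e))\<^sup>2" for e
  proof -
    have "cinner e (p e) = cinner (s e) (s e)"
      unfolding s(2)[symmetric] bop_times_apply
      by (rule selfadjoint_cinner[OF bop_pos_selfadjoint[OF s(1)]])
    from arg_cong[OF this, of Re] show ?thesis
      by (simp add: Re_cinner power2_norm_eq_inner)
  qed
  show ?thesis
    using Hilbert_Schmidt_adj[OF E F, of s S] S unfolding eq sa by blast
qed

lemma trace_norm_has_sum:
  assumes "trace_class x" "is_onb E"
  shows "((\<lambda>e. inner e (abs_op x e)) has_sum trace_norm x) E"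
proof (rule pos_has_sum_onb[OF abs_op(1) some_onb assms(2)])
  have "((\<lambda>e. cinner e (abs_op x e)) has_sum Tr (abs_op x)) some_onb"
    using assms(1) unfolding trace_class_def Tr_def by (rule has_sum_infsum)
  from has_sum_Re[OF this] show "((\<lambda>e. inner e (abs_op x e)) has_sum trace_norm x) some_onb"
    by (simp add: trace_norm_def Re_cinner)
qed

lemma trace_classI:
  assumes "is_onb E" "((\<lambda>e. inner e (abs_op x e)) has_sum S) E"
  shows "trace_class x" "trace_norm x = S"
proof -
  have S: "((\<lambda>e. inner e (abs_op x e)) has_sum S) some_onb"
    by (rule pos_has_sum_onb[OF abs_op(1) assms(1) some_onb assms(2)])
  have "((\<lambda>e. cinner e (abs_op x e)) has_sum of_real S) some_onb"
    unfolding pos_cinner_eq[OF abs_op(1)] by (rule has_sum_of_real[OF S])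
  then show tc: "trace_class x" by (auto simp: trace_class_def summable_on_def)
  show "trace_norm x = S"
    by (rule has_sum_unique[OF trace_norm_has_sum[OF tc some_onb] S])
qed

lemma closed_kernel: "closed {u. bop_apply x u = 0}"
  by (intro closed_Collect_eq continuous_intros)

lemma csubspace_kernel: "csubspace {u. bop_apply x u = 0}"
  by (auto simp: csubspace_def bop_simps)

lemma csubspace_closure_range: "csubspace (closure (range (bop_apply x)))"
  unfolding csubspace_def
proof (intro conjI ballI allI)
  show "0 \<in> closure (range (bop_apply x))"
    by (rule subsetD[OF closure_subset]) (auto simp: bop_simps intro!: image_eqI[of _ _ 0])
  fix u v assume "u \<in> closure (range (bop_apply x))" "v \<in> closure (range (bop_apply x))"
  then obtain f g where f: "\<And>n. f n \<in> range (bop_apply x)" "f \<longlonglongrightarrow> u"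
    and g: "\<And>n. g n \<in> range (bop_apply x)" "g \<longlonglongrightarrow> v"
    unfolding closure_sequential by blast
  have "f n + g n \<in> range (bop_apply x)" for n
  proof -
    from f(1)[of n] g(1)[of n] obtain p q where "f n = x p" "g n = x q" by auto
    then have "f n + g n = x (p + q)" by (simp add: bop_simps)
    then show ?thesis by (rule range_eqI)
  qed
  then show "u + v \<in> closure (range (bop_apply x))"
    unfolding closure_sequential by (intro exI[of _ "\<lambda>n. f n + g n"] conjI allI tendsto_add f(2) g(2))
next
  fix c u assume "u \<in> closure (range (bop_apply x))"
  then obtain f where f: "\<And>n. f n \<in> range (bop_apply x)" "f \<longlonglongrightarrow> u"
    unfolding closure_sequential by blast
  have "c *\<^sub>C f n \<in> range (bop_apply x)" for n
  proof -
    from f(1)[of n] obtain p where "f n = x p" by auto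
    then have "c *\<^sub>C f n = x (c *\<^sub>C p)" by simp
    then show ?thesis by (rule range_eqI)
  qed
  then show "c *\<^sub>C u \<in> closure (range (bop_apply x))"
    unfolding closure_sequential by (intro exI[of _ "\<lambda>n. c *\<^sub>C f n"] conjI allI tendsto_scaleC f(2))
qed

lemma abs_op_minus [simp]: "abs_op (- x) = abs_op (x :: 'a::complex_hilbert bop)"
  by (simp add: abs_op_def)

lemma selfadjoint_abs_commute:
  assumes "selfadjoint a"
  shows "a * abs_op a = abs_op a * a"
  using assms by (intro abs_op(3)) (simp add: selfadjoint_def mult.assoc)

lemma le_abs_op:
  assumes a: "selfadjoint (a :: 'a::complex_hilbert bop)"
  shows "- a \<le> abs_op a"
proof -
  define h where "h = abs_op a"
  have h: "0 \<le> h" "h * h = a * a" "a * h = h * a"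
    using abs_op(1,2)[of a] selfadjoint_abs_commute[OF a] a by (simp_all add: h_def selfadjoint_def)
  obtain t where t: "0 \<le> t" "t * t = h" "\<And>x. x * h = h * x \<Longrightarrow> x * t = t * x"
    using sqrt_exists[OF h(1)] by blast
  have ts: "selfadjoint t" by (rule bop_pos_selfadjoint[OF t(1)])
  define b where "b = h + a"
  have bs: "selfadjoint b"
    using bop_pos_selfadjoint[OF h(1)] a by (simp add: b_def selfadjoint_def)
  have "b * h = h * b" using h(3) by (simp add: b_def algebra_simps)
  then have bt: "b * t = t * b" by (rule t(3))
  have "2 *\<^sub>R (t * b * t) = 2 *\<^sub>R (b * h)"
    unfolding t(2)[symmetric] using bt by (metis mult.assoc)
  also have "\<dots> = b * b"
    unfolding scaleR_2 using h(2,3) by (simp add: b_def algebra_simps)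
  finally have tbt: "2 *\<^sub>R (t * b * t) = b * b" .
  have range: "0 \<le> inner (t w) (b (t w))" for w
  proof -
    have "cinner (t w) (b (t w)) = cinner w ((t * b * t) w)"
      using selfadjoint_cinner[OF ts, of w "b (t w)"] by simp
    then have "2 * cinner (t w) (b (t w)) = cinner w ((2 *\<^sub>R (t * b * t)) w)" by simp
    also have "\<dots> = cinner (b w) (b w)"
      unfolding tbt using selfadjoint_cinner[OF bs, of w "b w"] by simp
    finally have "2 * cinner (t w) (b (t w)) = complex_of_real ((norm (b w))\<^sup>2)"
      unfolding cinner_self .
    from arg_cong[OF this, of Re] have "2 * inner (t w) (b (t w)) = (norm (b w))\<^sup>2"
      by (simp add: Re_cinner)
    then show ?thesis using zero_le_power2[of "norm (b w)"] by linarith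
  qed
  have closr: "0 \<le> inner m (b m)" if m: "m \<in> closure (range (bop_apply t))" for m
  proof -
    obtain f where f: "\<And>n. f n \<in> range (bop_apply t)" "f \<longlonglongrightarrow> m"
      using m unfolding closure_sequential by blast
    have "(\<lambda>n. inner (f n) (b (f n))) \<longlonglongrightarrow> inner m (b m)"
      by (intro tendsto_intros f)
    moreover have "0 \<le> inner (f n) (b (f n))" for n using f(1)[of n] range by auto
    ultimately show ?thesis by (intro LIMSEQ_le_const) auto
  qed
  have "0 \<le> inner u (b u)" for u
  proof -
    obtain m where m: "m \<in> closure (range (bop_apply t))"
      "\<And>n. n \<in> closure (range (bop_apply t)) \<Longrightarrow> cinner n (u - m) = 0"
      using orthogonal_decomposition[OF csubspace_closure_range closed_closure] by metis
    define k where "k = u - m"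
    have "cinner w (t k) = 0" for w
    proof -
      have "t w \<in> closure (range (bop_apply t))"
        by (rule subsetD[OF closure_subset]) (rule rangeI)
      then show ?thesis
        unfolding selfadjoint_cinner[OF ts] k_def by (rule m(2))
    qed
    then have "t k = 0" by (intro cinner_extI) simp
    then have hk: "h k = 0" unfolding t(2)[symmetric] by (simp add: bop_simps)
    have "cinner (a k) (a k) = cinner k ((h * h) k)"
      unfolding h(2) using selfadjoint_cinner[OF a, of k "a k"] by simp
    then have "a k = 0" by (simp add: hk bop_simps cinner_self)
    then have bk: "b k = 0" using hk by (simp add: b_def)
    have u: "u = m + k" by (simp add: k_def)
    have "cinner k (b m) = 0" by (simp add: selfadjoint_cinner[OF bs] bk)
    then have "inner k (b m) = 0" by (metis Re_cinner zero_complex.sel(1))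
    then have "inner u (b u) = inner m (b m)"
      unfolding u by (simp add: bop_simps bk inner_add_left)
    then show ?thesis using closr[OF m(1)] by simp
  qed
  then have "0 \<le> b" by (rule bop_posI[OF bs])
  then have "- a + 0 \<le> - a + b" by (rule add_left_mono)
  then show ?thesis by (simp add: b_def h_def)
qed

lemma le_abs_op':
  assumes "selfadjoint (a :: 'a::complex_hilbert bop)"
  shows "a \<le> abs_op a"
  using le_abs_op[of "- a"] assms by (simp add: selfadjoint_def)

lemma trace_class_dominated:
  fixes a p :: "'a::complex_hilbert bop"
  assumes a: "selfadjoint a" and le: "a \<le> p" "- a \<le> p"
    and E0: "is_onb E0" and S: "((\<lambda>e. inner e (p e)) has_sum S) E0"
  shows "trace_class a" "trace_norm a \<le> S"
proof -
  define h where "h = abs_op a"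
  have h: "0 \<le> h" "h * h = a * a" "a * h = h * a"
    using abs_op(1,2)[of a] selfadjoint_abs_commute[OF a] a by (simp_all add: h_def selfadjoint_def)
  define b c where "b = h + a" and "c = h - a"
  have bc: "b * c = 0" using h(2,3) by (simp add: b_def c_def algebra_simps)
  have cs: "selfadjoint c"
    using bop_pos_selfadjoint[OF h(1)] a by (simp add: c_def selfadjoint_def)
  let ?N = "{u. bop_apply b u = 0}"
  have "orthonormal ({} :: 'a set)" by (simp add: orthonormal_def)
  from orthonormal_extend[OF this empty_subsetI csubspace_kernel[of b]]
  obtain N where N: "N \<subseteq> ?N" "orthonormal N"
    "\<And>u. u \<in> ?N \<Longrightarrow> (\<And>e. e \<in> N \<Longrightarrow> cinner e u = 0) \<Longrightarrow> u = 0"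
    by metis
  obtain E where E: "N \<subseteq> E" "is_onb E" by (rule onb_extend[OF N(2)])
  have alt: "b e = 0 \<or> c e = 0" if e: "e \<in> E" for e
  proof (cases "e \<in> N")
    case False
    have orth: "cinner f e = 0" if "f \<in> N" for f
      using E e False that unfolding is_onb_def orthonormal_def by (metis subsetD)
    have "b (c (c e)) = (b * c) (c e)" by simp
    then have "c (c e) \<in> ?N" unfolding bc by simp
    then have "cinner (c (c e)) e = 0"
      by (rule orthonormal_total_orthogonal[OF csubspace_kernel closed_kernel N(2,1) N(3) orth, rotated -1])
    then have "cinner (c e) (c e) = 0"
      by (simp add: selfadjoint_cinner[OF cs])
    then show ?thesis by (simp add: cinner_self)
  next
    case True
    then show ?thesis using N(1) by blast
  qed
  have p0: "0 \<le> p"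
  proof -
    have "a + - a \<le> p + p" by (rule add_mono[OF le])
    then have "0 \<le> (1/2) *\<^sub>R (p + p)" by (intro scaleR_nonneg_nonneg) auto
    then show ?thesis by simp
  qed
  have pS: "((\<lambda>e. inner e (p e)) has_sum S) E"
    by (rule pos_has_sum_onb[OF p0 E0 E(2) S])
  have hp: "inner e (h e) \<le> inner e (p e)" if "e \<in> E" for e
    using alt[OF that]
  proof
    assume "b e = 0"
    then have "h e = (- a) e" by (simp add: b_def eq_neg_iff_add_eq_0)
    then show ?thesis using bop_le_inner[OF le(2)] by simp
  next
    assume "c e = 0"
    then have "h e = a e" by (simp add: c_def)
    then show ?thesis using bop_le_inner[OF le(1)] by simp
  qed
  have "(\<lambda>e. inner e (h e)) summable_on E"
    by (rule summable_on_comparison_test[of "\<lambda>e. inner e (p e)"])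
       (use pS hp bop_pos_inner[OF h(1)] in \<open>auto simp: summable_on_def\<close>)
  then have hs: "((\<lambda>e. inner e (h e)) has_sum infsum (\<lambda>e. inner e (h e)) E) E" by simp
  show "trace_class a" "trace_norm a \<le> S"
    using trace_classI[OF E(2), of a] hs has_sum_mono[OF hs pS hp] by (simp_all add: h_def)
qed

lemma trace_norm_nonneg: "trace_class x \<Longrightarrow> 0 \<le> trace_norm (x :: 'a::complex_hilbert bop)"
  by (rule has_sum_nonneg[OF trace_norm_has_sum[OF _ some_onb]]) (auto intro: bop_pos_inner abs_op(1))

lemma trace_norm_eq_0:
  assumes "selfadjoint (a :: 'a::complex_hilbert bop)" "trace_class a" "trace_norm a = 0"
  shows "a = 0"
proof -
  let ?h = "abs_op a"
  have "inner e (?h e) = 0" if "e \<in> some_onb" for e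
    by (rule nonneg_has_sum_le_0D[OF trace_norm_has_sum[OF assms(2) some_onb] _ _ that])
       (simp_all add: assms(3) bop_pos_inner[OF abs_op(1)])
  then have "?h e = 0" if "e \<in> some_onb" for e
    using pos_norm_apply[OF abs_op(1), of a e] that by simp
  then have "cinner e (?h u) = 0" if "e \<in> some_onb" for e u
    using that by (simp add: selfadjoint_cinner[OF bop_pos_selfadjoint[OF abs_op(1)]])
  then have "?h u = 0" for u using some_onb unfolding is_onb_def by blast
  then have "?h = 0" by (intro bop_eqI) simp
  then have "a * a = 0" using abs_op(2)[of a] assms(1) by (simp add: selfadjoint_def)
  then show ?thesis by (rule selfadjoint_square_zero[OF assms(1)])
qed

lemma trace_class_zero: "trace_class (0 :: 'a::complex_hilbert bop)" "trace_norm (0 :: 'a bop) = 0"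
proof -
  have z: "((\<lambda>e. inner e ((0 :: 'a bop) e)) has_sum 0) some_onb"
    by (simp add: has_sum_0)
  have *: "trace_class (0 :: 'a bop)" "trace_norm (0 :: 'a bop) \<le> 0"
    by (rule trace_class_dominated[OF _ _ _ some_onb z]; simp add: selfadjoint_def)+
  then show "trace_class (0 :: 'a bop)" "trace_norm (0 :: 'a bop) = 0"
    using trace_norm_nonneg[OF *(1)] by auto
qed

lemma trace_class_add:
  assumes "selfadjoint (a :: 'a::complex_hilbert bop)" "trace_class a" "selfadjoint b" "trace_class b"
  shows "trace_class (a + b)" "trace_norm (a + b) \<le> trace_norm a + trace_norm b"
proof -
  have 1: "selfadjoint (a + b)" using assms by (simp add: selfadjoint_def)
  have 2: "a + b \<le> abs_op a + abs_op b" "- (a + b) \<le> abs_op a + abs_op b"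
    using add_mono[OF le_abs_op'[OF assms(1)] le_abs_op'[OF assms(3)]]
      add_mono[OF le_abs_op[OF assms(1)] le_abs_op[OF assms(3)]] by simp_all
  have 3: "((\<lambda>e. inner e ((abs_op a + abs_op b) e)) has_sum (trace_norm a + trace_norm b)) some_onb"
    using has_sum_add[OF trace_norm_has_sum[OF assms(2) some_onb] trace_norm_has_sum[OF assms(4) some_onb]]
    by (simp add: inner_add_right)
  show "trace_class (a + b)" "trace_norm (a + b) \<le> trace_norm a + trace_norm b"
    by (rule trace_class_dominated[OF 1 2 some_onb 3])+
qed

lemma trace_class_scaleR_le:
  assumes "selfadjoint (a :: 'a::complex_hilbert bop)" "trace_class a"
  shows "trace_class (r *\<^sub>R a)" "trace_norm (r *\<^sub>R a) \<le> \<bar>r\<bar> * trace_norm a"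
proof -
  have 1: "selfadjoint (r *\<^sub>R a)" using assms by (simp add: selfadjoint_def)
  have "\<bar>r\<bar> *\<^sub>R a \<le> \<bar>r\<bar> *\<^sub>R abs_op a" "\<bar>r\<bar> *\<^sub>R (- a) \<le> \<bar>r\<bar> *\<^sub>R abs_op a"
    by (intro scaleR_left_mono le_abs_op' le_abs_op assms abs_ge_zero)+
  then have 2: "r *\<^sub>R a \<le> \<bar>r\<bar> *\<^sub>R abs_op a" "- (r *\<^sub>R a) \<le> \<bar>r\<bar> *\<^sub>R abs_op a"
    by (cases "r \<ge> 0"; simp)+
  have 3: "((\<lambda>e. inner e ((\<bar>r\<bar> *\<^sub>R abs_op a) e)) has_sum (\<bar>r\<bar> * trace_norm a)) some_onb"
    using has_sum_cmult_right[OF trace_norm_has_sum[OF assms(2) some_onb], of "\<bar>r\<bar>"] by simp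
  show "trace_class (r *\<^sub>R a)" "trace_norm (r *\<^sub>R a) \<le> \<bar>r\<bar> * trace_norm a"
    by (rule trace_class_dominated[OF 1 2 some_onb 3])+
qed

lemma trace_norm_scaleR:
  assumes "selfadjoint (a :: 'a::complex_hilbert bop)" "trace_class a"
  shows "trace_norm (r *\<^sub>R a) = \<bar>r\<bar> * trace_norm a"
proof (cases "r = 0")
  case False
  have "selfadjoint (r *\<^sub>R a)" using assms by (simp add: selfadjoint_def)
  from trace_class_scaleR_le(2)[OF this trace_class_scaleR_le(1)[OF assms], of "1 / r"]
  have "trace_norm a \<le> trace_norm (r *\<^sub>R a) / \<bar>r\<bar>" using False by simp
  then have "\<bar>r\<bar> * trace_norm a \<le> trace_norm (r *\<^sub>R a)" using False by (simp add: field_simps)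
  then show ?thesis using trace_class_scaleR_le(2)[OF assms, of r] by simp
qed (simp add: trace_class_zero)

lemma trace_class_sandwich:
  assumes "selfadjoint (a :: 'a::complex_hilbert bop)" "trace_class a"
  shows "selfadjoint (x * a * x\<^sup>\<dagger>)" "trace_class (x * a * x\<^sup>\<dagger>)"
proof -
  define h where "h = abs_op a"
  show 1: "selfadjoint (x * a * x\<^sup>\<dagger>)" using assms(1) by (simp add: selfadjoint_def mult.assoc)
  have "0 \<le> x * (h - a) * x\<^sup>\<dagger>" "0 \<le> x * (h - - a) * x\<^sup>\<dagger>"
    using le_abs_op'[OF assms(1)] le_abs_op[OF assms(1)] unfolding h_def
    by (intro bop_sandwich_pos; simp only: diff_ge_0_iff_ge)+
  then have 2: "x * a * x\<^sup>\<dagger> \<le> x * h * x\<^sup>\<dagger>" "- (x * a * x\<^sup>\<dagger>) \<le> x * h * x\<^sup>\<dagger>"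
    by (simp_all only: right_diff_distrib left_diff_distrib mult_minus_left mult_minus_right diff_ge_0_iff_ge)
  have h0: "0 \<le> h" unfolding h_def by (rule abs_op(1))
  obtain s where s: "0 \<le> s" "s * s = h" using sqrt_exists[OF h0] by blast
  have sa: "s\<^sup>\<dagger> = s" using bop_pos_selfadjoint[OF s(1)] by (simp add: selfadjoint_def)
  have eq: "inner e ((y\<^sup>\<dagger> * y) e) = (norm (y e))\<^sup>2" for e and y :: "'a bop"
  proof -
    have "cinner e ((y\<^sup>\<dagger> * y) e) = cinner (y e) (y e)" by (simp add: adj)
    from arg_cong[OF this, of Re] show ?thesis by (simp only: Re_cinner power2_norm_eq_inner)
  qed
  have "(\<lambda>e. inner e (h e)) summable_on some_onb"
    using trace_norm_has_sum[OF assms(2) some_onb] by (auto simp: summable_on_def h_def)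
  then have "(\<lambda>e. (norm x)\<^sup>2 * (norm (s e))\<^sup>2) summable_on some_onb"
    using eq[of _ s] unfolding sa s(2) by (intro summable_on_cmult_right) simp
  then have "(\<lambda>e. (norm ((x * s) e))\<^sup>2) summable_on some_onb"
  proof (rule summable_on_comparison_test)
    show "(norm ((x * s) e))\<^sup>2 \<le> (norm x)\<^sup>2 * (norm (s e))\<^sup>2" for e
      unfolding power_mult_distrib[symmetric] bop_times_apply by (intro power_mono norm_bop) auto
  qed simp
  then obtain S where "((\<lambda>e. (norm ((x * s) e))\<^sup>2) has_sum S) some_onb" by (auto simp: summable_on_def)
  from Hilbert_Schmidt_adj[OF some_onb some_onb this]
  have "((\<lambda>e. inner e ((x * h * x\<^sup>\<dagger>) e)) has_sum S) some_onb"
    unfolding eq[symmetric] adj_adj adj_mult sa s(2)[symmetric] by (simp add: mult.assoc)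
  from trace_class_dominated(1)[OF 1 2 some_onb this] show "trace_class (x * a * x\<^sup>\<dagger>)" .
qed

text \<open>The real Banach space of self-adjoint trace class operators.\<close>

typedef (overloaded) 'a tsa = "{x :: 'a::complex_hilbert bop. selfadjoint x \<and> trace_class x}"
  morphisms tsa_op Tsa
  by (intro exI[of _ 0]) (simp add: selfadjoint_def trace_class_zero)

setup_lifting type_definition_tsa

instantiation tsa :: (complex_hilbert) real_normed_vector
begin

lift_definition zero_tsa :: "'a tsa" is 0
  by (simp add: selfadjoint_def trace_class_zero)
lift_definition plus_tsa :: "'a tsa \<Rightarrow> 'a tsa \<Rightarrow> 'a tsa" is "(+)"
  by (simp add: trace_class_add) (simp add: selfadjoint_def)
lift_definition scaleR_tsa :: "real \<Rightarrow> 'a tsa \<Rightarrow> 'a tsa" is "(*\<^sub>R)"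
  by (simp add: trace_class_scaleR_le) (simp add: selfadjoint_def)
lift_definition uminus_tsa :: "'a tsa \<Rightarrow> 'a tsa" is uminus
  using trace_class_scaleR_le(1)[of _ "-1"] by (auto simp: selfadjoint_def)
definition minus_tsa :: "'a tsa \<Rightarrow> 'a tsa \<Rightarrow> 'a tsa" where "minus_tsa \<rho> \<sigma> = \<rho> + - \<sigma>"
lift_definition norm_tsa :: "'a tsa \<Rightarrow> real" is trace_norm .
definition dist_tsa :: "'a tsa \<Rightarrow> 'a tsa \<Rightarrow> real" where "dist_tsa \<rho> \<sigma> = norm (\<rho> - \<sigma>)"
definition sgn_tsa :: "'a tsa \<Rightarrow> 'a tsa" where "sgn_tsa \<rho> = inverse (norm \<rho>) *\<^sub>R \<rho>"
definition uniformity_tsa :: "('a tsa \<times> 'a tsa) filter" where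
  "uniformity_tsa = (INF e\<in>{0<..}. principal {(x, y). dist x y < e})"
definition open_tsa :: "'a tsa set \<Rightarrow> bool" where
  "open_tsa S = (\<forall>x\<in>S. \<forall>\<^sub>F (x', y) in uniformity. x' = x \<longrightarrow> y \<in> S)"

instance
proof
  fix x y :: "'a tsa" and r :: real
  show "norm x = 0 \<longleftrightarrow> x = 0"
    by transfer (auto simp: trace_class_zero intro: trace_norm_eq_0)
  show "norm (x + y) \<le> norm x + norm y"
    by transfer (auto intro: trace_class_add)
  show "norm (r *\<^sub>R x) = \<bar>r\<bar> * norm x"
    by transfer (auto intro: trace_norm_scaleR)
qed (unfold dist_tsa_def open_tsa_def sgn_tsa_def uniformity_tsa_def minus_tsa_def,
     (rule refl | (transfer, force simp: algebra_simps))+)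

end

instantiation tsa :: (complex_hilbert) ordered_real_vector
begin

lift_definition less_eq_tsa :: "'a tsa \<Rightarrow> 'a tsa \<Rightarrow> bool" is "(\<le>)" .
lift_definition less_tsa :: "'a tsa \<Rightarrow> 'a tsa \<Rightarrow> bool" is "(<)" .

instance
  by standard (transfer, auto intro: scaleR_left_mono scaleR_right_mono)+

end

text \<open>\<open>\<rho> \<mapsto> x \<rho> x\<^sup>\<dagger>\<close>\<close>

lift_definition sandwich :: "'a::complex_hilbert bop \<Rightarrow> 'a tsa \<Rightarrow> 'a tsa" is "\<lambda>x \<rho>. x * \<rho> * x\<^sup>\<dagger>"
  by (simp add: trace_class_sandwich)

section \<open>Semigroups, generators and resolvents\<close>

text \<open>An unbounded operator is a partial function \<^typ>\<open>'a \<rightharpoonup> 'a\<close>, its domain being \<^const>\<open>dom\<close>;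
  the value at \<open>u\<close> in the domain is \<open>the (A u)\<close>.\<close>

definition clinear_operator :: "('a::complex_space \<rightharpoonup> 'a) \<Rightarrow> bool" where
  "clinear_operator A \<longleftrightarrow> csubspace (dom A) \<and>
     (\<forall>u\<in>dom A. \<forall>v\<in>dom A. the (A (u + v)) = the (A u) + the (A v)) \<and>
     (\<forall>c. \<forall>u\<in>dom A. the (A (c *\<^sub>C u)) = c *\<^sub>C the (A u))"

definition C0_semigroup :: "(real \<Rightarrow> 'a::real_normed_vector \<Rightarrow> 'a) \<Rightarrow> bool" where
  "C0_semigroup P \<longleftrightarrow>
     (\<forall>t\<ge>0. bounded_linear (P t)) \<and> P 0 = id \<and> (\<forall>s\<ge>0. \<forall>t\<ge>0. P (s + t) = P s \<circ> P t) \<and>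
     (\<forall>u. continuous_on {0..} (\<lambda>t. P t u))"

definition generator :: "(real \<Rightarrow> 'a::real_normed_vector \<Rightarrow> 'a) \<Rightarrow> ('a \<rightharpoonup> 'a)" where
  "generator P u =
     (if \<exists>v. ((\<lambda>t. (1 / t) *\<^sub>R (P t u - u)) \<longlongrightarrow> v) (at_right 0)
      then Some (Lim (at_right 0) (\<lambda>t. (1 / t) *\<^sub>R (P t u - u))) else None)"

definition resolvent :: "real \<Rightarrow> ('a::real_vector \<rightharpoonup> 'a) \<Rightarrow> 'a \<Rightarrow> 'a" where
  "resolvent l A w = (THE u. u \<in> dom A \<and> l *\<^sub>R u - the (A u) = w)"


section \<open>The minimal quantum dynamical semigroup\<close>

text \<open>The sequence \<open>(L\<^sub>l)\<close> is indexed by \<open>l \<ge> 1\<close>. Since \<^const>\<open>infsum\<close> is \<open>0\<close> for a family that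
  is not summable, convergence of the series is demanded separately.\<close>

definition premise ::
    "(real \<Rightarrow> 'a::complex_hilbert bop) \<Rightarrow> ('a \<rightharpoonup> 'a) \<Rightarrow> (nat \<Rightarrow> 'a \<rightharpoonup> 'a) \<Rightarrow> bool" where
  "premise P Y L \<longleftrightarrow>
     C0_semigroup (\<lambda>t. bop_apply (P t)) \<and> (\<forall>t\<ge>0. norm (P t) \<le> 1) \<and>
     Y = generator (\<lambda>t. bop_apply (P t)) \<and>
     (\<forall>l\<ge>1. clinear_operator (L l) \<and> dom Y \<subseteq> dom (L l)) \<and>
     (\<forall>u\<in>dom Y.
        (\<lambda>l. cinner (the (L l u)) (the (L l u))) summable_on {1..} \<and>
        cinner u (the (Y u)) + cinner (the (Y u)) u
          + (\<Sum>\<^sub>\<infinity>l\<in>{1..}. cinner (the (L l u)) (the (L l u))) \<in> \<real>\<^sub>\<le>\<^sub>0)"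

definition Upsilon ::
    "('a::complex_hilbert \<rightharpoonup> 'a) \<Rightarrow> (nat \<Rightarrow> 'a \<rightharpoonup> 'a) \<Rightarrow> 'a bop \<Rightarrow> 'a \<Rightarrow> 'a \<Rightarrow> complex" where
  "Upsilon Y L x v u =
     cinner v (x (the (Y u))) + cinner (the (Y v)) (x u)
       + (\<Sum>\<^sub>\<infinity>l\<in>{1..}. cinner (the (L l v)) (x (the (L l u))))"

text \<open>The weak topology \<open>\<sigma>(\<L>(H), \<T>(H))\<close> given by the functionals \<open>x \<mapsto> Tr (\<rho> x)\<close>.\<close>

definition sigma_weak :: "'a::complex_hilbert bop topology" where
  "sigma_weak = topology_generated_by {{x. Tr (\<rho> * x) \<in> U} | \<rho> U. trace_class \<rho> \<and> open U}"

text \<open>Positivity of the operator matrix \<open>(X\<^sub>i\<^sub>j)\<close> as an operator on \<open>H\<^sup>n\<close>, indices running over \<open>{..<n}\<close>.\<close>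

definition positive_matrix :: "nat \<Rightarrow> (nat \<Rightarrow> nat \<Rightarrow> 'a::complex_hilbert bop) \<Rightarrow> bool" where
  "positive_matrix n X \<longleftrightarrow>
     (\<forall>u. (\<Sum>i<n. \<Sum>j<n. cinner (u i) (bop_apply (X i j) (u j))) \<in> \<real>\<^sub>\<ge>\<^sub>0)"

definition completely_positive :: "('a::complex_hilbert bop \<Rightarrow> 'a bop) \<Rightarrow> bool" where
  "completely_positive \<Phi> \<longleftrightarrow>
     (\<forall>n X. positive_matrix n X \<longrightarrow> positive_matrix n (\<lambda>i j. \<Phi> (X i j)))"

definition quantum_dynamical_semigroup ::
    "(real \<Rightarrow> 'a::complex_hilbert bop \<Rightarrow> 'a bop) \<Rightarrow> bool" where
  "quantum_dynamical_semigroup T \<longleftrightarrow>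
     (\<forall>t\<ge>0. bounded_clinear (T t) \<and> completely_positive (T t) \<and>
            continuous_map sigma_weak sigma_weak (T t)) \<and>
     T 0 = id \<and> (\<forall>s\<ge>0. \<forall>t\<ge>0. T (s + t) = T s \<circ> T t) \<and>
     (\<forall>x. continuous_map (top_of_set {0..}) sigma_weak (\<lambda>t. T t x))"

definition conservative :: "(real \<Rightarrow> 'a::complex_hilbert bop \<Rightarrow> 'a bop) \<Rightarrow> bool" where
  "conservative T \<longleftrightarrow> (\<forall>t\<ge>0. T t 1 = 1)"

definition equation_E ::
    "('a::complex_hilbert \<rightharpoonup> 'a) \<Rightarrow> (nat \<Rightarrow> 'a \<rightharpoonup> 'a) \<Rightarrow> (real \<Rightarrow> 'a bop \<Rightarrow> 'a bop) \<Rightarrow> bool" where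
  "equation_E Y L T \<longleftrightarrow>
     (\<forall>u\<in>dom Y. \<forall>v\<in>dom Y. \<forall>x. \<forall>t\<ge>0.
        (\<lambda>s. Upsilon Y L (T s x) v u) integrable_on {0..t} \<and>
        cinner v (T t x u) = cinner v (x u) + integral {0..t} (\<lambda>s. Upsilon Y L (T s x) v u))"

definition minimal_qds ::
    "('a::complex_hilbert \<rightharpoonup> 'a) \<Rightarrow> (nat \<Rightarrow> 'a \<rightharpoonup> 'a) \<Rightarrow> (real \<Rightarrow> 'a bop \<Rightarrow> 'a bop) \<Rightarrow> bool" where
  "minimal_qds Y L T \<longleftrightarrow>
     quantum_dynamical_semigroup T \<and> (\<forall>t\<ge>0. T t 1 \<le> 1) \<and> equation_E Y L T \<and>
     (\<forall>U. quantum_dynamical_semigroup U \<longrightarrow> equation_E Y L U \<longrightarrow>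
        (\<forall>t\<ge>0. \<forall>x\<ge>0. T t x \<le> U t x))"

text \<open>The maps \<open>S t\<close> act on the trace class operators; the values of the function \<open>S t\<close> at other
  operators are irrelevant.\<close>

definition predual_semigroup ::
    "(real \<Rightarrow> 'a::complex_hilbert bop \<Rightarrow> 'a bop) \<Rightarrow> (real \<Rightarrow> 'a bop \<Rightarrow> 'a bop) \<Rightarrow> bool" where
  "predual_semigroup T S \<longleftrightarrow>
     (\<forall>t\<ge>0. \<forall>\<rho>. trace_class \<rho> \<longrightarrow>
        trace_class (S t \<rho>) \<and> (\<forall>x. Tr (S t \<rho> * x) = Tr (\<rho> * T t x)))"


section \<open>Honesty\<close>

definition restrict_tsa :: "('a::complex_hilbert bop \<Rightarrow> 'a bop) \<Rightarrow> 'a tsa \<Rightarrow> 'a tsa" where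
  "restrict_tsa \<Phi> \<rho> = Tsa (\<Phi> (tsa_op \<rho>))"

definition tsa_trace :: "'a::complex_hilbert tsa \<Rightarrow> real" where
  "tsa_trace \<rho> = Re (Tr (tsa_op \<rho>))"

definition op_A :: "(real \<Rightarrow> 'a::complex_hilbert bop) \<Rightarrow> ('a tsa \<rightharpoonup> 'a tsa)" where
  "op_A P = generator (\<lambda>t. sandwich (P t))"

definition pi_map :: "('a::complex_hilbert \<rightharpoonup> 'a) \<Rightarrow> 'a tsa \<Rightarrow> 'a tsa" where
  "pi_map Y = sandwich (Bop (resolvent 1 Y))"

definition core_Ds :: "('a::complex_hilbert \<rightharpoonup> 'a) \<Rightarrow> 'a tsa set" where
  "core_Ds Y = range (pi_map Y)"

definition op_B_core ::
    "('a::complex_hilbert \<rightharpoonup> 'a) \<Rightarrow> (nat \<Rightarrow> 'a \<rightharpoonup> 'a) \<Rightarrow> 'a tsa \<Rightarrow> 'a tsa" where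
  "op_B_core Y L \<rho> =
     (\<Sum>\<^sub>\<infinity>l\<in>{1..}. sandwich (Bop (\<lambda>w. the (L l (resolvent 1 Y w)))) (inv (pi_map Y) \<rho>))"

text \<open>\<open>core_Ds Y\<close> is dense and invariant under \<open>R(1, A)\<close>, because \<open>\<pi>\<close> commutes with the semigroup
  generated by \<open>A\<close>; so \<open>op_B_core\<close> is only applied inside \<open>core_Ds Y\<close> here.\<close>

definition J_1 ::
    "(real \<Rightarrow> 'a::complex_hilbert bop) \<Rightarrow> ('a \<rightharpoonup> 'a) \<Rightarrow> (nat \<Rightarrow> 'a \<rightharpoonup> 'a) \<Rightarrow> 'a tsa \<Rightarrow> 'a tsa" where
  "J_1 P Y L =
     (THE J. bounded_linear J \<and> (\<forall>\<rho>\<in>core_Ds Y. J \<rho> = op_B_core Y L (resolvent 1 (op_A P) \<rho>)))"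

definition op_B ::
    "(real \<Rightarrow> 'a::complex_hilbert bop) \<Rightarrow> ('a \<rightharpoonup> 'a) \<Rightarrow> (nat \<Rightarrow> 'a \<rightharpoonup> 'a) \<Rightarrow> ('a tsa \<rightharpoonup> 'a tsa)" where
  "op_B P Y L \<rho> =
     (if \<rho> \<in> dom (op_A P) then Some (J_1 P Y L (\<rho> - the (op_A P \<rho>))) else None)"

definition loss ::
    "(real \<Rightarrow> 'a::complex_hilbert bop) \<Rightarrow> ('a \<rightharpoonup> 'a) \<Rightarrow> (nat \<Rightarrow> 'a \<rightharpoonup> 'a) \<Rightarrow> 'a tsa \<Rightarrow> real" where
  "loss P Y L \<rho> = - tsa_trace (the (op_A P \<rho>) + the (op_B P Y L \<rho>))"

text \<open>The functional \<open>a\<close>-bar on \<open>D(G)\<close>: the value at \<open>\<eta> = R(\<lambda>, G) \<rho>\<close> is the sum of the series formed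
  with \<open>\<lambda>\<close> and \<open>\<rho>\<close>, which does not depend on \<open>\<lambda> > 0\<close>.\<close>

definition loss_bar ::
    "(real \<Rightarrow> 'a::complex_hilbert bop) \<Rightarrow> ('a \<rightharpoonup> 'a) \<Rightarrow> (nat \<Rightarrow> 'a \<rightharpoonup> 'a) \<Rightarrow>
     ('a tsa \<rightharpoonup> 'a tsa) \<Rightarrow> 'a tsa \<Rightarrow> real" where
  "loss_bar P Y L G \<eta> =
     (THE c. \<forall>l>0. \<forall>\<rho>. \<eta> \<in> dom G \<and> resolvent l G \<rho> = \<eta> \<longrightarrow>
        (\<lambda>k. loss P Y L (resolvent l (op_A P)
           (((\<lambda>\<sigma>. the (op_B P Y L (resolvent l (op_A P) \<sigma>))) ^^ k) \<rho>))) sums c)"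

definition honest ::
    "(real \<Rightarrow> 'a::complex_hilbert bop) \<Rightarrow> ('a \<rightharpoonup> 'a) \<Rightarrow> (nat \<Rightarrow> 'a \<rightharpoonup> 'a) \<Rightarrow>
     (real \<Rightarrow> 'a bop \<Rightarrow> 'a bop) \<Rightarrow> bool" where
  "honest P Y L S \<longleftrightarrow>
     (\<forall>t\<ge>0. \<forall>\<rho>\<ge>0. norm (restrict_tsa (S t) \<rho>) - norm \<rho> =
        - loss_bar P Y L (generator (\<lambda>s. restrict_tsa (S s)))
            (integral {0..t} (\<lambda>s. restrict_tsa (S s) \<rho>)))"

end

theory Submission
  imports Defs
begin

text \<open>Equality in the premise forces the loss functional \<open>a(\<rho>) = - Tr (A \<rho> + B \<rho>)\<close> to vanish on \<open>D(A)\<close>: on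
  the core it is the premise tested on rank one operators, and \<open>a \<circ> R(1,A)\<close> is bounded because
  \<open>Tr (B R(1,A) \<rho>) = Tr \<rho> - Tr (R(1,A) \<rho>) \<le> Tr \<rho>\<close> for positive \<open>\<rho>\<close> in the core. Hence \<open>a\<close>-bar vanishes on
  \<open>D(G)\<close>, and honesty says that \<open>S(t)\<close> preserves the norm, that is the trace, of positive \<open>\<rho>\<close>. As
  \<open>Tr (S(t) \<rho>) = Tr (\<rho> T(t) 1)\<close>, this means \<open>T(t) 1 = 1\<close>. The integral of \<open>S(s) \<rho>\<close> lies in \<open>D(G)\<close> because
  \<open>S\<close> is strongly continuous, which comes from the \<open>\<sigma>\<close>-weak continuity of \<open>T\<close>: weak convergence of
  positive trace class operators together with convergence of their traces is norm convergence.\<close>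

section \<open>Contraction semigroups\<close>

text \<open>Unbounded operators are kept at bay by factoring out resolvents. On the core everything
  is expressed by bounded maps, \<open>\<pi>\<close>, \<open>A\<pi>\<close> for A composed with
  \<open>\<pi>\<close>, and \<open>\<Phi>\<close> for B composed with \<open>\<pi>\<close>. The
  premise at u = R(1,Y) w becomes Tr (\<open>\<Phi>\<close> \<rho>) = - Tr (\<open>A\<pi>\<close>
  \<rho>) for \<rho> = |w><w|, hence for all \<rho>. Such transfers rest on one principle: the
  operators |u><u| with u in a dense set span a dense subspace of \<open>tsa\<close>. For u in D(Y)
  they lie in the core, since u = R(1,Y) (u - Y u). The obstacle is that \<open>resolvent\<close>,
  \<open>J_1\<close> and \<open>loss_bar\<close> are definite descriptions, while \<open>Bop\<close>
  and \<open>Tsa\<close> carry information only on legitimate arguments. Existence, uniqueness and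
  boundedness have to be established before any defining equation can be used. This is why
  completeness of \<open>tsa\<close>, the construction of resolvents and the bounded extension of B
  R(1,A) come before the conclusion that the loss vanishes.\<close>

lemma closed_equicontinuous_convergence:
  fixes T :: "'i \<Rightarrow> 'a::metric_space \<Rightarrow> 'b::metric_space"
  assumes T: "\<forall>\<^sub>F i in F. \<forall>x y. dist (T i x) (T i y) \<le> K * dist x y"
    and G: "\<And>x y. dist (G x) (G y) \<le> K * dist x y"
  shows "closed {x. ((\<lambda>i. T i x) \<longlongrightarrow> G x) F}"
  unfolding closed_limpt islimpt_approachable mem_Collect_eq
proof (intro allI impI tendstoI)
  fix x and e :: real
  assume x: "\<forall>e>0. \<exists>x'\<in>{x. ((\<lambda>i. T i x) \<longlongrightarrow> G x) F}. x' \<noteq> x \<and> dist x' x < e" and e: "e > 0"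
  \<comment> \<open>The sign of \<open>K\<close> is not prescribed; \<open>\<bar>K\<bar> + 1\<close>
    is positive and dominates \<open>K\<close>.\<close>
  define d where "d = e / (3 * (\<bar>K\<bar> + 1))"
  have d: "d > 0" using e by (simp add: d_def)
  obtain y where y: "((\<lambda>i. T i y) \<longlongrightarrow> G y) F" "dist y x < d"
    using x d by blast
  have Kd: "K * dist a b \<le> e / 3" if "dist a b < d" for a b :: 'a
  proof -
    have "K * dist a b \<le> (\<bar>K\<bar> + 1) * d"
      using that by (intro mult_mono) auto
    also have "\<dots> = e / 3" by (simp add: d_def field_simps)
    finally show ?thesis .
  qed
  have xy: "dist x y < d" using y(2) by (simp add: dist_commute)
  have "\<forall>\<^sub>F i in F. dist (T i y) (G y) < e / 3"
    using y(1) e by (intro tendstoD) auto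
  then show "\<forall>\<^sub>F i in F. dist (T i x) (G x) < e"
    using T
  proof eventually_elim
    case (elim i)
    have "dist (T i x) (T i y) \<le> e / 3" "dist (G y) (G x) \<le> e / 3"
      using elim(2) G[of y x] Kd[OF xy] Kd[OF y(2)] by (meson order_trans)+
    then show ?case
      using elim(1) dist_triangle[of "T i x" "G x" "T i y"] dist_triangle[of "T i y" "G x" "G y"]
      by linarith
  qed
qed

text \<open>The same three-epsilon estimate without a candidate for the limit. It is what produces
  the operator \<open>J_1\<close>, for which no formula off the core is at hand.\<close>

lemma closed_equicontinuous_Cauchy:
  fixes T :: "nat \<Rightarrow> 'a::metric_space \<Rightarrow> 'b::metric_space"
  assumes T: "\<And>n x y. dist (T n x) (T n y) \<le> K * dist x y"
  shows "closed {x. Cauchy (\<lambda>n. T n x)}"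
  unfolding closed_limpt islimpt_approachable mem_Collect_eq
proof (intro allI impI metric_CauchyI)
  fix x and e :: real
  assume x: "\<forall>e>0. \<exists>x'\<in>{x. Cauchy (\<lambda>n. T n x)}. x' \<noteq> x \<and> dist x' x < e" and e: "e > 0"
  define d where "d = e / (3 * (\<bar>K\<bar> + 1))"
  have d: "d > 0" using e by (simp add: d_def)
  obtain y where y: "Cauchy (\<lambda>n. T n y)" "dist y x < d"
    using x d by blast
  have Kd: "dist (T n y) (T n x) \<le> e / 3" for n
  proof -
    have "K * dist y x \<le> (\<bar>K\<bar> + 1) * d"
      using y(2) by (intro mult_mono) auto
    also have "\<dots> = e / 3" by (simp add: d_def field_simps)
    finally show ?thesis using T[of n y x] by linarith
  qed
  obtain M where M: "\<And>m n. m \<ge> M \<Longrightarrow> n \<ge> M \<Longrightarrow> dist (T m y) (T n y) < e / 3"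
    using metric_CauchyD[OF y(1), of "e / 3"] e by auto
  have "dist (T m x) (T n x) < e" if "m \<ge> M" "n \<ge> M" for m n
    using M[OF that] Kd[of m] Kd[of n] dist_triangle[of "T m x" "T n x" "T m y"]
      dist_triangle[of "T m y" "T n x" "T n y"] dist_commute[of "T m x" "T m y"]
    by linarith
  then show "\<exists>M. \<forall>m\<ge>M. \<forall>n\<ge>M. dist (T m x) (T n x) < e" by blast
qed

lemma generatorI:
  assumes "((\<lambda>t. (1 / t) *\<^sub>R (P t u - u)) \<longlongrightarrow> v) (at_right 0)"
  shows "u \<in> dom (generator P)" "the (generator P u) = v"
  using assms tendsto_Lim[OF trivial_limit_at_right_real assms]
  by (auto simp: generator_def dom_def)

lemma generatorD:
  assumes "u \<in> dom (generator P)"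
  shows "((\<lambda>t. (1 / t) *\<^sub>R (P t u - u)) \<longlongrightarrow> the (generator P u)) (at_right 0)"
proof -
  obtain v where v: "((\<lambda>t. (1 / t) *\<^sub>R (P t u - u)) \<longlongrightarrow> v) (at_right 0)"
    using assms by (auto simp: generator_def dom_def split: if_splits)
  then show ?thesis using generatorI(2)[where P = P and u = u and v = v] by simp
qed

text \<open>Serves for \<open>P t\<close> on the Hilbert space, for \<open>sandwich (P t)\<close>
  and the predual semigroup on \<open>tsa\<close>, and for the discounted semigroup in the
  construction of the resolvent.\<close>

locale contraction_semigroup =
  fixes P :: "real \<Rightarrow> 'a::banach \<Rightarrow> 'a"
  assumes C0: "C0_semigroup P"
    and contr: "\<And>t x. 0 \<le> t \<Longrightarrow> norm (P t x) \<le> norm x"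
begin

abbreviation A where "A \<equiv> generator P"

lemma bounded_linear_P: "0 \<le> t \<Longrightarrow> bounded_linear (P t)"
  using C0 by (simp add: C0_semigroup_def)

lemma zero: "P 0 x = x"
  using C0 by (simp add: C0_semigroup_def)

lemma add: "0 \<le> s \<Longrightarrow> 0 \<le> t \<Longrightarrow> P (s + t) x = P s (P t x)"
  using C0 by (simp add: C0_semigroup_def fun_eq_iff)

lemma cont: "0 \<le> a \<Longrightarrow> continuous_on {a..b} (\<lambda>t. P t x)"
  using C0 unfolding C0_semigroup_def by (meson atLeastatMost_subset_iff continuous_on_subset subsetI atLeast_iff atLeastAtMost_iff order_trans)

lemma intble: "0 \<le> a \<Longrightarrow> (\<lambda>s. P s x) integrable_on {a..b}"
  by (intro integrable_continuous_interval cont)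

lemma average_tendsto:
  assumes a: "0 \<le> a"
  shows "((\<lambda>h. (1 / h) *\<^sub>R integral {a..a+h} (\<lambda>s. P s x)) \<longlongrightarrow> P a x) (at_right 0)"
proof -
  let ?f = "\<lambda>u. integral {a..u} (\<lambda>s. P s x)"
  have "(?f has_vector_derivative P a x) (at a within {a..a+1})"
    by (rule integral_has_vector_derivative[OF cont[OF a]]) simp
  then have "((\<lambda>y. norm ((?f y - ?f a) - (y - a) *\<^sub>R P a x) / norm (y - a)) \<longlongrightarrow> 0) (at_right a)"
    by (simp add: has_vector_derivative_def has_derivative_iff_norm at_within_Icc_at_right)
  then have *: "((\<lambda>h. norm (?f (h + a) - h *\<^sub>R P a x) / norm h) \<longlongrightarrow> 0) (at_right 0)"
    unfolding filterlim_at_right_to_0[of _ _ a] by simp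
  have "((\<lambda>h. (1 / h) *\<^sub>R ?f (a + h) - P a x) \<longlongrightarrow> 0) (at_right 0)"
  proof (rule tendsto_norm_zero_cancel, rule Lim_transform_eventually[OF *])
    have "norm (?f (h + a) - h *\<^sub>R P a x) / norm h = norm ((1 / h) *\<^sub>R ?f (a + h) - P a x)" if "h > 0" for h
    proof -
      have "(1 / h) *\<^sub>R ?f (a + h) - P a x = (1 / h) *\<^sub>R (?f (h + a) - h *\<^sub>R P a x)"
        using that by (simp add: scaleR_diff_right add.commute)
      then show ?thesis using that by simp
    qed
    then show "\<forall>\<^sub>F h in at_right 0. norm (?f (h + a) - h *\<^sub>R P a x) / norm h
        = norm ((1 / h) *\<^sub>R ?f (a + h) - P a x)"
      by (intro eventually_at_right_less[THEN eventually_mono])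
  qed
  then show ?thesis by (rule LIM_zero_cancel)
qed

lemma shift_integral:
  assumes "0 \<le> a" "0 \<le> h"
  shows "P h (integral {a..b} (\<lambda>s. P s x)) = integral {a+h..b+h} (\<lambda>s. P s x)"
proof -
  have "P h (integral {a..b} (\<lambda>s. P s x)) = integral {a..b} (P h \<circ> (\<lambda>s. P s x))"
    using integral_linear[OF intble[OF assms(1)] bounded_linear_P[OF assms(2)]] by simp
  also have "\<dots> = integral {a..b} ((\<lambda>s. P s x) \<circ> (+) h)"
    using assms by (intro integral_cong) (simp add: add)
  finally show ?thesis by (simp only: integral_shift_Icc_real)
qed

text \<open>Shifting the window [0,t] by h leaves only its two ends. Divided by h they converge by
  \<open>average_tendsto\<close>, which puts the integral into the domain of the generator.\<close>

lemma diff_integral: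
  assumes "0 \<le> t" "0 \<le> h"
  shows "P h (integral {0..t} (\<lambda>s. P s x)) - integral {0..t} (\<lambda>s. P s x) =
    integral {t..t+h} (\<lambda>s. P s x) - integral {0..h} (\<lambda>s. P s x)"
proof -
  have "integral {0..t} (\<lambda>s. P s x) + integral {t..t+h} (\<lambda>s. P s x) = integral {0..t+h} (\<lambda>s. P s x)"
    "integral {0..h} (\<lambda>s. P s x) + integral {h..t+h} (\<lambda>s. P s x) = integral {0..t+h} (\<lambda>s. P s x)"
    using assms by (intro Henstock_Kurzweil_Integration.integral_combine intble; simp)+
  moreover have "P h (integral {0..t} (\<lambda>s. P s x)) = integral {h..t+h} (\<lambda>s. P s x)"
    using shift_integral[of 0 h t x] assms by simp
  ultimately show ?thesis by (simp add: algebra_simps)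
qed

lemma integral_in_dom:
  assumes t: "0 \<le> t"
  shows "integral {0..t} (\<lambda>s. P s x) \<in> dom A"
proof -
  let ?J = "integral {0..t} (\<lambda>s. P s x)"
  have "((\<lambda>h. (1 / h) *\<^sub>R integral {t..t+h} (\<lambda>s. P s x) - (1 / h) *\<^sub>R integral {0..0+h} (\<lambda>s. P s x))
      \<longlongrightarrow> P t x - P 0 x) (at_right 0)"
    by (intro tendsto_diff average_tendsto t order_refl)
  then have "((\<lambda>h. (1 / h) *\<^sub>R (P h ?J - ?J)) \<longlongrightarrow> P t x - P 0 x) (at_right 0)"
    by (rule Lim_transform_eventually)
       (use t in \<open>auto intro!: eventually_at_right_less[THEN eventually_mono] simp: diff_integral scaleR_diff_right[symmetric]\<close>)
  then show ?thesis by (rule generatorI)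
qed

text \<open>The averages of an orbit over [0,h] lie in the domain and tend to its starting
  point.\<close>

lemma dom_dense: "closure (dom A) = UNIV"
proof -
  have "x \<in> closure (dom A)" for x
  proof (rule Lim_in_closed_set[OF closed_closure _ trivial_limit_at_right_real])
    show "((\<lambda>h. (1 / h) *\<^sub>R integral {0..0+h} (\<lambda>s. P s x)) \<longlongrightarrow> x) (at_right 0)"
      using average_tendsto[of 0 x] by (simp add: zero)
    have "(1 / h) *\<^sub>R integral {0..0+h} (\<lambda>s. P s x) \<in> dom A" if h: "h > 0" for h
    proof -
      let ?J = "integral {0..h} (\<lambda>s. P s x)"
      have "((\<lambda>t. (1 / h) *\<^sub>R ((1 / t) *\<^sub>R (P t ?J - ?J))) \<longlongrightarrow> (1 / h) *\<^sub>R the (A ?J)) (at_right 0)"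
        using h by (intro tendsto_scaleR tendsto_const generatorD integral_in_dom) simp
      then have "((\<lambda>t. (1 / t) *\<^sub>R (P t ((1 / h) *\<^sub>R ?J) - (1 / h) *\<^sub>R ?J)) \<longlongrightarrow> (1 / h) *\<^sub>R the (A ?J)) (at_right 0)"
        by (rule Lim_transform_eventually)
           (auto intro!: eventually_at_right_less[THEN eventually_mono] simp: linear_simps[OF bounded_linear_P] algebra_simps)
      then show ?thesis using generatorI(1) by simp
    qed
    then show "\<forall>\<^sub>F h in at_right 0. (1 / h) *\<^sub>R integral {0..0+h} (\<lambda>s. P s x) \<in> closure (dom A)"
      by (intro eventually_at_right_less[THEN eventually_mono]) (use closure_subset in blast)
  qed
  then show ?thesis by auto
qed

lemma generator_commute:
  assumes B: "bounded_linear B" and BP: "\<And>t. 0 < t \<Longrightarrow> P t (B u) = B (P t u)" and u: "u \<in> dom A"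
  shows "B u \<in> dom A" "the (A (B u)) = B (the (A u))"
proof -
  interpret B: bounded_linear B by fact
  have "((\<lambda>t. B ((1 / t) *\<^sub>R (P t u - u))) \<longlongrightarrow> B (the (A u))) (at_right 0)"
    by (intro B.tendsto generatorD u)
  then have "((\<lambda>t. (1 / t) *\<^sub>R (P t (B u) - B u)) \<longlongrightarrow> B (the (A u))) (at_right 0)"
    by (rule Lim_transform_eventually)
       (auto intro!: eventually_at_right_less[THEN eventually_mono] simp: BP B.diff B.scaleR)
  then show "B u \<in> dom A" "the (A (B u)) = B (the (A u))"
    by (rule generatorI)+
qed

lemma generator_scaleR:
  assumes "u \<in> dom A" shows "r *\<^sub>R u \<in> dom A" "the (A (r *\<^sub>R u)) = r *\<^sub>R the (A u)"
  using generator_commute[OF bounded_linear_scaleR_right[of r] _ assms] linear_simps(5)[OF bounded_linear_P] by auto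

lemma generator_add:
  assumes "u \<in> dom A" "v \<in> dom A"
  shows "u + v \<in> dom A" "the (A (u + v)) = the (A u) + the (A v)"
proof -
  have "((\<lambda>t. (1 / t) *\<^sub>R (P t u - u) + (1 / t) *\<^sub>R (P t v - v)) \<longlongrightarrow> the (A u) + the (A v)) (at_right 0)"
    by (intro tendsto_add generatorD assms)
  moreover have "(1 / t) *\<^sub>R (P t u - u) + (1 / t) *\<^sub>R (P t v - v) = (1 / t) *\<^sub>R (P t (u + v) - (u + v))"
    if "0 < t" for t
    using linear_simps(1)[OF bounded_linear_P, of t u v] that by (simp add: algebra_simps)
  ultimately have "((\<lambda>t. (1 / t) *\<^sub>R (P t (u + v) - (u + v))) \<longlongrightarrow> the (A u) + the (A v)) (at_right 0)"
    by (auto elim!: Lim_transform_eventually intro!: eventually_at_right_less[THEN eventually_mono])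
  then show "u + v \<in> dom A" "the (A (u + v)) = the (A u) + the (A v)"
    by (rule generatorI)+
qed

lemma generator_diff:
  assumes "u \<in> dom A" "v \<in> dom A"
  shows "u - v \<in> dom A" "the (A (u - v)) = the (A u) - the (A v)"
  using generator_add[OF assms(1) generator_scaleR(1)[OF assms(2), of "-1"]]
    generator_scaleR(2)[OF assms(2), of "-1"] by simp_all

section \<open>Dissipativity and resolvents\<close>

lemma dissipative:
  assumes u: "u \<in> dom A"
  shows "l * norm u \<le> norm (l *\<^sub>R u - the (A u))"
proof (rule tendsto_lowerbound[OF _ _ trivial_limit_at_right_real])
  show "((\<lambda>h. norm (l *\<^sub>R u - (1 / h) *\<^sub>R (P h u - u))) \<longlongrightarrow> norm (l *\<^sub>R u - the (A u))) (at_right 0)"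
    by (intro tendsto_intros generatorD u)
  have "l * norm u \<le> norm (l *\<^sub>R u - (1 / h) *\<^sub>R (P h u - u))" if h: "h > 0" for h
  proof -
    \<comment> \<open>The vector (1/h + l) u splits into P h u / h, of norm at most norm u / h by
      contractivity, and the approximation of l u - A u; the multiple norm u / h then
      cancels.\<close>
    have "(1 / h + l) * norm u \<le> norm ((1 / h + l) *\<^sub>R u)" by (simp add: mult_right_mono)
    also have "(1 / h + l) *\<^sub>R u = (1 / h) *\<^sub>R P h u + (l *\<^sub>R u - (1 / h) *\<^sub>R (P h u - u))"
      by (simp add: algebra_simps)
    also have "norm \<dots> \<le> (1 / h) * norm (P h u) + norm (l *\<^sub>R u - (1 / h) *\<^sub>R (P h u - u))"
      by (rule norm_triangle_le) (use h in simp)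
    also have "(1 / h) * norm (P h u) \<le> (1 / h) * norm u"
      using h contr[of h u] by (intro mult_left_mono) auto
    finally show ?thesis by (simp add: algebra_simps)
  qed
  then show "\<forall>\<^sub>F h in at_right 0. l * norm u \<le> norm (l *\<^sub>R u - (1 / h) *\<^sub>R (P h u - u))"
    by (intro eventually_at_right_less[THEN eventually_mono])
qed

text \<open>Dissipativity makes l - A injective, so any solution of the resolvent equation is the
  one that the definite description selects.\<close>

lemma resolvent_eqI:
  assumes "0 < l" "u \<in> dom A" "l *\<^sub>R u - the (A u) = x"
  shows "resolvent l A x = u"
  unfolding resolvent_def
proof (rule the_equality)
  fix v assume v: "v \<in> dom A \<and> l *\<^sub>R v - the (A v) = x"
  have "l * norm (v - u) \<le> norm (l *\<^sub>R (v - u) - the (A (v - u)))"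
    using v assms by (intro dissipative generator_diff) auto
  also have "l *\<^sub>R (v - u) - the (A (v - u)) = 0"
    using v assms by (simp add: generator_diff algebra_simps)
  finally show "v = u" using assms(1) by (simp add: mult_le_0_iff)
qed (use assms in simp)

lemma discounted_semigroup:
  assumes "0 \<le> l"
  shows "contraction_semigroup (\<lambda>t x. exp (- (l * t)) *\<^sub>R P t x)"
proof
  have "continuous_on {0..} (\<lambda>t. P t x)" for x
    using C0 by (simp add: C0_semigroup_def)
  then show "C0_semigroup (\<lambda>t x. exp (- (l * t)) *\<^sub>R P t x)"
    unfolding C0_semigroup_def
    by (auto simp: fun_eq_iff zero add bounded_linear_P linear_simps[OF bounded_linear_P] distrib_left mult_exp_exp
        intro!: bounded_linear_intros continuous_intros)
  show "norm (exp (- (l * t)) *\<^sub>R P t x) \<le> norm x" if "0 \<le> t" for t x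
    using contr[OF that, of x] assms that
    by (simp add: mult_left_le_one_le mult_le_one order_trans[OF mult_left_le_one_le])
qed

text \<open>The resolvent is the Laplace transform of the semigroup; cutting \<open>{0..}\<close> into unit intervals
  turns the improper integral into a geometrically convergent series.\<close>

lemma resolvent_exists:
  assumes l: "0 < l"
  obtains u where "u \<in> dom A" "l *\<^sub>R u - the (A u) = x"
    "\<And>\<phi>. bounded_linear \<phi> \<Longrightarrow> (\<And>t. 0 \<le> t \<Longrightarrow> 0 \<le> \<phi> (P t x)) \<Longrightarrow> 0 \<le> (\<phi> u :: real)"
proof -
  define Q where "Q = (\<lambda>t x. exp (- (l * t)) *\<^sub>R P t x)"
  interpret Q: contraction_semigroup Q
    unfolding Q_def by (rule discounted_semigroup) (use l in simp)
  define J where "J t = integral {0..t} (\<lambda>s. Q s x)" for t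
  have nQ: "norm (Q (real k) y) \<le> exp (- l) ^ k * norm y" for k y
    using contr[of "real k" y] by (simp add: Q_def exp_of_nat_mult[symmetric] mult.commute mult_left_mono)
  have geo: "summable (\<lambda>k. exp (- l) ^ k)" using l by (intro summable_geometric) simp
  have summ: "summable (\<lambda>k. Q (real k) y)" for y
    by (rule summable_comparison_test'[OF summable_mult2[OF geo, of "norm y"]]) (rule nQ)
  define u where "u = (\<Sum>k. Q (real k) (J 1))"
  have sums_u: "(\<lambda>k. Q (real k) (J 1)) sums u" unfolding u_def by (rule summable_sums[OF summ])
  have Qu: "Q h u - u = - J h" if h: "0 \<le> h" for h
  proof -
    have "(\<lambda>k. Q h (Q (real k) (J 1)) - Q (real k) (J 1)) sums (Q h u - u)"
      by (intro sums_diff bounded_linear.sums[OF Q.bounded_linear_P[OF h]] sums_u)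
    moreover have "Q h (Q (real k) (J 1)) - Q (real k) (J 1) = Q (real (Suc k)) (J h) - Q (real k) (J h)" for k
    proof -
      have "Q h (Q (real k) (J 1)) = Q (real k) (Q h (J 1))"
        using h by (simp add: Q.add[symmetric] add.commute)
      then have "Q h (Q (real k) (J 1)) - Q (real k) (J 1) = Q (real k) (Q h (J 1) - J 1)"
        by (simp add: linear_simps[OF Q.bounded_linear_P])
      \<comment> \<open>Both sides are the integral of the orbit over [1,1+h] minus that over [0,h].
        Trading h for 1 in this way makes the series telescope.\<close>
      also have "Q h (J 1) - J 1 = Q 1 (J h) - J h"
        using Q.diff_integral[of 1 h x] Q.diff_integral[of h 1 x] Q.shift_integral[of 0 1 h x] h
        by (simp add: J_def add.commute)
      also have "Q (real k) \<dots> = Q (real (Suc k)) (J h) - Q (real k) (J h)"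
        by (simp add: linear_simps[OF Q.bounded_linear_P] Q.add[symmetric] add.commute)
      finally show ?thesis .
    qed
    moreover have "(\<lambda>k. Q (real (Suc k)) (J h) - Q (real k) (J h)) sums (0 - Q (real 0) (J h))"
      by (rule telescope_sums) (rule summable_LIMSEQ_zero[OF summ])
    ultimately show ?thesis using sums_unique2 Q.zero by fastforce
  qed
  have "((\<lambda>h. - ((1 / h) *\<^sub>R J (0 + h))) \<longlongrightarrow> - Q 0 x) (at_right 0)"
    unfolding J_def by (intro tendsto_minus Q.average_tendsto order_refl)
  then have "((\<lambda>h. (1 / h) *\<^sub>R (Q h u - u)) \<longlongrightarrow> - x) (at_right 0)"
    unfolding Q.zero
    by (rule Lim_transform_eventually)
       (auto intro!: eventually_at_right_less[THEN eventually_mono] simp: Qu)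
  moreover have "((\<lambda>h. exp (l * h)) \<longlongrightarrow> 1) (at_right 0)"
    by (auto intro!: tendsto_eq_intros)
  moreover have "((\<lambda>h. (exp (l * h) - 1) / h) \<longlongrightarrow> l) (at_right 0)"
  proof -
    have "((\<lambda>h. exp (l * h)) has_real_derivative l) (at 0 within {0<..})"
      by (auto intro!: derivative_eq_intros)
    then show ?thesis by (simp add: has_field_derivative_iff)
  qed
  \<comment> \<open>The discount is undone by a product rule: the difference quotient of P is exp (l
    h) times that of Q plus (exp (l h) - 1) / h times u.\<close>
  ultimately have "((\<lambda>h. exp (l * h) *\<^sub>R ((1 / h) *\<^sub>R (Q h u - u)) + ((exp (l * h) - 1) / h) *\<^sub>R u)
      \<longlongrightarrow> 1 *\<^sub>R (- x) + l *\<^sub>R u) (at_right 0)"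
    by (intro tendsto_intros)
  then have "((\<lambda>h. (1 / h) *\<^sub>R (P h u - u)) \<longlongrightarrow> 1 *\<^sub>R (- x) + l *\<^sub>R u) (at_right 0)"
  proof (rule Lim_transform_eventually)
    have "exp (l * h) *\<^sub>R ((1 / h) *\<^sub>R (Q h u - u)) + ((exp (l * h) - 1) / h) *\<^sub>R u = (1 / h) *\<^sub>R (P h u - u)" for h
    proof -
      have "exp (l * h) *\<^sub>R Q h u = P h u" by (simp add: Q_def exp_minus)
      moreover have "exp (l * h) *\<^sub>R ((1 / h) *\<^sub>R (Q h u - u)) =
          (1 / h) *\<^sub>R (exp (l * h) *\<^sub>R Q h u - exp (l * h) *\<^sub>R u)"
        by (simp add: scaleR_diff_right mult.commute)
      ultimately show ?thesis by (simp add: diff_divide_distrib algebra_simps)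
    qed
    then show "\<forall>\<^sub>F h in at_right 0. exp (l * h) *\<^sub>R ((1 / h) *\<^sub>R (Q h u - u)) + ((exp (l * h) - 1) / h) *\<^sub>R u
        = (1 / h) *\<^sub>R (P h u - u)" by simp
  qed
  then have "u \<in> dom A" "the (A u) = - x + l *\<^sub>R u"
    using generatorI by force+
  moreover have "0 \<le> \<phi> u"
    if \<phi>: "bounded_linear \<phi>" and pos: "\<And>t. 0 \<le> t \<Longrightarrow> 0 \<le> \<phi> (P t x)" for \<phi> :: "'a \<Rightarrow> real"
  proof -
    interpret \<phi>: bounded_linear \<phi> by fact
    have "0 \<le> \<phi> (Q (real k) (J 1))" for k
    proof -
      have "\<phi> (Q (real k) (J 1)) = \<phi> (integral {0+real k..1+real k} (\<lambda>s. Q s x))"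
        unfolding J_def by (subst Q.shift_integral) auto
      also have "\<dots> = integral {0+real k..1+real k} (\<phi> \<circ> (\<lambda>s. Q s x))"
        by (intro integral_linear[symmetric] Q.intble \<phi>) simp
      also have "\<dots> \<ge> 0"
        using pos by (intro integral_nonneg integrable_linear Q.intble \<phi>) (auto simp: Q_def \<phi>.scaleR)
      finally show ?thesis .
    qed
    then show ?thesis using sums_le[OF _ sums_zero \<phi>.sums[OF sums_u]] by simp
  qed
  ultimately show ?thesis using that[of u] by simp
qed

lemma resolvent:
  assumes "0 < l"
  shows "resolvent l A x \<in> dom A" "the (A (resolvent l A x)) = l *\<^sub>R resolvent l A x - x"
    "l * norm (resolvent l A x) \<le> norm x"
proof -
  obtain u where u: "u \<in> dom A" "l *\<^sub>R u - the (A u) = x"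
    using resolvent_exists[OF assms] by metis
  then show "resolvent l A x \<in> dom A" "the (A (resolvent l A x)) = l *\<^sub>R resolvent l A x - x"
    "l * norm (resolvent l A x) \<le> norm x"
    using dissipative[OF u(1), of l] resolvent_eqI[OF assms u] by auto
qed

text \<open>Positivity of the resolvent, phrased with functionals because the space carries no order
  here. On \<open>tsa\<close> it is applied to the quadratic forms \<rho> \<mapsto> <u, \<rho>
  u>.\<close>

lemma resolvent_nonneg:
  assumes "0 < l" "bounded_linear \<phi>" "\<And>t. 0 \<le> t \<Longrightarrow> 0 \<le> \<phi> (P t x)"
  shows "0 \<le> (\<phi> (resolvent l A x) :: real)"
  using resolvent_exists[OF assms(1), of x] resolvent_eqI[OF assms(1)] assms(2,3) by metis

lemma resolvent_bounded_linear:
  assumes l: "0 < l"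
  shows "bounded_linear (resolvent l A)"
proof (rule bounded_linear_intro)
  show "resolvent l A (x + y) = resolvent l A x + resolvent l A y" for x y
    by (rule resolvent_eqI[OF l])
       (simp_all add: generator_add resolvent[OF l] algebra_simps)
  show "resolvent l A (r *\<^sub>R x) = r *\<^sub>R resolvent l A x" for r x
    by (rule resolvent_eqI[OF l])
       (simp_all add: generator_scaleR resolvent[OF l] algebra_simps)
  show "norm (resolvent l A x) \<le> norm x * (1 / l)" for x
    using resolvent(3)[OF l, of x] l by (simp add: field_simps)
qed

lemma resolvent_commute:
  assumes "0 < l" and B: "bounded_linear B" and BP: "\<And>t u. 0 < t \<Longrightarrow> P t (B u) = B (P t u)"
  shows "resolvent l A (B x) = B (resolvent l A x)"
proof (rule resolvent_eqI[OF assms(1)])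
  interpret B: bounded_linear B by fact
  note * = generator_commute[OF B BP resolvent(1)[OF assms(1)]]
  show "B (resolvent l A x) \<in> dom A" by (rule *)
  show "l *\<^sub>R B (resolvent l A x) - the (A (B (resolvent l A x))) = B x"
    by (simp add: * resolvent[OF assms(1)] B.diff B.scaleR)
qed

lemma resolvent_inverse:
  assumes "0 < l" "u \<in> dom A"
  shows "resolvent l A (l *\<^sub>R u - the (A u)) = u"
  by (rule resolvent_eqI[OF assms refl])

text \<open>Continuity of R(1,A) gives u = R(1,A) (u - v) in the limit, and the right-hand side lies
  in the domain.\<close>

lemma generator_closed:
  assumes "\<And>n. f n \<in> dom A" "(f \<longlongrightarrow> u) F" "((\<lambda>n. the (A (f n))) \<longlongrightarrow> v) F" "F \<noteq> bot"
  shows "u \<in> dom A" "the (A u) = v"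
proof -
  interpret R: bounded_linear "resolvent 1 A" by (rule resolvent_bounded_linear) simp
  have "((\<lambda>n. resolvent 1 A (1 *\<^sub>R f n - the (A (f n)))) \<longlongrightarrow> resolvent 1 A (u - v)) F"
    unfolding scaleR_one by (intro R.tendsto tendsto_diff assms)
  then have "(f \<longlongrightarrow> resolvent 1 A (u - v)) F"
    using assms(1) resolvent_inverse[of 1] by simp
  then have u: "u = resolvent 1 A (u - v)"
    by (rule tendsto_unique[OF assms(4,2)])
  then show "u \<in> dom A" using resolvent(1)[of 1 "u - v"] by simp
  show "the (A u) = v" using resolvent(2)[of 1 "u - v"] u[symmetric] by simp
qed

text \<open>On the domain, m R(m,A) u - u = R(m,A) A u has norm at most norm (A u) / m; uniform
  contractivity carries the convergence to the closure. Taking m = Suc n keeps m positive at n =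
  0.\<close>

lemma resolvent_tendsto:
  shows "(\<lambda>n. real (Suc n) *\<^sub>R resolvent (real (Suc n)) A x) \<longlonglongrightarrow> x"
proof -
  define T where "T n x = real (Suc n) *\<^sub>R resolvent (real (Suc n)) A x" for n x
  have "dist (T n x) (T n y) \<le> 1 * dist x y" for n x y
    using resolvent(3)[of "real (Suc n)" "x - y"] linear_simps[OF resolvent_bounded_linear[of "real (Suc n)"]]
    by (simp add: dist_norm T_def flip: scaleR_diff_right)
  then have "closed {x. (\<lambda>n. T n x) \<longlonglongrightarrow> x}"
    by (intro closed_equicontinuous_convergence[where K = 1] always_eventually) auto
  moreover have "dom A \<subseteq> {x. (\<lambda>n. T n x) \<longlonglongrightarrow> x}"
  proof clarify
    fix u v assume "A u = Some v"
    then have u: "u \<in> dom A" and v: "the (A u) = v" by auto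
    have Tu: "T n u - u = resolvent (real (Suc n)) A v" for n
    proof -
      have "u = resolvent (real (Suc n)) A (real (Suc n) *\<^sub>R u - v)"
        using resolvent_inverse[of "real (Suc n)", OF _ u] v by simp
      then have "u = T n u - resolvent (real (Suc n)) A v"
        by (simp only: T_def linear_simps[OF resolvent_bounded_linear[of "real (Suc n)"]] of_nat_0_less_iff zero_less_Suc)
      then show ?thesis by (metis add.commute add_diff_cancel_left' diff_add_cancel)
    qed
    have "norm (T n u - u) \<le> norm v * (1 / real (Suc n))" for n
      unfolding Tu using resolvent(3)[of "real (Suc n)" v] by (simp add: field_simps)
    moreover have "(\<lambda>n. norm v * (1 / real (Suc n))) \<longlonglongrightarrow> 0"
      by (rule tendsto_mult_right_zero) (rule LIMSEQ_Suc[OF lim_1_over_n])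
    ultimately have "(\<lambda>n. T n u - u) \<longlonglongrightarrow> 0"
      using Lim_null_comparison[of "\<lambda>n. T n u - u" "\<lambda>n. norm v * (1 / real (Suc n))" sequentially]
      by (simp only: always_eventually simp_thms)
    then show "(\<lambda>n. T n u) \<longlonglongrightarrow> u" by (simp add: LIM_zero_iff)
  qed
  ultimately have "closure (dom A) \<subseteq> {x. (\<lambda>n. T n x) \<longlonglongrightarrow> x}" by (intro closure_minimal)
  then show ?thesis using dom_dense by (auto simp: T_def)
qed

end

section \<open>Self-adjoint trace class operators\<close>

lemma abs_op_pos:
  assumes "0 \<le> (p :: 'a::complex_hilbert bop)"
  shows "abs_op p = p"
  using sqrt_unique[OF abs_op(1) assms] abs_op(2)[of p] bop_pos_selfadjoint[OF assms]
  by (simp add: selfadjoint_def)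

lemma selfadjoint_cinner_real:
  assumes "selfadjoint (a :: 'a::complex_hilbert bop)"
  shows "cinner u (a u) = of_real (inner u (a u))"
proof -
  have "cnj (cinner u (a u)) = cinner u (a u)"
    using selfadjoint_cinner[OF assms, of u u] cinner_commute[of u "a u"] by simp
  then have "Im (cinner u (a u)) = 0" by (simp add: complex_eq_iff)
  then show ?thesis by (simp add: complex_eq_iff Re_cinner)
qed

lemma abs_inner_le_abs_op:
  assumes "selfadjoint (a :: 'a::complex_hilbert bop)"
  shows "\<bar>inner u (a u)\<bar> \<le> inner u (abs_op a u)"
  using bop_le_inner[OF le_abs_op'[OF assms], of u] bop_le_inner[OF le_abs_op[OF assms], of u]
  by auto

lemma abs_op_trace_class:
  assumes "trace_class (x :: 'a::complex_hilbert bop)"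
  shows "trace_class (abs_op x)"
  using assms by (simp add: trace_class_def abs_op_pos[OF abs_op(1)])

text \<open>Extend an orthonormal basis of the kernel of \<open>|a| + a\<close> and use \<open>(|a| + a) (|a| - a) = 0\<close>.\<close>

lemma abs_op_adapted_onb:
  assumes a: "selfadjoint (a :: 'a::complex_hilbert bop)"
  obtains E where "is_onb E" "\<And>e. e \<in> E \<Longrightarrow> inner e (abs_op a e) = \<bar>inner e (a e)\<bar>"
proof -
  define h where "h = abs_op a"
  have h: "0 \<le> h" "h * h = a * a" "a * h = h * a"
    using abs_op(1,2)[of a] selfadjoint_abs_commute[OF a] a by (simp_all add: h_def selfadjoint_def)
  define b c where "b = h + a" and "c = h - a"
  have bc: "b * c = 0" using h(2,3) by (simp add: b_def c_def algebra_simps)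
  have cs: "selfadjoint c"
    using bop_pos_selfadjoint[OF h(1)] a by (simp add: c_def selfadjoint_def)
  have "orthonormal ({} :: 'a set)" by (simp add: orthonormal_def)
  from orthonormal_extend[OF this empty_subsetI csubspace_kernel[of b]]
  obtain N where N: "N \<subseteq> {u. b u = 0}" "orthonormal N"
    "\<And>u. u \<in> {u. b u = 0} \<Longrightarrow> (\<And>e. e \<in> N \<Longrightarrow> cinner e u = 0) \<Longrightarrow> u = 0"
    by metis
  obtain E where E: "N \<subseteq> E" "is_onb E" by (rule onb_extend[OF N(2)])
  have alt: "b e = 0 \<or> c e = 0" if e: "e \<in> E" for e
  proof (cases "e \<in> N")
    case False
    have orth: "cinner f e = 0" if "f \<in> N" for f
      using E e False that unfolding is_onb_def orthonormal_def by (metis subsetD)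
    have "b (c (c e)) = (b * c) (c e)" by simp
    then have "c (c e) \<in> {u. b u = 0}" unfolding bc by simp
    then have "cinner (c (c e)) e = 0"
      by (rule orthonormal_total_orthogonal[OF csubspace_kernel closed_kernel N(2,1) N(3) orth, rotated -1])
    then have "cinner (c e) (c e) = 0"
      by (simp add: selfadjoint_cinner[OF cs])
    then show ?thesis by (simp add: cinner_self)
  qed (use N(1) in blast)
  have "inner e (abs_op a e) = \<bar>inner e (a e)\<bar>" if "e \<in> E" for e
    using alt[OF that]
  proof
    assume "b e = 0"
    then have "h e = - a e" by (simp add: b_def eq_neg_iff_add_eq_0)
    then show ?thesis using bop_pos_inner[OF h(1), of e] by (simp add: h_def)
  next
    assume "c e = 0"
    then have "h e = a e" by (simp add: c_def)
    then show ?thesis using bop_pos_inner[OF h(1), of e] by (simp add: h_def)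
  qed
  then show ?thesis by (rule that[OF E(2)])
qed

text \<open>In a basis adapted to the limit, its trace norm is the sum of the |<e, a e>|. Every
  finite part of this sum is a limit of the corresponding parts for \<open>X n\<close>, which stay
  below the trace norm of \<open>X n\<close>.\<close>

lemma trace_norm_lower_semicontinuous:
  fixes X :: "nat \<Rightarrow> 'a::complex_hilbert bop"
  assumes X: "\<And>n. selfadjoint (X n)" "\<And>n. trace_class (X n)" "\<And>n. trace_norm (X n) \<le> C"
    and a: "selfadjoint a" and lim: "\<And>u. (\<lambda>n. inner u (X n u)) \<longlonglongrightarrow> inner u (a u)"
  shows "trace_class a" "trace_norm a \<le> C"
proof -
  obtain E where E: "is_onb E" "\<And>e. e \<in> E \<Longrightarrow> inner e (abs_op a e) = \<bar>inner e (a e)\<bar>"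
    using abs_op_adapted_onb[OF a] by metis
  have fin: "(\<Sum>e\<in>F. inner e (abs_op a e)) \<le> C" if F: "finite F" "F \<subseteq> E" for F
  proof -
    have "(\<lambda>n. \<Sum>e\<in>F. \<bar>inner e (X n e)\<bar>) \<longlonglongrightarrow> (\<Sum>e\<in>F. \<bar>inner e (a e)\<bar>)"
      by (intro tendsto_sum tendsto_rabs lim)
    moreover have "(\<Sum>e\<in>F. \<bar>inner e (X n e)\<bar>) \<le> C" for n
    proof -
      have "(\<Sum>e\<in>F. \<bar>inner e (X n e)\<bar>) \<le> (\<Sum>e\<in>F. inner e (abs_op (X n) e))"
        by (intro sum_mono abs_inner_le_abs_op X)
      also have "\<dots> \<le> trace_norm (X n)"
        by (rule has_sum_mono2[OF has_sum_finite[OF F(1)] trace_norm_has_sum[OF X(2) E(1)] F(2)])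
           (rule bop_pos_inner[OF abs_op(1)])
      finally show ?thesis using X(3) by (rule order_trans)
    qed
    ultimately have "(\<Sum>e\<in>F. \<bar>inner e (a e)\<bar>) \<le> C"
      by (intro LIMSEQ_le_const2) auto
    moreover have "(\<Sum>e\<in>F. inner e (abs_op a e)) = (\<Sum>e\<in>F. \<bar>inner e (a e)\<bar>)"
      using F(2) E(2) by (intro sum.cong) auto
    ultimately show ?thesis by simp
  qed
  have "(\<lambda>e. inner e (abs_op a e)) summable_on E"
    by (rule nonneg_bdd_above_summable_on)
       (auto intro!: bdd_aboveI2[where M = C] fin bop_pos_inner abs_op(1))
  then have S: "((\<lambda>e. inner e (abs_op a e)) has_sum infsum (\<lambda>e. inner e (abs_op a e)) E) E" by simp
  show "trace_class a" "trace_norm a \<le> C"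
    using trace_classI[OF E(1) S] has_sum_le_finite_sums[OF S fin] by simp_all
qed

text \<open>A unit vector extends to an orthonormal basis, so the quadratic form of |a| is bounded
  by the trace norm; moreover a u and |a| u have the same norm.\<close>

lemma norm_bop_le_trace_norm:
  assumes a: "selfadjoint (a :: 'a::complex_hilbert bop)" "trace_class a"
  shows "norm a \<le> trace_norm a"
proof -
  let ?h = "abs_op a"
  have diag: "inner u (?h u) \<le> trace_norm a * (norm u)\<^sup>2" for u
  proof (cases "u = 0")
    case False
    define e where "e = (1 / norm u) *\<^sub>R u"
    have u: "u = norm u *\<^sub>R e" using False by (simp add: e_def)
    have "norm e = 1" using False by (simp add: e_def)
    then have "orthonormal {e}" by (simp add: orthonormal_def cinner_self)
    then obtain E where E: "{e} \<subseteq> E" "is_onb E" by (rule onb_extend)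
    have "(\<Sum>e\<in>{e}. inner e (?h e)) \<le> trace_norm a"
      by (rule has_sum_mono2[OF has_sum_finite trace_norm_has_sum[OF a(2) E(2)] E(1)])
         (auto intro: bop_pos_inner[OF abs_op(1)])
    then have "(norm u)\<^sup>2 * inner e (?h e) \<le> (norm u)\<^sup>2 * trace_norm a"
      by (intro mult_left_mono) auto
    moreover have "inner u (?h u) = (norm u)\<^sup>2 * inner e (?h e)"
      by (subst (1 2) u) (simp add: bop_simps power2_eq_square)
    ultimately show ?thesis by (simp add: mult.commute)
  qed simp
  \<comment> \<open>A self-improving estimate: the norm of |a| occurs on both sides, and squaring
    and cancelling leaves the trace norm.\<close>
  have "norm ?h \<le> sqrt (norm ?h * trace_norm a)"
  proof (rule norm_bop_bound)
    fix u
    have "(norm (?h u))\<^sup>2 \<le> norm ?h * (trace_norm a * (norm u)\<^sup>2)"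
      using pos_norm_apply[OF abs_op(1), of a u] mult_left_mono[OF diag[of u], of "norm ?h"] by simp
    also have "\<dots> = (sqrt (norm ?h * trace_norm a) * norm u)\<^sup>2"
      by (simp add: power_mult_distrib trace_norm_nonneg[OF a(2)])
    finally show "norm (?h u) \<le> sqrt (norm ?h * trace_norm a) * norm u"
      by (rule power2_le_imp_le) (simp add: trace_norm_nonneg[OF a(2)])
  qed (simp add: trace_norm_nonneg[OF a(2)])
  then have "(norm ?h)\<^sup>2 \<le> (sqrt (norm ?h * trace_norm a))\<^sup>2"
    by (intro power_mono) auto
  then have "norm ?h * norm ?h \<le> norm ?h * trace_norm a"
    by (simp add: power2_eq_square trace_norm_nonneg[OF a(2)])
  then have h: "norm ?h \<le> trace_norm a"
    using trace_norm_nonneg[OF a(2)] by (cases "?h = 0") auto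
  show ?thesis
  proof (rule norm_bop_bound[OF trace_norm_nonneg[OF a(2)]])
    fix u
    have "cinner (a u) (a u) = cinner (?h u) (?h u)"
    proof -
      have "cinner (a u) (a u) = cinner u ((a * a) u)"
        by (simp add: selfadjoint_cinner[OF a(1)])
      also have "a * a = ?h * ?h" using abs_op(2)[of a] a(1) by (simp add: selfadjoint_def)
      also have "cinner u ((?h * ?h) u) = cinner (?h u) (?h u)"
        by (simp add: selfadjoint_cinner[OF bop_pos_selfadjoint[OF abs_op(1)]])
      finally show ?thesis .
    qed
    then have "norm (a u) = norm (?h u)"
      unfolding cinner_self of_real_eq_iff by simp
    also have "\<dots> \<le> norm ?h * norm u" by (rule norm_bop)
    also have "\<dots> \<le> trace_norm a * norm u" by (intro mult_right_mono h) simp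
    finally show "norm (a u) \<le> trace_norm a * norm u" .
  qed
qed

lemma tsa_op_selfadjoint [simp]: "selfadjoint (tsa_op \<rho>)"
  and tsa_op_trace_class [simp]: "trace_class (tsa_op \<rho>)"
  using tsa_op[of \<rho>] by auto

lemma tsa_op_minus: "tsa_op (\<rho> - \<sigma>) = tsa_op \<rho> - tsa_op \<sigma>"
  unfolding minus_tsa_def minus_bop_def plus_tsa.rep_eq uminus_tsa.rep_eq ..

lemmas tsa_op_simps = zero_tsa.rep_eq plus_tsa.rep_eq uminus_tsa.rep_eq tsa_op_minus scaleR_tsa.rep_eq

lemma tsa_op_sum: "tsa_op (sum f F) = (\<Sum>i\<in>F. tsa_op (f i))"
  by (induction F rule: infinite_finite_induct) (simp_all add: tsa_op_simps)

lemma bop_sum_apply: "bop_apply (sum f F) u = (\<Sum>i\<in>F. bop_apply (f i) u)"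
  by (rule bounded_bilinear.sum_left[OF bounded_bilinear_bop_apply])

lemma tsa_eqI: "(\<And>u. tsa_op \<rho> u = tsa_op \<sigma> u) \<Longrightarrow> \<rho> = \<sigma>"
  by (simp add: bop_eqI flip: tsa_op_inject)

lemma norm_tsa_op: "norm (tsa_op \<rho>) \<le> norm \<rho>"
  unfolding norm_tsa.rep_eq by (rule norm_bop_le_trace_norm) auto

lemma bounded_linear_tsa_op: "bounded_linear tsa_op"
  by (rule bounded_linear_intro[where K = 1]) (simp_all add: tsa_op_simps norm_tsa_op)

lemma selfadjoint_diff: "selfadjoint a \<Longrightarrow> selfadjoint b \<Longrightarrow> selfadjoint (a - b)"
  by (simp add: selfadjoint_def)

text \<open>The limit in operator norm is the candidate. Lower semicontinuity turns the Cauchy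
  estimates into trace norm bounds for its distance to \<open>X n\<close>, and one such difference
  being trace class makes the limit itself trace class.\<close>

instance tsa :: (complex_hilbert) banach
proof
  fix X :: "nat \<Rightarrow> 'a tsa"
  assume X: "Cauchy X"
  have "Cauchy (\<lambda>n. tsa_op (X n))"
    by (rule bounded_linear.Cauchy[OF bounded_linear_tsa_op X])
  then obtain a where a: "(\<lambda>n. tsa_op (X n)) \<longlonglongrightarrow> a"
    by (auto simp: Cauchy_convergent_iff convergent_def)
  have lim: "(\<lambda>n. tsa_op (X n) u) \<longlonglongrightarrow> a u" for u
    by (intro tendsto_bop_apply a tendsto_const)
  have sa: "selfadjoint a"
  proof (rule selfadjointI)
    fix u v
    have "(\<lambda>n. cinner u (tsa_op (X n) v)) \<longlonglongrightarrow> cinner u (a v)"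
      "(\<lambda>n. cinner (tsa_op (X n) u) v) \<longlonglongrightarrow> cinner (a u) v"
      by (intro tendsto_intros lim)+
    then show "cinner u (a v) = cinner (a u) v"
      unfolding selfadjoint_cinner[OF tsa_op_selfadjoint] by (rule LIMSEQ_unique)
  qed
  have dom: "trace_class (tsa_op (X n) - a) \<and> trace_norm (tsa_op (X n) - a) \<le> C"
    if C: "\<And>m. m \<ge> n \<Longrightarrow> norm (X n - X m) \<le> C" for n C
  proof -
    let ?Y = "\<lambda>m. tsa_op (X n - X (m + n))"
    have 1: "trace_norm (?Y m) \<le> C" for m
      using C[of "m + n"] by (simp add: norm_tsa.rep_eq)
    have 2: "selfadjoint (tsa_op (X n) - a)"
      by (rule selfadjoint_diff[OF tsa_op_selfadjoint sa])
    have 3: "(\<lambda>m. inner u (?Y m u)) \<longlonglongrightarrow> inner u ((tsa_op (X n) - a) u)" for u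
      unfolding tsa_op_minus bop_diff_apply
      by (intro tendsto_inner tendsto_diff tendsto_const LIMSEQ_ignore_initial_segment[OF lim])
    note * = trace_norm_lower_semicontinuous[of ?Y, OF tsa_op_selfadjoint tsa_op_trace_class 1 2 3]
    show ?thesis by (intro conjI *)
  qed
  have ex: "\<exists>N. \<forall>n\<ge>N. trace_class (tsa_op (X n) - a) \<and> trace_norm (tsa_op (X n) - a) \<le> e" if e: "e > 0" for e
  proof -
    obtain N where "\<And>m n. m \<ge> N \<Longrightarrow> n \<ge> N \<Longrightarrow> norm (X m - X n) < e"
      using CauchyD[OF X e] by blast
    then show ?thesis by (intro exI[of _ N] allI impI dom) (auto intro: less_imp_le)
  qed
  obtain N where N: "trace_class (tsa_op (X N) - a)"
    using ex[of 1] by auto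
  have "selfadjoint (tsa_op (X N) - a)"
    by (rule selfadjoint_diff[OF tsa_op_selfadjoint sa])
  then have "tsa_op (Tsa (tsa_op (X N) - a)) = tsa_op (X N) - a"
    using N by (simp add: Tsa_inverse)
  then have xa: "tsa_op (X N - Tsa (tsa_op (X N) - a)) = a" by (simp add: tsa_op_minus)
  define x where "x = X N - Tsa (tsa_op (X N) - a)"
  have "norm (X n - x) = trace_norm (tsa_op (X n) - a)" for n
    unfolding norm_tsa.rep_eq tsa_op_minus xa[folded x_def] ..
  then have "X \<longlonglongrightarrow> x"
    using ex by (intro LIMSEQ_I) (metis dense le_less_trans)
  then show "convergent X" by (auto simp: convergent_def)
qed

lemma norm_tsa_pos: "0 \<le> \<rho> \<Longrightarrow> norm \<rho> = tsa_trace \<rho>"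
  by (simp add: less_eq_tsa.rep_eq zero_tsa.rep_eq norm_tsa.rep_eq trace_norm_def tsa_trace_def abs_op_pos)

lemma tsa_pos_inner: "0 \<le> \<rho> \<Longrightarrow> 0 \<le> inner u (tsa_op \<rho> u)"
  by (simp add: less_eq_tsa.rep_eq zero_tsa.rep_eq bop_pos_inner)

lemma tsa_posI: "(\<And>u. 0 \<le> inner u (tsa_op \<rho> u)) \<Longrightarrow> 0 \<le> \<rho>"
  by (simp add: less_eq_tsa.rep_eq zero_tsa.rep_eq bop_posI)

lemma tsa_leI: "(\<And>u. inner u (tsa_op \<rho> u) \<le> inner u (tsa_op \<sigma> u)) \<Longrightarrow> \<rho> \<le> \<sigma>"
  using tsa_posI[of "\<sigma> - \<rho>"] by (simp add: tsa_op_minus inner_diff_right)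

text \<open>\<open>Tr\<close> is an \<open>infsum\<close>, which is 0 on families that are not
  summable; comparison with |\<rho>| supplies the summability that gives the trace its
  meaning.\<close>

lemma tsa_trace_has_sum: "((\<lambda>e. inner e (tsa_op \<rho> e)) has_sum tsa_trace \<rho>) some_onb"
proof -
  have "(\<lambda>e. norm (inner e (tsa_op \<rho> e))) summable_on some_onb"
    by (rule summable_on_comparison_test[of "\<lambda>e. inner e (abs_op (tsa_op \<rho>) e)"])
       (use trace_norm_has_sum[OF tsa_op_trace_class some_onb, of \<rho>] abs_inner_le_abs_op[OF tsa_op_selfadjoint]
        in \<open>auto simp: summable_on_def\<close>)
  then have "(\<lambda>e. inner e (tsa_op \<rho> e)) summable_on some_onb"
    by (rule abs_summable_summable)
  then obtain S where S: "((\<lambda>e. inner e (tsa_op \<rho> e)) has_sum S) some_onb"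
    by (auto simp: summable_on_def)
  have "((\<lambda>e. cinner e (tsa_op \<rho> e)) has_sum of_real S) some_onb"
    unfolding selfadjoint_cinner_real[OF tsa_op_selfadjoint] by (rule has_sum_of_real[OF S])
  then have "Tr (tsa_op \<rho>) = of_real S" unfolding Tr_def by (rule infsumI)
  then show ?thesis using S by (simp add: tsa_trace_def)
qed

lemma tsa_trace_le_norm: "\<bar>tsa_trace \<rho>\<bar> \<le> norm \<rho>"
proof -
  note * = trace_norm_has_sum[OF tsa_op_trace_class some_onb, of \<rho>, folded norm_tsa.rep_eq]
  have "tsa_trace \<rho> \<le> norm \<rho>"
    by (rule has_sum_mono[OF tsa_trace_has_sum *])
       (use abs_inner_le_abs_op[OF tsa_op_selfadjoint] abs_le_D1 in blast)
  moreover have "- tsa_trace \<rho> \<le> norm \<rho>"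
    by (rule has_sum_mono[OF _ *, of "\<lambda>e. - inner e (tsa_op \<rho> e)"])
       (use abs_inner_le_abs_op[OF tsa_op_selfadjoint] abs_le_D2 tsa_trace_has_sum in \<open>auto simp: has_sum_uminus\<close>)
  ultimately show ?thesis by linarith
qed

lemma bounded_linear_tsa_trace: "bounded_linear tsa_trace"
proof (rule bounded_linear_intro[where K = 1])
  show "tsa_trace (\<rho> + \<sigma>) = tsa_trace \<rho> + tsa_trace \<sigma>" for \<rho> \<sigma> :: "'a tsa"
    using has_sum_unique[OF tsa_trace_has_sum[of "\<rho> + \<sigma>"]] has_sum_add[OF tsa_trace_has_sum tsa_trace_has_sum, of \<rho> \<sigma>]
    by (simp add: tsa_op_simps inner_add_right)
  show "tsa_trace (r *\<^sub>R \<rho>) = r *\<^sub>R tsa_trace \<rho>" for r and \<rho> :: "'a tsa"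
    using has_sum_unique[OF tsa_trace_has_sum[of "r *\<^sub>R \<rho>"]] has_sum_cmult_right[OF tsa_trace_has_sum, of r \<rho>]
    by (simp add: tsa_op_simps)
qed (simp add: tsa_trace_le_norm)

lemmas tsa_trace_simps = linear_simps[OF bounded_linear_tsa_trace]

lemma norm_tsa_dominated:
  assumes "- \<sigma> \<le> \<rho>" "\<rho> \<le> \<sigma>"
  shows "norm \<rho> \<le> norm (\<sigma> :: 'a::complex_hilbert tsa)"
proof -
  have le: "tsa_op \<rho> \<le> tsa_op \<sigma>" "- tsa_op \<rho> \<le> tsa_op \<sigma>"
    using assms by (simp_all add: less_eq_tsa.rep_eq tsa_op_simps minus_le_iff)
  have "norm \<rho> \<le> tsa_trace \<sigma>"
    using trace_class_dominated(2)[OF tsa_op_selfadjoint le some_onb tsa_trace_has_sum]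
    by (simp add: norm_tsa.rep_eq)
  then show ?thesis using tsa_trace_le_norm[of \<sigma>] by linarith
qed

lemma tsa_Jordan_decomposition:
  fixes \<rho> :: "'a::complex_hilbert tsa"
  obtains p q where "0 \<le> p" "0 \<le> q" "\<rho> = p - q" "norm \<rho> = norm p + norm q"
proof -
  define h where "h = Tsa (abs_op (tsa_op \<rho>))"
  have h: "tsa_op h = abs_op (tsa_op \<rho>)"
    unfolding h_def
    by (rule Tsa_inverse) (simp add: abs_op_trace_class bop_pos_selfadjoint[OF abs_op(1)])
  have h0: "0 \<le> h" by (simp add: less_eq_tsa.rep_eq zero_tsa.rep_eq h abs_op(1))
  have le: "\<rho> \<le> h" "- \<rho> \<le> h"
    by (simp_all add: less_eq_tsa.rep_eq uminus_tsa.rep_eq h le_abs_op le_abs_op')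
  define p q where "p = (1/2) *\<^sub>R (h + \<rho>)" and "q = (1/2) *\<^sub>R (h - \<rho>)"
  have p: "0 \<le> p" unfolding p_def
    using le(2) by (intro scaleR_nonneg_nonneg) (auto simp: add.commute neg_le_iff_le add_increasing dest: add_right_mono[of "- \<rho>" h \<rho>])
  have q: "0 \<le> q" unfolding q_def
    using le(1) by (intro scaleR_nonneg_nonneg) auto
  have "\<rho> = p - q"
    by (simp add: p_def q_def scaleR_diff_right[symmetric] scaleR_2[symmetric] del: scaleR_diff_right)
  moreover have "norm \<rho> = norm p + norm q"
  proof -
    have "norm p + norm q = tsa_trace h"
      by (simp add: norm_tsa_pos p q) (simp add: p_def q_def tsa_trace_simps field_simps)
    also have "\<dots> = norm \<rho>"
      unfolding tsa_trace_def h norm_tsa.rep_eq trace_norm_def ..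
    finally show ?thesis by simp
  qed
  ultimately show ?thesis using p q that by blast
qed

text \<open>Bounds need only be checked on positive operators, without loss in the constant, because
  the norm is additive along the Jordan decomposition.\<close>

lemma norm_tsa_linear_bound:
  fixes f :: "'a::complex_hilbert tsa \<Rightarrow> 'b::real_normed_vector"
  assumes add: "\<And>\<rho> \<sigma>. f (\<rho> + \<sigma>) = f \<rho> + f \<sigma>"
    and pos: "\<And>\<rho>. 0 \<le> \<rho> \<Longrightarrow> norm (f \<rho>) \<le> C * norm \<rho>"
  shows "norm (f \<rho>) \<le> C * norm \<rho>"
proof -
  obtain p q where pq: "0 \<le> p" "0 \<le> q" "\<rho> = p - q" "norm \<rho> = norm p + norm q"
    by (rule tsa_Jordan_decomposition)
  have "f p = f \<rho> + f q" using add[of \<rho> q] pq(3) by simp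
  then have "norm (f \<rho>) \<le> norm (f p) + norm (f q)"
    using norm_triangle_ineq4[of "f p" "f q"] by simp
  also have "\<dots> \<le> C * norm p + C * norm q" by (intro add_mono pos pq)
  finally show ?thesis by (simp add: pq(4) distrib_left)
qed

section \<open>Rank one operators\<close>

lift_definition rank_one :: "'a::complex_hilbert \<Rightarrow> 'a bop" is "\<lambda>u w. cinner u w *\<^sub>C u"
  unfolding bounded_clinear_def
proof (intro conjI allI)
  fix u :: 'a
  have "norm (cinner u w *\<^sub>C u) \<le> norm w * (norm u * norm u)" for w
    using mult_right_mono[OF cinner_Cauchy_Schwarz[of u w], of "norm u"] by (simp add: mult_ac)
  then show "bounded_linear (\<lambda>w. cinner u w *\<^sub>C u)"
    by (intro bounded_linear_intro[where K = "norm u * norm u"])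
       (auto simp: cinner_add_right scaleC_add_left simp flip: scaleC_of_real)
qed simp

declare rank_one.rep_eq [simp]

lemma inner_rank_one: "inner w (rank_one u w) = (cmod (cinner w u))\<^sup>2"
proof -
  have "cinner w (rank_one u w) = cinner w u * cnj (cinner w u)"
    by (simp add: mult.commute flip: cinner_commute[of u w])
  then have "cinner w (rank_one u w) = of_real ((cmod (cinner w u))\<^sup>2)"
    by (simp only: complex_norm_square)
  from arg_cong[OF this, of Re] show ?thesis by (simp only: Re_cinner Re_complex_of_real)
qed

lemma rank_one_selfadjoint: "selfadjoint (rank_one u)"
  by (rule selfadjointI) (simp add: mult.commute flip: cinner_commute)

lemma rank_one_pos: "0 \<le> rank_one u"
  by (rule bop_posI[OF rank_one_selfadjoint]) (simp add: inner_rank_one del: rank_one.rep_eq)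

lemma rank_one_has_sum: "is_onb E \<Longrightarrow> ((\<lambda>e. inner e (rank_one u e)) has_sum (norm u)\<^sup>2) E"
  unfolding inner_rank_one by (rule Parseval)

lift_definition ket :: "'a::complex_hilbert \<Rightarrow> 'a tsa" is rank_one
proof (intro conjI)
  fix u :: 'a
  show "trace_class (rank_one u)"
    by (rule trace_class_dominated(1)[OF rank_one_selfadjoint order_refl _ some_onb rank_one_has_sum[OF some_onb]])
       (use rank_one_pos[of u] in \<open>auto intro: order_trans[of _ 0]\<close>)
qed (rule rank_one_selfadjoint)

lemma ket_pos: "0 \<le> ket u"
  by (simp add: less_eq_tsa.rep_eq zero_tsa.rep_eq ket.rep_eq rank_one_pos)

lemma tsa_trace_ket: "tsa_trace (ket u) = (norm u)\<^sup>2"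
  by (rule has_sum_unique[OF tsa_trace_has_sum[of "ket u", unfolded ket.rep_eq] rank_one_has_sum[OF some_onb]])

lemma norm_ket: "norm (ket u) = (norm u)\<^sup>2"
  by (simp add: norm_tsa_pos ket_pos tsa_trace_ket)

text \<open>The operator |u><v| + |v><u|, obtained by polarization; |u><v| alone is in general not
  self-adjoint.\<close>

definition ket2 :: "'a::complex_hilbert \<Rightarrow> 'a \<Rightarrow> 'a tsa" where
  "ket2 u v = ket (u + v) - ket u - ket v"

lemma ket2_apply: "tsa_op (ket2 u v) w = cinner u w *\<^sub>C v + cinner v w *\<^sub>C u"
  by (simp add: ket2_def tsa_op_simps ket.rep_eq cinner_add_left scaleC_add_left scaleC_add_right)

lemma scaleC_minus_left: "(- c) *\<^sub>C x = - (c *\<^sub>C (x :: 'a::complex_space))"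
  using scaleC_minus_one[of "c *\<^sub>C x"] by simp

lemma scaleC_diff_left: "(c - d) *\<^sub>C x = c *\<^sub>C x - d *\<^sub>C (x :: 'a::complex_space)"
  using scaleC_add_left[of c "- d" x] by (simp add: scaleC_minus_left)

lemma scaleC_diff_right: "c *\<^sub>C (x - y) = c *\<^sub>C x - c *\<^sub>C (y :: 'a::complex_space)"
  using scaleC_add_right[of c x "- y"] by (simp add: scaleC_minus_right)

lemma ket2_parallelogram: "2 *\<^sub>R ket2 u v = ket (u + v) - ket (u - v)"
  by (rule tsa_eqI)
     (simp add: ket2_apply tsa_op_simps ket.rep_eq cinner_add_left cinner_diff_left scaleC_add_left
       scaleC_add_right scaleC_diff_left scaleC_diff_right scaleR_2)

text \<open>The parallelogram form bounds the norm by the sum of the squared norms of u and v;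
  rescaling both to unit vectors turns this into the product bound with constant 2.\<close>

lemma bounded_bilinear_ket2: "bounded_bilinear ket2"
proof
  show "ket2 (u + u') v = ket2 u v + ket2 u' v" for u u' v :: 'a
    by (rule tsa_eqI) (simp add: ket2_apply tsa_op_simps cinner_add_left scaleC_add_left scaleC_add_right)
  show "ket2 u (v + v') = ket2 u v + ket2 u v'" for u v v' :: 'a
    by (rule tsa_eqI) (simp add: ket2_apply tsa_op_simps cinner_add_left scaleC_add_left scaleC_add_right)
  show *: "ket2 (r *\<^sub>R u) v = r *\<^sub>R ket2 u v" for r and u v :: 'a
    by (rule tsa_eqI) (simp add: ket2_apply tsa_op_simps scaleC_add_right mult.commute flip: scaleC_of_real)
  show **: "ket2 u (r *\<^sub>R v) = r *\<^sub>R ket2 u v" for r and u v :: 'a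
    by (rule tsa_eqI) (simp add: ket2_apply tsa_op_simps scaleC_add_right mult.commute flip: scaleC_of_real)
  have le: "norm (ket2 u v) \<le> (norm u)\<^sup>2 + (norm v)\<^sup>2" for u v :: 'a
  proof -
    have "norm (ket2 u v) \<le> (1/2) * ((norm (u + v))\<^sup>2 + (norm (u - v))\<^sup>2)"
      using norm_triangle_ineq4[of "ket (u + v)" "ket (u - v)"] by (simp add: norm_ket flip: ket2_parallelogram)
    also have "\<dots> = (norm u)\<^sup>2 + (norm v)\<^sup>2"
      by (simp add: power2_norm_eq_inner algebra_simps)
    finally show ?thesis .
  qed
  have "norm (ket2 u v) \<le> norm u * norm v * 2" for u v :: 'a
  proof (cases "u = 0 \<or> v = 0")
    case True
    then show ?thesis using *[of 0 0 v] **[of u 0 0] by auto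
  next
    case False
    have "ket2 u v = ket2 (norm u *\<^sub>R ((1 / norm u) *\<^sub>R u)) (norm v *\<^sub>R ((1 / norm v) *\<^sub>R v))"
      using False by simp
    also have "\<dots> = norm u *\<^sub>R norm v *\<^sub>R ket2 ((1 / norm u) *\<^sub>R u) ((1 / norm v) *\<^sub>R v)"
      unfolding * ** by simp
    also have "norm \<dots> \<le> norm u * (norm v * 2)"
      using le[of "(1 / norm u) *\<^sub>R u" "(1 / norm v) *\<^sub>R v"] False
      by (auto intro!: mult_left_mono)
    finally show ?thesis by simp
  qed
  then show "\<exists>K. \<forall>(u::'a) v. norm (ket2 u v) \<le> norm u * norm v * K" by blast
qed

lemma ket_eq_ket2: "ket u = (1/2) *\<^sub>R ket2 u u"
  by (rule tsa_eqI) (simp add: ket2_apply tsa_op_simps ket.rep_eq flip: scaleR_2)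

lemma tendsto_ket: "(f \<longlongrightarrow> u) F \<Longrightarrow> ((\<lambda>i. ket (f i)) \<longlongrightarrow> ket u) F"
  unfolding ket_eq_ket2 by (intro tendsto_scaleR tendsto_const bounded_bilinear.tendsto[OF bounded_bilinear_ket2])

text \<open>With \<open>\<rho> = s\<^sup>2\<close> one has \<open>\<rho> = \<Sum>\<^sub>e |s e\<rangle>\<langle>s e|\<close>, the error of a partial sum being positive,
  so that its norm is its trace.\<close>

lemma tsa_pos_ket_has_sum:
  assumes "0 \<le> \<rho>"
  obtains s where "((\<lambda>e. ket (bop_apply s e)) has_sum \<rho>) some_onb"
    "s\<^sup>\<dagger> = s" "s * s = tsa_op \<rho>" "((\<lambda>e. (norm (s e))\<^sup>2) has_sum norm \<rho>) some_onb"
proof -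
  have \<rho>: "0 \<le> tsa_op \<rho>" using assms by (simp add: less_eq_tsa.rep_eq zero_tsa.rep_eq)
  obtain s where s: "0 \<le> s" "s * s = tsa_op \<rho>" using sqrt_exists[OF \<rho>] by blast
  note sa = bop_pos_selfadjoint[OF s(1)]
  have sq: "inner u (tsa_op \<rho> u) = (norm (s u))\<^sup>2" for u
  proof -
    have "cinner u (tsa_op \<rho> u) = cinner (s u) (s u)"
      by (simp add: selfadjoint_cinner[OF sa] flip: s(2))
    from arg_cong[OF this, of Re] show ?thesis by (simp add: Re_cinner power2_norm_eq_inner)
  qed
  have tr: "((\<lambda>e. (norm (s e))\<^sup>2) has_sum norm \<rho>) some_onb"
    using tsa_trace_has_sum[of \<rho>] unfolding sq norm_tsa_pos[OF assms] .
  have diff: "norm ((\<Sum>e\<in>F. ket (s e)) - \<rho>) = norm \<rho> - (\<Sum>e\<in>F. (norm (s e))\<^sup>2)"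
    if F: "finite F" "F \<subseteq> some_onb" for F
  proof -
    \<comment> \<open>As quadratic forms at u this is Bessel's inequality for
      \<open>s u\<close>.\<close>
    have "(\<Sum>e\<in>F. ket (s e)) \<le> \<rho>"
    proof (rule tsa_leI)
      fix u
      have "inner u (tsa_op (\<Sum>e\<in>F. ket (s e)) u) = (\<Sum>e\<in>F. (cmod (cinner u (s e)))\<^sup>2)"
        by (simp add: tsa_op_sum bop_sum_apply inner_sum_right ket.rep_eq inner_rank_one del: rank_one.rep_eq)
      also have "\<dots> = (\<Sum>e\<in>F. (cmod (cinner e (s u)))\<^sup>2)"
        using selfadjoint_cinner[OF sa] by (metis cinner_commute complex_mod_cnj)
      also have "\<dots> \<le> (norm (s u))\<^sup>2"
        using some_onb F by (intro Bessel_finite) (auto simp: is_onb_def)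
      finally show "inner u (tsa_op (\<Sum>e\<in>F. ket (s e)) u) \<le> inner u (tsa_op \<rho> u)"
        by (simp add: sq)
    qed
    then have "norm (\<rho> - (\<Sum>e\<in>F. ket (s e))) = tsa_trace (\<rho> - (\<Sum>e\<in>F. ket (s e)))"
      by (intro norm_tsa_pos) simp
    also have "\<dots> = norm \<rho> - (\<Sum>e\<in>F. (norm (s e))\<^sup>2)"
      by (simp add: tsa_trace_simps linear_sum[OF bounded_linear.linear[OF bounded_linear_tsa_trace]]
          tsa_trace_ket norm_tsa_pos assms)
    finally show ?thesis by (simp add: norm_minus_commute)
  qed
  have "((\<lambda>F. norm \<rho> - (\<Sum>e\<in>F. (norm (s e))\<^sup>2)) \<longlongrightarrow> norm \<rho> - norm \<rho>) (finite_subsets_at_top some_onb)"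
    using tr unfolding has_sum_def by (intro tendsto_diff tendsto_const)
  moreover have "\<forall>\<^sub>F F in finite_subsets_at_top some_onb.
      norm \<rho> - (\<Sum>e\<in>F. (norm (s e))\<^sup>2) = norm ((\<Sum>e\<in>F. ket (s e)) - \<rho>)"
    by (rule eventually_finite_subsets_at_top_weakI) (simp add: diff)
  ultimately have "((\<lambda>F. norm ((\<Sum>e\<in>F. ket (s e)) - \<rho>)) \<longlongrightarrow> norm \<rho> - norm \<rho>)
      (finite_subsets_at_top some_onb)"
    by (rule Lim_transform_eventually)
  then have "((\<lambda>F. norm ((\<Sum>e\<in>F. ket (s e)) - \<rho>)) \<longlongrightarrow> 0) (finite_subsets_at_top some_onb)"
    by simp
  then have "((\<lambda>e. ket (s e)) has_sum \<rho>) some_onb"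
    unfolding has_sum_def by (intro LIM_zero_cancel[where f = "\<lambda>F. \<Sum>e\<in>F. ket (s e)"]) (rule tendsto_norm_zero_cancel)
  then show ?thesis using that[of s] s(2) sa tr by (simp add: selfadjoint_def)
qed

text \<open>The density principle behind all later extensions: continuity of \<open>ket\<close>
  passes from D to all vectors, the expansion into kets to positive operators, and the Jordan
  decomposition to all of \<open>tsa\<close>.\<close>

lemma tsa_closed_subspace_eq_UNIV:
  fixes V :: "'a::complex_hilbert tsa set"
  assumes V: "subspace V" "closed V" and D: "closure D = UNIV" and ket: "\<And>u. u \<in> D \<Longrightarrow> ket u \<in> V"
  shows "\<rho> \<in> V"
proof -
  have ketV: "ket u \<in> V" for u
  proof -
    obtain f where f: "\<And>n. f n \<in> D" "f \<longlonglongrightarrow> u"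
      using D unfolding closure_sequential by (metis UNIV_I closure_sequential)
    show ?thesis
      by (rule closed_sequentially[OF V(2) _ tendsto_ket[OF f(2)]]) (use ket f in blast)
  qed
  have pos: "\<sigma> \<in> V" if \<sigma>: "0 \<le> \<sigma>" for \<sigma>
  proof -
    obtain s where "((\<lambda>e. ket (bop_apply s e)) has_sum \<sigma>) some_onb"
      using tsa_pos_ket_has_sum[OF \<sigma>] by blast
    then show ?thesis unfolding has_sum_def
      by (rule Lim_in_closed_set[OF V(2) _ finite_subsets_at_top_neq_bot, rotated])
         (auto intro!: always_eventually subspace_sum[OF V(1)] ketV)
  qed
  obtain p q where "0 \<le> p" "0 \<le> q" "\<rho> = p - q" by (rule tsa_Jordan_decomposition)
  then show ?thesis using subspace_diff[OF V(1)] pos by blast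
qed

lemma tsa_bounded_linear_eqI:
  assumes f: "bounded_linear f" and g: "bounded_linear g" and D: "closure D = UNIV"
    and eq: "\<And>u. u \<in> D \<Longrightarrow> f (ket u) = g (ket u)"
  shows "f \<rho> = (g \<rho> :: 'b::real_normed_vector)"
proof -
  have "\<rho> \<in> {\<rho>. f \<rho> = g \<rho>}"
    by (rule tsa_closed_subspace_eq_UNIV[OF _ _ D])
       (auto simp: eq subspace_def linear_simps[OF f] linear_simps[OF g]
         intro!: closed_Collect_eq linear_continuous_on f g)
  then show ?thesis by simp
qed

lemma tsa_bounded_linear_nonneg:
  assumes f: "bounded_linear (f :: 'a::complex_hilbert tsa \<Rightarrow> real)" and ket: "\<And>u. 0 \<le> f (ket u)"
    and \<rho>: "0 \<le> \<rho>"
  shows "0 \<le> f \<rho>"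
proof -
  obtain s where "((\<lambda>e. ket (bop_apply s e)) has_sum \<rho>) some_onb"
    using tsa_pos_ket_has_sum[OF \<rho>] by blast
  then have "((\<lambda>e. f (ket (bop_apply s e))) has_sum f \<rho>) some_onb"
    by (rule has_sum_bounded_linear[OF f])
  then show ?thesis by (rule has_sum_nonneg) (simp add: ket)
qed

lemma bounded_linear_inner_tsa: "bounded_linear (\<lambda>\<rho>. inner u (tsa_op \<rho> v))"
  by (rule bounded_linear_compose[OF bounded_linear_inner_right])
     (rule bounded_linear_compose[OF bounded_bilinear.bounded_linear_left[OF bounded_bilinear_bop_apply] bounded_linear_tsa_op])

subsection \<open>The pairing with bounded operators\<close>

text \<open>Polarizing Parseval's identity gives the real parts; replacing a by
  \<open>\<i> *\<^sub>C a\<close> gives the imaginary parts.\<close>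

lemma Parseval_cinner:
  assumes E: "is_onb E"
  shows "((\<lambda>e. cinner a e * cinner e b) has_sum cinner a b) E"
proof -
  have Re: "((\<lambda>e. Re (cinner a e * cinner e b)) has_sum Re (cinner a b)) E" for a
  proof -
    have 1: "(norm (a + b))\<^sup>2 - (norm (a - b))\<^sup>2 = 4 * inner a b" for a b :: 'a
      by (simp add: power2_norm_eq_inner inner_commute algebra_simps)
    have 2: "(cmod (cinner e (a + b)))\<^sup>2 - (cmod (cinner e (a - b)))\<^sup>2 = 4 * Re (cinner a e * cinner e b)" for e
    proof -
      have "cinner a e = cnj (cinner e a)" by (rule cinner_commute)
      then show ?thesis
        unfolding cinner_add_right cinner_diff_right cmod_power2
        by (simp add: power2_eq_square algebra_simps)
    qed
    have "((\<lambda>e. - (cmod (cinner e (a - b)))\<^sup>2) has_sum - (norm (a - b))\<^sup>2) E"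
      using Parseval[OF E] by (simp add: has_sum_uminus)
    then have "((\<lambda>e. (1/4) * ((cmod (cinner e (a + b)))\<^sup>2 + - (cmod (cinner e (a - b)))\<^sup>2)) has_sum
        (1/4) * ((norm (a + b))\<^sup>2 + - (norm (a - b))\<^sup>2)) E"
      by (intro has_sum_cmult_right has_sum_add Parseval E)
    then show ?thesis unfolding diff_conv_add_uminus[symmetric] 1 2 by (simp add: Re_cinner del: times_complex.sel)
  qed
  have "((\<lambda>e. of_real (Re (cinner a e * cinner e b)) + \<i> * of_real (Re (cinner (\<i> *\<^sub>C a) e * cinner e b)))
      has_sum of_real (Re (cinner a b)) + \<i> * of_real (Re (cinner (\<i> *\<^sub>C a) b))) E"
    by (intro has_sum_add has_sum_cmult_right has_sum_of_real Re)
  moreover have eq: "of_real (Re z) + \<i> * of_real (Re (cnj \<i> * z)) = z" for z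
    by (simp add: complex_eq_iff)
  ultimately show ?thesis unfolding cinner_scaleC_left mult.assoc eq by blast
qed

lemma Tr_mult_rank_one: "Tr (x * rank_one a) = cinner a (x a)"
  unfolding Tr_def
  by (rule infsumI) (use Parseval_cinner[OF some_onb, of a "x a"] in \<open>simp add: bop_simps\<close>)

text \<open>For positive \<rho> = s s the diagonal entries are <s e, s y e>. The inequality 2ab <=
  a^2 + b^2 bounds them by Hilbert-Schmidt sums of s and s y, whence the constant \<open>C\<close>;
  continuity is all that is wanted, not the sharp bound.\<close>

lemma Tr_pairing:
  fixes y :: "'a::complex_hilbert bop"
  shows "bounded_linear (\<lambda>\<rho>. Tr (tsa_op \<rho> * y))" "Tr (tsa_op (ket u) * y) = cinner u (y u)"
proof -
  let ?g = "\<lambda>\<rho> e. cinner e (tsa_op \<rho> (y e))"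
  define C where "C = (1 + (norm (y\<^sup>\<dagger>))\<^sup>2) / 2"
  have pos: "?g \<rho> summable_on some_onb \<and> norm (infsum (?g \<rho>) some_onb) \<le> C * norm \<rho>" if "0 \<le> \<rho>" for \<rho>
  proof -
    obtain s where s: "s\<^sup>\<dagger> = s" "s * s = tsa_op \<rho>" "((\<lambda>e. (norm (s e))\<^sup>2) has_sum norm \<rho>) some_onb"
      using tsa_pos_ket_has_sum[OF \<open>0 \<le> \<rho>\<close>] by blast
    have le: "(norm (y\<^sup>\<dagger> (s e)))\<^sup>2 \<le> (norm (y\<^sup>\<dagger>))\<^sup>2 * (norm (s e))\<^sup>2" for e
      unfolding power_mult_distrib[symmetric] by (intro power_mono norm_bop) auto
    have cs: "((\<lambda>e. (norm (y\<^sup>\<dagger>))\<^sup>2 * (norm (s e))\<^sup>2) has_sum (norm (y\<^sup>\<dagger>))\<^sup>2 * norm \<rho>) some_onb"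
      by (intro has_sum_cmult_right s)
    have "(\<lambda>e. (norm (y\<^sup>\<dagger> (s e)))\<^sup>2) summable_on some_onb"
      by (rule summable_on_comparison_test[OF has_sum_imp_summable[OF cs]]) (use le in auto)
    then obtain S where S: "((\<lambda>e. (norm (y\<^sup>\<dagger> (s e)))\<^sup>2) has_sum S) some_onb" by (auto simp: summable_on_def)
    have SS: "S \<le> (norm (y\<^sup>\<dagger>))\<^sup>2 * norm \<rho>" by (rule has_sum_mono[OF S cs le])
    have "((\<lambda>e. (norm ((y\<^sup>\<dagger> * s) e))\<^sup>2) has_sum S) some_onb" using S by simp
    \<comment> \<open>s y is the adjoint of \<open>y\<^sup>\<dagger> * s\<close>, and a
      Hilbert-Schmidt sum does not change under adjoints.\<close>
    from Hilbert_Schmidt_adj[OF some_onb some_onb this]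
    have S': "((\<lambda>e. (norm (s (y e)))\<^sup>2) has_sum S) some_onb" by (simp add: s)
    have bd: "norm (?g \<rho> e) \<le> (1/2) * ((norm (s e))\<^sup>2 + (norm (s (y e)))\<^sup>2)" for e
    proof -
      have "?g \<rho> e = cinner (s e) (s (y e))"
        using adj[of e s "s (y e)"] by (simp add: s(1) flip: s(2))
      then have "norm (?g \<rho> e) \<le> norm (s e) * norm (s (y e))"
        using cinner_Cauchy_Schwarz by simp
      also have "\<dots> \<le> (1/2) * ((norm (s e))\<^sup>2 + (norm (s (y e)))\<^sup>2)"
        using sum_squares_bound[of "norm (s e)" "norm (s (y e))"] by simp
      finally show ?thesis .
    qed
    have dom: "((\<lambda>e. (1/2) * ((norm (s e))\<^sup>2 + (norm (s (y e)))\<^sup>2)) has_sum (1/2) * (norm \<rho> + S)) some_onb"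
      by (intro has_sum_cmult_right has_sum_add s S')
    have sm: "(\<lambda>e. norm (?g \<rho> e)) summable_on some_onb"
      by (rule summable_on_comparison_test[OF has_sum_imp_summable[OF dom]]) (use bd in auto)
    have "norm (infsum (?g \<rho>) some_onb) \<le> (\<Sum>\<^sub>\<infinity>e\<in>some_onb. norm (?g \<rho> e))"
      by (rule norm_infsum_bound[OF sm])
    also have "\<dots> \<le> (1/2) * (norm \<rho> + S)"
      by (rule has_sum_mono[OF has_sum_infsum[OF sm] dom bd])
    also have "\<dots> \<le> C * norm \<rho>" using SS by (simp add: C_def algebra_simps)
    finally show ?thesis using abs_summable_summable[OF sm] by simp
  qed
  have summ: "?g \<rho> summable_on some_onb" for \<rho>
  proof -
    obtain p q where pq: "0 \<le> p" "0 \<le> q" "\<rho> = p - q" by (rule tsa_Jordan_decomposition)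
    have "(\<lambda>e. ?g p e + - ?g q e) summable_on some_onb"
      by (intro summable_on_add summable_on_uminus[THEN iffD2] pos[THEN conjunct1] pq(1,2))
    then show ?thesis by (simp add: pq(3) tsa_op_simps cinner_diff_right)
  qed
  have Tr: "Tr (tsa_op \<rho> * y) = infsum (?g \<rho>) some_onb" for \<rho>
    by (simp add: Tr_def)
  have add: "Tr (tsa_op (\<rho> + \<sigma>) * y) = Tr (tsa_op \<rho> * y) + Tr (tsa_op \<sigma> * y)" for \<rho> \<sigma>
    unfolding Tr using infsum_add[OF summ summ, of \<rho> \<sigma>] by (simp add: tsa_op_simps cinner_add_right)
  show "bounded_linear (\<lambda>\<rho>. Tr (tsa_op \<rho> * y))"
  proof (rule bounded_linear_intro[OF add])
    show "Tr (tsa_op (r *\<^sub>R \<rho>) * y) = r *\<^sub>R Tr (tsa_op \<rho> * y)" for r \<rho>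
      unfolding Tr using infsum_cmult_right'[of "of_real r" "?g \<rho>" some_onb]
      by (simp add: tsa_op_simps scaleR_conv_of_real)
    show "norm (Tr (tsa_op \<rho> * y)) \<le> norm \<rho> * C" for \<rho>
      using norm_tsa_linear_bound[OF add, of C \<rho>] pos by (simp add: Tr mult.commute)
  qed
  have "cinner e (tsa_op (ket u) (y e)) = cinner (y\<^sup>\<dagger> u) e * cinner e u" for e
    by (simp add: ket.rep_eq adj')
  then show "Tr (tsa_op (ket u) * y) = cinner u (y u)"
    unfolding Tr using infsumI[OF Parseval_cinner[OF some_onb, of "y\<^sup>\<dagger> u" u]] by (simp add: adj')
qed

lemma Tr_pairing_real:
  assumes y: "selfadjoint y" 
  shows "Tr (tsa_op \<rho> * y) = of_real (Re (Tr (tsa_op \<rho> * y)))"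
proof (rule tsa_bounded_linear_eqI[OF Tr_pairing(1) _ closure_UNIV])
  show "bounded_linear (\<lambda>\<rho>. complex_of_real (Re (Tr (tsa_op \<rho> * y))))"
    by (intro bounded_linear_compose[OF bounded_linear_of_real] bounded_linear_compose[OF bounded_linear_Re] Tr_pairing)
  show "Tr (tsa_op (ket u) * y) = complex_of_real (Re (Tr (tsa_op (ket u) * y)))" for u
    by (simp add: Tr_pairing Re_cinner selfadjoint_cinner_real[OF y])
qed

lemma Tr_pairing_mono:
  assumes "0 \<le> \<rho>" "x \<le> (y :: 'a::complex_hilbert bop)"
  shows "Re (Tr (tsa_op \<rho> * x)) \<le> Re (Tr (tsa_op \<rho> * y))"
proof -
  have lin: "bounded_linear (\<lambda>\<rho>. Re (Tr (tsa_op \<rho> * z)))" for z :: "'a bop"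
    by (rule bounded_linear_compose[OF bounded_linear_Re Tr_pairing(1)])
  have "0 \<le> Re (Tr (tsa_op \<rho> * y)) - Re (Tr (tsa_op \<rho> * x))"
    by (rule tsa_bounded_linear_nonneg[OF bounded_linear_sub[OF lin lin] _ assms(1)])
       (use bop_le_inner[OF assms(2)] in \<open>simp add: Tr_pairing(2) Re_cinner\<close>)
  then show ?thesis by simp
qed

subsection \<open>Conjugation by a bounded operator\<close>

lemma sandwich_ket [simp]: "sandwich x (ket u) = ket (bop_apply x u)"
  by (rule tsa_eqI) (simp add: sandwich.rep_eq ket.rep_eq adj)

lemma sandwich_pos: "0 \<le> \<rho> \<Longrightarrow> 0 \<le> sandwich x \<rho>"
  by (simp add: less_eq_tsa.rep_eq zero_tsa.rep_eq sandwich.rep_eq bop_sandwich_pos)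

lemma sandwich_mult: "sandwich x (sandwich y \<rho>) = sandwich (x * y) \<rho>"
  by (rule tsa_eqI) (simp add: sandwich.rep_eq)

lemma sandwich_one [simp]: "sandwich 1 \<rho> = \<rho>"
  by (rule tsa_eqI) (simp add: sandwich.rep_eq)

lemma sandwich_add: "sandwich x (\<rho> + \<sigma>) = sandwich x \<rho> + sandwich x \<sigma>"
  by (rule tsa_eqI) (simp add: sandwich.rep_eq tsa_op_simps bop_simps)

text \<open>For positive \<rho> = s s the trace is the Hilbert-Schmidt sum of the adjoint of x s,
  which equals that of x s and is dominated termwise by that of s.\<close>

lemma norm_sandwich: "norm (sandwich x \<rho>) \<le> (norm x)\<^sup>2 * norm \<rho>"
proof (rule norm_tsa_linear_bound[OF sandwich_add])
  fix \<rho> :: "'a tsa" assume \<rho>: "0 \<le> \<rho>"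
  obtain s where s: "s\<^sup>\<dagger> = s" "s * s = tsa_op \<rho>" "((\<lambda>e. (norm (s e))\<^sup>2) has_sum norm \<rho>) some_onb"
    using tsa_pos_ket_has_sum[OF \<rho>] by blast
  have le: "(norm (x (s e)))\<^sup>2 \<le> (norm x)\<^sup>2 * (norm (s e))\<^sup>2" for e
    unfolding power_mult_distrib[symmetric] by (intro power_mono norm_bop) auto
  have cs: "((\<lambda>e. (norm x)\<^sup>2 * (norm (s e))\<^sup>2) has_sum (norm x)\<^sup>2 * norm \<rho>) some_onb"
    by (intro has_sum_cmult_right s)
  have "(\<lambda>e. (norm (x (s e)))\<^sup>2) summable_on some_onb"
    by (rule summable_on_comparison_test[OF has_sum_imp_summable[OF cs]]) (use le in auto)
  then obtain S where S: "((\<lambda>e. (norm (x (s e)))\<^sup>2) has_sum S) some_onb" by (auto simp: summable_on_def)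
  then have "((\<lambda>e. (norm ((x * s) e))\<^sup>2) has_sum S) some_onb" by simp
  from Hilbert_Schmidt_adj[OF some_onb some_onb this]
  have S': "((\<lambda>e. (norm (s (x\<^sup>\<dagger> e)))\<^sup>2) has_sum S) some_onb" by (simp add: s)
  have "inner e (tsa_op (sandwich x \<rho>) e) = (norm (s (x\<^sup>\<dagger> e)))\<^sup>2" for e
  proof -
    have "cinner e (tsa_op (sandwich x \<rho>) e) = cinner (s (x\<^sup>\<dagger> e)) (s (x\<^sup>\<dagger> e))"
      using adj'[of x e "s (s (x\<^sup>\<dagger> e))"] adj[of "x\<^sup>\<dagger> e" s "s (x\<^sup>\<dagger> e)"]
      by (simp add: sandwich.rep_eq s(1) flip: s(2))
    from arg_cong[OF this, of Re] show ?thesis by (simp add: Re_cinner power2_norm_eq_inner)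
  qed
  then have "tsa_trace (sandwich x \<rho>) = S"
    using tsa_trace_has_sum[of "sandwich x \<rho>"] has_sum_unique[OF S'] by auto
  then show "norm (sandwich x \<rho>) \<le> (norm x)\<^sup>2 * norm \<rho>"
    using has_sum_mono[OF S cs le] by (simp add: norm_tsa_pos sandwich_pos \<rho>)
qed

lemma bounded_linear_sandwich: "bounded_linear (sandwich x)"
proof (rule bounded_linear_intro[OF sandwich_add])
  show "sandwich x (r *\<^sub>R \<rho>) = r *\<^sub>R sandwich x \<rho>" for r \<rho>
    by (rule tsa_eqI) (simp add: sandwich.rep_eq tsa_op_simps bop_simps)
  show "norm (sandwich x \<rho>) \<le> norm \<rho> * (norm x)\<^sup>2" for \<rho>
    using norm_sandwich[of x \<rho>] by (simp add: mult.commute)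
qed

text \<open>Strong convergence of bounded nets suffices for trace norm convergence: it is immediate
  on kets, and the maps share the Lipschitz constant \<open>K\<^sup>2\<close>.\<close>

lemma sandwich_tendsto:
  assumes x: "\<forall>\<^sub>F i in F. norm (x i) \<le> K" and x0: "norm x0 \<le> K"
    and lim: "\<And>u. ((\<lambda>i. bop_apply (x i) u) \<longlongrightarrow> bop_apply x0 u) F"
  shows "((\<lambda>i. sandwich (x i) \<rho>) \<longlongrightarrow> sandwich x0 \<rho>) F"
proof -
  have d: "dist (sandwich y \<rho>) (sandwich y \<sigma>) \<le> K\<^sup>2 * dist \<rho> \<sigma>" if "norm y \<le> K" for y \<rho> \<sigma>
  proof -
    have "dist (sandwich y \<rho>) (sandwich y \<sigma>) \<le> (norm y)\<^sup>2 * dist \<rho> \<sigma>"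
      using norm_sandwich[of y "\<rho> - \<sigma>"] by (simp add: dist_norm linear_simps[OF bounded_linear_sandwich])
    also have "\<dots> \<le> K\<^sup>2 * dist \<rho> \<sigma>"
      using that by (intro mult_right_mono power_mono) auto
    finally show ?thesis .
  qed
  have "\<rho> \<in> {\<rho>. ((\<lambda>i. sandwich (x i) \<rho>) \<longlongrightarrow> sandwich x0 \<rho>) F}"
  proof (rule tsa_closed_subspace_eq_UNIV[OF _ _ closure_UNIV])
    show "closed {\<rho>. ((\<lambda>i. sandwich (x i) \<rho>) \<longlongrightarrow> sandwich x0 \<rho>) F}"
      by (rule closed_equicontinuous_convergence[where K = "K\<^sup>2"])
         (use x in \<open>auto elim!: eventually_mono intro!: d x0\<close>)
    show "subspace {\<rho>. ((\<lambda>i. sandwich (x i) \<rho>) \<longlongrightarrow> sandwich x0 \<rho>) F}"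
      by (auto simp: subspace_def linear_simps[OF bounded_linear_sandwich] intro!: tendsto_add tendsto_scaleR)
    show "ket u \<in> {\<rho>. ((\<lambda>i. sandwich (x i) \<rho>) \<longlongrightarrow> sandwich x0 \<rho>) F}" for u
      by (simp add: tendsto_ket lim)
  qed
  then show ?thesis by simp
qed

subsection \<open>Weak convergence with convergence of the traces\<close>

lemma tsa_eq_innerI: "(\<And>u. inner u (tsa_op \<rho> u) = inner u (tsa_op \<sigma> u)) \<Longrightarrow> \<rho> = \<sigma>"
  by (intro order.antisym tsa_leI) simp_all

text \<open>The last bracket is the cross term of p and q, expressed by polarization so that it
  stays inside \<open>tsa\<close>.\<close>

lemma sandwich_lincomb:
  "sandwich (a *\<^sub>R p + b *\<^sub>R q) \<sigma> =
    a\<^sup>2 *\<^sub>R sandwich p \<sigma> + b\<^sup>2 *\<^sub>R sandwich q \<sigma> + (a * b) *\<^sub>R (sandwich (p + q) \<sigma> - sandwich p \<sigma> - sandwich q \<sigma>)"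
  by (simp add: sandwich.rep_eq tsa_op_simps power2_eq_square algebra_simps flip: tsa_op_inject)

text \<open>Conjugating \<sigma> by sqrt c p + q / sqrt c and by sqrt c p - q / sqrt c gives
  positive operators, which traps the cross term \<open>X\<close> between - \<open>D\<close> and
  \<open>D\<close>. The weight c lets a small q part absorb a large p part.\<close>

lemma norm_diff_sandwich:
  assumes \<sigma>: "0 \<le> \<sigma>" and pq: "p + q = 1" and c: "0 < c"
  shows "norm (\<sigma> - sandwich p \<sigma>) \<le> c * norm (sandwich p \<sigma>) + (1 / c + 1) * norm (sandwich q \<sigma>)"
proof -
  define X where "X = \<sigma> - sandwich p \<sigma> - sandwich q \<sigma>"
  define D where "D = c *\<^sub>R sandwich p \<sigma> + (1 / c) *\<^sub>R sandwich q \<sigma>"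
  have "0 \<le> sandwich (sqrt c *\<^sub>R p + (r / sqrt c) *\<^sub>R q) \<sigma>" for r
    by (rule sandwich_pos[OF \<sigma>])
  then have "0 \<le> c *\<^sub>R sandwich p \<sigma> + (r\<^sup>2 / c) *\<^sub>R sandwich q \<sigma> + r *\<^sub>R X" for r
    unfolding sandwich_lincomb using c by (simp add: X_def pq power_divide)
  from this[of 1] this[of "-1"] have "0 \<le> D - - X" "0 \<le> D - X"
    by (simp_all add: D_def)
  then have "- D \<le> X" "X \<le> D"
    unfolding diff_ge_0_iff_ge minus_le_iff[of D] by blast+
  then have "norm X \<le> norm D" by (rule norm_tsa_dominated)
  also have "\<dots> \<le> c * norm (sandwich p \<sigma>) + (1 / c) * norm (sandwich q \<sigma>)"
    unfolding D_def by (rule norm_triangle_le) (use c in simp)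
  finally have "norm X \<le> c * norm (sandwich p \<sigma>) + (1 / c) * norm (sandwich q \<sigma>)" .
  moreover have "norm (\<sigma> - sandwich p \<sigma>) \<le> norm X + norm (sandwich q \<sigma>)"
    using norm_triangle_ineq[of X "sandwich q \<sigma>"] by (simp add: X_def)
  ultimately show ?thesis by (simp add: algebra_simps)
qed

definition proj :: "'a::complex_hilbert set \<Rightarrow> 'a bop" where
  "proj F = (\<Sum>e\<in>F. rank_one e)"

lemma proj_apply: "proj F u = (\<Sum>e\<in>F. cinner e u *\<^sub>C e)"
  by (simp add: proj_def bop_sum_apply)

lemma proj_selfadjoint: "(proj F)\<^sup>\<dagger> = proj F"
  by (rule adj_eqI)
     (simp add: proj_apply cinner_sum_left cinner_sum_right mult.commute flip: cinner_commute)

lemma norm_proj: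
  assumes "orthonormal E" "finite F" "F \<subseteq> E"
  shows "(norm (proj F u))\<^sup>2 = (\<Sum>e\<in>F. (cmod (cinner e u))\<^sup>2)"
    "(norm (u - proj F u))\<^sup>2 = (norm u)\<^sup>2 - (norm (proj F u))\<^sup>2"
proof -
  show 1: "(norm (proj F u))\<^sup>2 = (\<Sum>e\<in>F. (cmod (cinner e u))\<^sup>2)"
    unfolding proj_apply by (rule norm_orthonormal_sum[OF assms])
  have "cinner (proj F u) u = (\<Sum>e\<in>F. complex_of_real ((cmod (cinner e u))\<^sup>2))"
    unfolding proj_apply cinner_sum_left
    by (intro sum.cong refl) (simp add: complex_norm_square mult.commute flip: of_real_power)
  then have "inner (proj F u) u = (norm (proj F u))\<^sup>2"
    unfolding 1 by (simp flip: Re_cinner)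
  then show "(norm (u - proj F u))\<^sup>2 = (norm u)\<^sup>2 - (norm (proj F u))\<^sup>2"
    by (simp add: power2_norm_eq_inner inner_diff_left inner_diff_right inner_commute)
qed

text \<open>A compression depends on finitely many matrix entries, so it follows weak convergence in
  norm. The factor 1/2 compensates for \<open>ket2\<close> adding to each term its adjoint, which
  the double sum already contains by Hermitian symmetry.\<close>

lemma sandwich_proj:
  "sandwich (proj F) \<delta> = (1/2) *\<^sub>R (\<Sum>e\<in>F. \<Sum>f\<in>F. ket2 (cinner e (tsa_op \<delta> f) *\<^sub>C e) f)"
proof (rule tsa_eqI)
  fix w
  let ?c = "\<lambda>e f. cinner e (tsa_op \<delta> f)"
  have cc: "cnj (?c e f) = ?c f e" for e f
    using selfadjoint_cinner[OF tsa_op_selfadjoint, of f \<delta> e] cinner_commute[of "tsa_op \<delta> f" e] by simp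
  let ?s = "\<Sum>e\<in>F. \<Sum>f\<in>F. (?c e f * cinner f w) *\<^sub>C e"
  have scaleC_sum: "(\<Sum>i\<in>F. g i) *\<^sub>C (x :: 'a) = (\<Sum>i\<in>F. g i *\<^sub>C x)" for g x
    by (induction F rule: infinite_finite_induct) (simp_all add: scaleC_add_left)
  have "tsa_op (sandwich (proj F) \<delta>) w = proj F (tsa_op \<delta> (proj F w))"
    by (simp add: sandwich.rep_eq proj_selfadjoint)
  also have "tsa_op \<delta> (proj F w) = (\<Sum>f\<in>F. cinner f w *\<^sub>C tsa_op \<delta> f)"
    by (simp add: proj_apply linear_sum[OF bounded_linear.linear[OF bop_linear]])
  also have "proj F \<dots> = ?s"
    by (simp only: proj_apply cinner_sum_right scaleC_sum cinner_scaleC_right mult.commute)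
  finally have 1: "tsa_op (sandwich (proj F) \<delta>) w = ?s" .
  have "tsa_op (\<Sum>e\<in>F. \<Sum>f\<in>F. ket2 (?c e f *\<^sub>C e) f) w =
      (\<Sum>e\<in>F. \<Sum>f\<in>F. (?c f e * cinner e w) *\<^sub>C f) + (\<Sum>e\<in>F. \<Sum>f\<in>F. (?c e f * cinner f w) *\<^sub>C e)"
    by (simp add: tsa_op_sum bop_sum_apply ket2_apply cc sum.distrib mult.commute)
  also have "\<dots> = ?s + ?s" by (subst sum.swap) simp
  finally show "tsa_op (sandwich (proj F) \<delta>) w =
      tsa_op ((1/2) *\<^sub>R (\<Sum>e\<in>F. \<Sum>f\<in>F. ket2 (?c e f *\<^sub>C e) f)) w"
    unfolding 1 by (simp add: tsa_op_simps flip: scaleR_2)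
qed

lemma bounded_linear_scaleC_left: "bounded_linear (\<lambda>c. c *\<^sub>C (x :: 'a::complex_hilbert))"
  by (rule bounded_linear_intro[where K = "norm x"])
     (simp_all add: scaleC_add_left scaleR_conv_of_real flip: scaleC_of_real)

text \<open>A noncommutative Scheffe lemma (Dell'Antonio, Gruemm): the weak limit is captured up to
  \<open>\<epsilon>\<close> by a finite rank projection, where weak and norm convergence agree; convergence of the
  traces prevents mass from escaping to the orthogonal complement.\<close>

lemma tsa_tendsto_weak_trace:
  fixes X :: "'i \<Rightarrow> 'a::complex_hilbert tsa"
  assumes X: "\<forall>\<^sub>F i in F. 0 \<le> X i" and \<rho>: "0 \<le> \<rho>"
    and weak: "\<And>u. ((\<lambda>i. inner u (tsa_op (X i) u)) \<longlongrightarrow> inner u (tsa_op \<rho> u)) F"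
    and tr: "((\<lambda>i. tsa_trace (X i)) \<longlongrightarrow> tsa_trace \<rho>) F"
  shows "(X \<longlongrightarrow> \<rho>) F"
proof (rule tendstoI)
  fix \<epsilon> :: real assume \<epsilon>: "\<epsilon> > 0"
  have onb: "orthonormal (some_onb :: 'a set)" using some_onb[where 'a = 'a] by (simp add: is_onb_def)
  have pol: "inner u (tsa_op \<sigma> v) = (1/2) * (inner (u + v) (tsa_op \<sigma> (u + v)) - inner u (tsa_op \<sigma> u)
      - inner v (tsa_op \<sigma> v))" for \<sigma> :: "'a tsa" and u v
  proof -
    have "inner v (tsa_op \<sigma> u) = inner u (tsa_op \<sigma> v)"
      using arg_cong[OF selfadjoint_cinner[OF tsa_op_selfadjoint, of v \<sigma> u], of Re]
      by (simp add: Re_cinner inner_commute)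
    then show ?thesis by (simp add: bop_simps inner_add_left inner_add_right)
  qed
  have weak_inner: "((\<lambda>i. inner u (tsa_op (X i) v)) \<longlongrightarrow> inner u (tsa_op \<rho> v)) F" for u v
    using tendsto_mult[OF tendsto_const tendsto_diff[OF tendsto_diff[OF weak[of "u + v"] weak[of u]] weak[of v]], of "1/2"]
    by (simp only: pol[symmetric])
  then have weak_cinner: "((\<lambda>i. cinner u (tsa_op (X i) v)) \<longlongrightarrow> cinner u (tsa_op \<rho> v)) F" for u v
    by (simp add: tendsto_complex_iff Re_cinner Im_cinner)
  define M where "M = tsa_trace \<rho> + 1"
  have M: "M > 0" using norm_tsa_pos[OF \<rho>] norm_ge_zero[of \<rho>] by (simp add: M_def)
  \<comment> \<open>\<open>c\<close> and \<open>d\<close> balance the bound of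
    \<open>norm_diff_sandwich\<close>: with a compressed part of trace at most \<open>M\<close> and
    a remainder below \<open>d\<close>, each of its two terms contributes at most
    \<epsilon>/8.\<close>
  define c where "c = \<epsilon> / (8 * M)"
  have c: "c > 0" "c * M = \<epsilon> / 8" using \<epsilon> M by (simp_all add: c_def)
  define d where "d = \<epsilon> / (8 * (1 / c + 1))"
  have c1: "1 / c + 1 > 0" using c by (simp add: add_pos_pos)
  have d: "d > 0" "(1 / c + 1) * d = \<epsilon> / 8"
  proof -
    have *: "0 < k \<Longrightarrow> k * (\<epsilon> / (8 * k)) = \<epsilon> / 8" for k by simp
    show "(1 / c + 1) * d = \<epsilon> / 8" unfolding d_def by (rule *[OF c1])
  qed (use \<epsilon> c1 in \<open>simp add: d_def\<close>)
  obtain N where N: "finite N" "N \<subseteq> some_onb" "dist (\<Sum>e\<in>N. inner e (tsa_op \<rho> e)) (tsa_trace \<rho>) < d"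
    using tendstoD[OF tsa_trace_has_sum[of \<rho>, unfolded has_sum_def] d(1)]
    unfolding eventually_finite_subsets_at_top by blast
  let ?p = "proj N"
  have tr_p: "tsa_trace (sandwich ?p \<sigma>) = (\<Sum>e\<in>N. inner e (tsa_op \<sigma> e))" for \<sigma>
    by (rule tsa_bounded_linear_eqI[OF bounded_linear_compose[OF bounded_linear_tsa_trace bounded_linear_sandwich]
          bounded_linear_sum[OF bounded_linear_inner_tsa] closure_UNIV])
       (simp add: tsa_trace_ket norm_proj(1)[OF onb N(1,2)] ket.rep_eq inner_rank_one del: rank_one.rep_eq)
  have tr_q: "tsa_trace (sandwich (1 - ?p) \<sigma>) = tsa_trace \<sigma> - tsa_trace (sandwich ?p \<sigma>)" for \<sigma>
    by (rule tsa_bounded_linear_eqI[OF bounded_linear_compose[OF bounded_linear_tsa_trace bounded_linear_sandwich]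
          bounded_linear_sub[OF bounded_linear_tsa_trace
            bounded_linear_compose[OF bounded_linear_tsa_trace bounded_linear_sandwich]] closure_UNIV])
       (simp add: tsa_trace_ket norm_proj(2)[OF onb N(1,2)])
  have approx: "norm (\<sigma> - sandwich ?p \<sigma>) \<le> \<epsilon> / 4"
    if \<sigma>: "0 \<le> \<sigma>" and "tsa_trace \<sigma> < M" and "tsa_trace \<sigma> - (\<Sum>e\<in>N. inner e (tsa_op \<sigma> e)) < d" for \<sigma>
  proof -
    have "0 \<le> tsa_trace (sandwich (1 - ?p) \<sigma>)"
      using norm_tsa_pos[OF sandwich_pos[OF \<sigma>]] norm_ge_zero by metis
    then have "tsa_trace (sandwich ?p \<sigma>) \<le> M" using that tr_q by simp
    then have "c * tsa_trace (sandwich ?p \<sigma>) + (1 / c + 1) * tsa_trace (sandwich (1 - ?p) \<sigma>) \<le> c * M + (1 / c + 1) * d"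
      using that c c1 by (intro add_mono mult_left_mono) (auto simp: tr_p tr_q)
    also have "\<dots> = \<epsilon> / 4" unfolding c(2) d(2) by simp
    finally have *: "c * tsa_trace (sandwich ?p \<sigma>) + (1 / c + 1) * tsa_trace (sandwich (1 - ?p) \<sigma>) \<le> \<epsilon> / 4" .
    have "?p + (1 - ?p) = 1" by simp
    from norm_diff_sandwich[OF \<sigma> this c(1), unfolded norm_tsa_pos[OF sandwich_pos[OF \<sigma>]]] *
    show ?thesis by (rule order_trans)
  qed
  have "((\<lambda>i. sandwich ?p (X i)) \<longlongrightarrow> sandwich ?p \<rho>) F"
    unfolding sandwich_proj
    by (intro tendsto_scaleR tendsto_const tendsto_sum bounded_bilinear.tendsto[OF bounded_bilinear_ket2]
        bounded_linear.tendsto[OF bounded_linear_scaleC_left] weak_cinner)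
  then have "\<forall>\<^sub>F i in F. dist (sandwich ?p (X i)) (sandwich ?p \<rho>) < \<epsilon> / 4"
    using \<epsilon> by (intro tendstoD) auto
  moreover have "\<forall>\<^sub>F i in F. tsa_trace (X i) < M"
    by (rule order_tendstoD(2)[OF tr]) (simp add: M_def)
  \<comment> \<open>The mass outside the range of the projection is the full trace minus finitely
    many diagonal entries, so it converges as well.\<close>
  moreover have "\<forall>\<^sub>F i in F. tsa_trace (X i) - (\<Sum>e\<in>N. inner e (tsa_op (X i) e)) < d"
  proof (rule order_tendstoD(2))
    show "((\<lambda>i. tsa_trace (X i) - (\<Sum>e\<in>N. inner e (tsa_op (X i) e))) \<longlongrightarrow>
        tsa_trace \<rho> - (\<Sum>e\<in>N. inner e (tsa_op \<rho> e))) F"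
      by (intro tendsto_diff tendsto_sum tr weak)
    show "tsa_trace \<rho> - (\<Sum>e\<in>N. inner e (tsa_op \<rho> e)) < d"
      using N(3) by (simp add: dist_real_def abs_less_iff)
  qed
  ultimately show "\<forall>\<^sub>F i in F. dist (X i) \<rho> < \<epsilon>"
    using X
  proof eventually_elim
    case (elim i)
    have "norm (X i - sandwich ?p (X i)) \<le> \<epsilon> / 4" using elim by (intro approx)
    moreover have "norm (\<rho> - sandwich ?p \<rho>) \<le> \<epsilon> / 4"
      using N(3) by (intro approx \<rho>) (auto simp: M_def dist_real_def abs_less_iff)
    moreover have "dist (X i) \<rho> \<le> norm (X i - sandwich ?p (X i)) + dist (sandwich ?p (X i)) (sandwich ?p \<rho>)
        + norm (\<rho> - sandwich ?p \<rho>)"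
      using norm_triangle_ineq4[of "X i - sandwich ?p (X i) + (sandwich ?p (X i) - sandwich ?p \<rho>)" "\<rho> - sandwich ?p \<rho>"]
        norm_triangle_ineq[of "X i - sandwich ?p (X i)" "sandwich ?p (X i) - sandwich ?p \<rho>"]
      by (simp add: dist_norm)
    ultimately show ?case using elim(1) \<epsilon> by linarith
  qed
qed

section \<open>The predual semigroup\<close>

lemma continuous_map_sigma_weak_Tr:
  assumes "trace_class \<rho>"
  shows "continuous_map sigma_weak euclidean (\<lambda>x. Tr (\<rho> * x))"
proof -
  let ?B = "{{x. Tr (\<rho> * x) \<in> U} | \<rho> U. trace_class \<rho> \<and> open U} :: 'a bop set set"
  have ex: "{x. Tr (\<rho> * x) \<in> U} \<in> ?B" if "open U" for U
    using assms that by blast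
  have op: "openin sigma_weak {x. Tr (\<rho> * x) \<in> U}" if "open U" for U
    unfolding sigma_weak_def by (rule topology_generated_by_Basis[OF ex[OF that]])
  \<comment> \<open>The topspace of a generated topology is the union of its generators; the
    generator for \<open>UNIV\<close> is already everything.\<close>
  have "topspace sigma_weak = (UNIV :: 'a bop set)"
    using openin_subset[OF op[OF open_UNIV]] by auto
  then show ?thesis unfolding continuous_map_def using op by auto
qed

locale sub_Markov_predual =
  fixes T S :: "real \<Rightarrow> 'h::complex_hilbert bop \<Rightarrow> 'h bop"
  assumes qds: "quantum_dynamical_semigroup T"
    and sub: "\<And>t. 0 \<le> t \<Longrightarrow> T t 1 \<le> 1"
    and predual: "predual_semigroup T S"
begin

text \<open>Complete positivity for matrices of size one.\<close>

lemma T_pos: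
  assumes "0 \<le> t" "0 \<le> x" shows "0 \<le> T t x"
proof -
  have "completely_positive (T t)" using qds assms(1) by (simp add: quantum_dynamical_semigroup_def)
  then have "positive_matrix 1 (\<lambda>i j. x) \<longrightarrow> positive_matrix 1 (\<lambda>i j. T t x)"
    unfolding completely_positive_def by blast
  then have "\<forall>u :: nat \<Rightarrow> 'h. cinner (u 0) (T t x (u 0)) \<in> \<real>\<^sub>\<ge>\<^sub>0"
    using assms(2) by (simp add: positive_matrix_def bop_pos_iff)
  then have "cinner u (T t x u) \<in> \<real>\<^sub>\<ge>\<^sub>0" for u
    by (drule_tac x = "\<lambda>_. u" in spec)
  then show ?thesis unfolding bop_pos_iff by blast
qed

definition S' :: "real \<Rightarrow> 'h tsa \<Rightarrow> 'h tsa" where "S' t = restrict_tsa (S t)"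

text \<open>\<open>Tsa\<close> is faithful only on self-adjoint trace class operators.
  Self-adjointness holds because <u, S(t)\<rho> u> is the pairing of \<rho> with the positive
  operator T(t)|u><u|.\<close>

lemma S'_op:
  assumes t: "0 \<le> t" shows "tsa_op (S' t \<rho>) = S t (tsa_op \<rho>)"
  unfolding S'_def restrict_tsa_def
proof (rule Tsa_inverse, rule CollectI, rule conjI)
  show "trace_class (S t (tsa_op \<rho>))" using predual t by (simp add: predual_semigroup_def)
  show "selfadjoint (S t (tsa_op \<rho>))"
  proof (rule bop_polarization_selfadjoint)
    fix u
    have "cinner u (S t (tsa_op \<rho>) u) = Tr (S t (tsa_op \<rho>) * rank_one u)"
      by (simp add: Tr_mult_rank_one)
    also have "\<dots> = Tr (tsa_op \<rho> * T t (rank_one u))"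
      using predual t by (simp add: predual_semigroup_def)
    also have "\<dots> \<in> \<real>"
      using Tr_pairing_real[OF bop_pos_selfadjoint[OF T_pos[OF t rank_one_pos]]] Reals_of_real by metis
    finally show "cinner u (S t (tsa_op \<rho>) u) \<in> \<real>" .
  qed
qed

lemma S'_pairing: "0 \<le> t \<Longrightarrow> Tr (tsa_op (S' t \<rho>) * x) = Tr (tsa_op \<rho> * T t x)"
  using predual by (simp add: S'_op predual_semigroup_def)

lemma S'_inner: "0 \<le> t \<Longrightarrow> inner u (tsa_op (S' t \<rho>) u) = Re (Tr (tsa_op \<rho> * T t (rank_one u)))"
  using Tr_mult_rank_one[of "tsa_op (S' t \<rho>)" u] by (simp add: S'_pairing flip: Re_cinner)

lemma S'_trace: "0 \<le> t \<Longrightarrow> tsa_trace (S' t \<rho>) = Re (Tr (tsa_op \<rho> * T t 1))"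
  using S'_pairing[of t \<rho> 1] by (simp add: tsa_trace_def)

lemma S'_pos:
  assumes "0 \<le> t" "0 \<le> \<rho>" shows "0 \<le> S' t \<rho>"
  using Tr_pairing_mono[OF assms(2) T_pos[OF assms(1) rank_one_pos]]
  by (intro tsa_posI) (simp add: S'_inner assms(1) Tr_def)

lemma Re_Tr_linear: "bounded_linear (\<lambda>\<rho>. Re (Tr (tsa_op \<rho> * y)))"
  by (rule bounded_linear_compose[OF bounded_linear_Re Tr_pairing(1)])

text \<open>\<open>predual_semigroup\<close> states only the duality. Linearity and the semigroup
  law follow from it because the pairings with \<open>rank_one u\<close> separate points.\<close>

lemma S'_add: "0 \<le> t \<Longrightarrow> S' t (\<rho> + \<sigma>) = S' t \<rho> + S' t \<sigma>"
  by (rule tsa_eq_innerI) (simp add: tsa_op_simps inner_add_right S'_inner linear_simps[OF Re_Tr_linear, unfolded tsa_op_simps])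

lemma S'_scaleR: "0 \<le> t \<Longrightarrow> S' t (r *\<^sub>R \<rho>) = r *\<^sub>R S' t \<rho>"
  by (rule tsa_eq_innerI)
     (simp add: scaleR_tsa.rep_eq[of r "S' t \<rho>"] S'_inner linear_simps[OF Re_Tr_linear])

lemma S'_contraction:
  assumes t: "0 \<le> t" shows "norm (S' t \<rho>) \<le> norm \<rho>"
proof -
  have "norm (S' t \<rho>) \<le> 1 * norm \<rho>"
  proof (rule norm_tsa_linear_bound[OF S'_add[OF t]])
    fix \<rho> :: "'h tsa" assume \<rho>: "0 \<le> \<rho>"
    have "Re (Tr (tsa_op \<rho> * T t 1)) \<le> Re (Tr (tsa_op \<rho> * 1))"
      by (rule Tr_pairing_mono[OF \<rho> sub[OF t]])
    then show "norm (S' t \<rho>) \<le> 1 * norm \<rho>"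
      using t \<rho> by (simp add: norm_tsa_pos S'_pos S'_trace) (simp add: tsa_trace_def)
  qed
  then show ?thesis by simp
qed

lemma S'_continuous: "continuous_on {0..} (\<lambda>t. S' t \<rho>)"
proof -
  have Tr: "continuous_on {0..} (\<lambda>t. Tr (tsa_op \<rho> * T t x))" for \<rho> x
  proof -
    have "continuous_map (top_of_set {0..}) euclidean ((\<lambda>x. Tr (tsa_op \<rho> * x)) \<circ> (\<lambda>t. T t x))"
      using qds by (intro continuous_map_compose[OF _ continuous_map_sigma_weak_Tr])
        (auto simp: quantum_dynamical_semigroup_def)
    then show ?thesis by (simp add: o_def)
  qed
  have pos: "continuous_on {0..} (\<lambda>t. S' t p)" if p: "0 \<le> p" for p
    unfolding continuous_on_def
  proof (intro ballI tsa_tendsto_weak_trace)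
    fix t :: real assume t: "t \<in> {0..}"
    have ev: "\<forall>\<^sub>F s in at t within {0..}. 0 \<le> s"
      by (simp add: eventually_at_filter)
    show "\<forall>\<^sub>F s in at t within {0..}. 0 \<le> S' s p"
      using ev by eventually_elim (simp add: S'_pos p)
    show "0 \<le> S' t p" using t by (simp add: S'_pos p)
    \<comment> \<open>One limit serves twice: x = \<open>rank_one u\<close> yields weak convergence
      and x = 1 convergence of the traces.\<close>
    have lim: "((\<lambda>s. Re (Tr (tsa_op p * T s x))) \<longlongrightarrow> Re (Tr (tsa_op p * T t x))) (at t within {0..})" for x
      using Tr t by (intro tendsto_Re) (auto simp: continuous_on_def)
    show "((\<lambda>s. inner u (tsa_op (S' s p) u)) \<longlongrightarrow> inner u (tsa_op (S' t p) u)) (at t within {0..})" for u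
      using t lim[of "rank_one u"] ev
      by (simp add: S'_inner) (elim Lim_transform_eventually eventually_mono, simp add: S'_inner)
    show "((\<lambda>s. tsa_trace (S' s p)) \<longlongrightarrow> tsa_trace (S' t p)) (at t within {0..})"
      using t lim[of 1] ev
      by (simp add: S'_trace) (elim Lim_transform_eventually eventually_mono, simp add: S'_trace)
  qed
  obtain p q where pq: "0 \<le> p" "0 \<le> q" "\<rho> = p - q" by (rule tsa_Jordan_decomposition)
  have "S' t \<rho> = S' t p - S' t q" if "t \<in> {0..}" for t
    using S'_add[of t \<rho> q] that pq(3) by simp
  then show ?thesis
    using continuous_on_diff[OF pos[OF pq(1)] pos[OF pq(2)]] by (subst continuous_on_cong) auto
qed

sublocale S': contraction_semigroup S'
proof
  show "C0_semigroup S'"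
    unfolding C0_semigroup_def
  proof (intro conjI allI impI)
    fix t :: real assume t: "0 \<le> t"
    show "bounded_linear (S' t)"
      by (rule bounded_linear_intro[where K = 1]) (simp_all add: S'_add S'_scaleR S'_contraction t)
    fix s :: real assume s: "0 \<le> s"
    show "S' (t + s) = S' t \<circ> S' s"
    proof (rule ext, rule tsa_eq_innerI)
      fix \<rho> u
      \<comment> \<open>Duality reverses the order of composition, so T is split in the opposite
        order.\<close>
      have "T (t + s) = T s \<circ> T t"
        using qds s t by (metis add.commute quantum_dynamical_semigroup_def)
      then show "inner u (tsa_op (S' (t + s) \<rho>) u) = inner u (tsa_op ((S' t \<circ> S' s) \<rho>) u)"
        using s t by (simp add: S'_inner S'_pairing)
    qed
  next
    have "T 0 = id" using qds by (simp add: quantum_dynamical_semigroup_def)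
    then show "S' 0 = id"
      by (intro ext tsa_eq_innerI) (simp add: S'_inner Tr_mult_rank_one Re_cinner)
  qed (rule S'_continuous)
qed (rule S'_contraction)

text \<open>On \<open>ket u\<close> preservation of the trace says <u, T(t)1 u> = <u,u>, and by
  polarization this determines T(t)1.\<close>

lemma conservative_iff: "conservative T \<longleftrightarrow> (\<forall>t\<ge>0. \<forall>\<rho>\<ge>0. norm (S' t \<rho>) = norm \<rho>)"
proof
  assume "conservative T"
  then show "\<forall>t\<ge>0. \<forall>\<rho>\<ge>0. norm (S' t \<rho>) = norm \<rho>"
    by (auto simp: conservative_def norm_tsa_pos S'_pos S'_trace) (simp add: tsa_trace_def)
next
  assume S: "\<forall>t\<ge>0. \<forall>\<rho>\<ge>0. norm (S' t \<rho>) = norm \<rho>"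
  show "conservative T"
    unfolding conservative_def
  proof (intro allI impI)
    fix t :: real assume t: "0 \<le> t"
    have sa: "selfadjoint (T t 1)"
      by (rule bop_pos_selfadjoint[OF T_pos[OF t]]) (simp add: bop_pos_iff cinner_self)
    have "cinner u ((T t 1 - 1) u) = 0" for u
    proof -
      have "Re (Tr (tsa_op (ket u) * T t 1)) = (norm u)\<^sup>2"
        using S t ket_pos[of u] S'_trace[OF t, of "ket u"] norm_tsa_pos[OF S'_pos[OF t ket_pos[of u]]]
        by (simp add: norm_ket)
      then show ?thesis
        by (simp add: Tr_pairing cinner_diff_right selfadjoint_cinner_real[OF sa] cinner_self Re_cinner)
    qed
    then have "T t 1 - 1 = 0" by (rule bop_polarization_zero)
    then show "T t 1 = 1" by simp
  qed
qed

end

section \<open>The operators A and B\<close>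

lemma ket2_commute: "ket2 u v = ket2 v u"
  by (simp add: ket2_def add.commute)

text \<open>The analogue of a^2 - b^2 = (a - b)(a + b): a difference quotient of kets becomes
  \<open>ket2\<close> with the difference quotient in one slot.\<close>

lemma ket_diff: "ket u - ket v = (1/2) *\<^sub>R ket2 (u - v) (u + v)"
  by (rule tsa_eqI)
     (simp add: ket2_apply tsa_op_simps ket.rep_eq cinner_add_left cinner_diff_left scaleC_add_left
       scaleC_add_right scaleC_diff_left scaleC_diff_right algebra_simps flip: scaleR_2)

lemma tsa_trace_ket2: "tsa_trace (ket2 u v) = 2 * inner u v"
  unfolding ket2_def by (simp add: tsa_trace_simps tsa_trace_ket power2_norm_eq_inner inner_commute algebra_simps)

locale dissipation_equality =
  fixes P :: "real \<Rightarrow> 'h::complex_hilbert bop"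
    and Y :: "'h \<rightharpoonup> 'h" and L :: "nat \<Rightarrow> 'h \<rightharpoonup> 'h"
  assumes prem: "premise P Y L"
    and equality: "\<forall>u\<in>dom Y. cinner u (the (Y u)) + cinner (the (Y u)) u
           + (\<Sum>\<^sub>\<infinity>l\<in>{1..}. cinner (the (L l u)) (the (L l u))) = 0"
begin

sublocale V: contraction_semigroup "\<lambda>t. bop_apply (P t)"
proof
  show "C0_semigroup (\<lambda>t. bop_apply (P t))" using prem by (simp add: premise_def)
  fix t :: real and u assume "0 \<le> t"
  then have "norm (P t) \<le> 1" using prem by (simp add: premise_def)
  then show "norm (P t u) \<le> norm u"
    using norm_bop[of "P t" u] mult_right_mono[of "norm (P t)" 1 "norm u"] by simp
qed

lemma norm_P: "0 \<le> t \<Longrightarrow> norm (P t) \<le> 1"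
  using prem by (simp add: premise_def)

lemma Y_eq: "generator (\<lambda>t. bop_apply (P t)) = Y"
  using prem by (simp add: premise_def)

lemmas resY = V.resolvent[unfolded Y_eq]
lemmas resY_commute = V.resolvent_commute[unfolded Y_eq]
lemmas resY_inverse = V.resolvent_inverse[unfolded Y_eq]

definition R :: "real \<Rightarrow> 'h bop" where "R l = Bop (resolvent l Y)"

lemma R_apply:
  assumes "0 < l" shows "R l u = resolvent l Y u"
proof -
  have "bounded_clinear (resolvent l Y)"
    unfolding bounded_clinear_def
    using V.resolvent_bounded_linear[unfolded Y_eq, OF assms]
      resY_commute[OF assms bounded_linear_scaleC] by simp
  then show ?thesis by (simp add: R_def Bop_inverse)
qed

lemma norm_R: "0 < l \<Longrightarrow> norm (l *\<^sub>R R l) \<le> 1"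
  by (rule norm_bop_bound) (use resY(3) in \<open>simp_all add: R_apply\<close>)

lemma R_commute_P: "0 \<le> t \<Longrightarrow> 0 < l \<Longrightarrow> R l * P t = P t * R l"
  by (rule bop_eqI) (simp add: R_apply resY_commute[OF _ bop_linear] V.add[symmetric] add.commute)

lemma R_commute:
  assumes "0 < l" "0 < m" shows "R l * R m = R m * R l"
proof (rule bop_eqI)
  fix u
  have "P t (R m u) = R m (P t u)" if "0 < t" for t u
    using arg_cong[OF R_commute_P[of t m], of "\<lambda>x. bop_apply x u"] that assms(2) by simp
  then show "(R l * R m) u = (R m * R l) u"
    using resY_commute[OF assms(1) bop_linear] by (simp add: R_apply[OF assms(1)])
qed

definition K :: "nat \<Rightarrow> 'h bop" where "K l = Bop (\<lambda>w. the (L l (resolvent 1 Y w)))"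

lemma L_has_sum:
  assumes "u \<in> dom Y"
  shows "((\<lambda>l. (norm (the (L l u)))\<^sup>2) has_sum - 2 * inner u (the (Y u))) {1..}"
proof -
  have "(\<lambda>l. cinner (the (L l u)) (the (L l u))) summable_on {1..}"
    using prem assms by (simp add: premise_def)
  moreover have "(\<Sum>\<^sub>\<infinity>l\<in>{1..}. cinner (the (L l u)) (the (L l u))) = - (cinner u (the (Y u)) + cinner (the (Y u)) u)"
    unfolding eq_neg_iff_add_eq_0 using equality assms by (simp add: add.commute add.left_commute)
  ultimately have "((\<lambda>l. cinner (the (L l u)) (the (L l u))) has_sum
      - (cinner u (the (Y u)) + cinner (the (Y u)) u)) {1..}"
    using has_sum_infsum by fastforce
  from has_sum_Re[OF this] show ?thesis
    by (simp add: Re_cinner inner_commute power2_norm_eq_inner)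
qed

text \<open>\<open>Bop\<close> needs a bounded map. A single term of the dissipation series bounds
  the square of norm (L_l R(1,Y) w) by 2 <R(1,Y) w, w - R(1,Y) w> with the real inner product;
  closedness of L_l does not enter.\<close>

lemma K_apply:
  assumes l: "1 \<le> l" shows "K l w = the (L l (R 1 w))"
proof -
  have dom: "R 1 w \<in> dom Y" for w using resY(1)[of 1 w] by (simp add: R_apply)
  have L: "clinear_operator (L l)" "dom Y \<subseteq> dom (L l)" using prem l unfolding premise_def by blast+
  let ?f = "\<lambda>w. the (L l (R 1 w))"
  have add: "?f (w + w') = ?f w + ?f w'" for w w'
    using L dom by (auto simp: clinear_operator_def bop_simps subset_iff)
  have scale: "the (L l (c *\<^sub>C R 1 w)) = c *\<^sub>C ?f w" for c w
    using L dom by (auto simp: clinear_operator_def subset_iff)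
  have "norm (?f w) \<le> norm w * 2" for w
  proof -
    have "(\<Sum>k\<in>{l}. (norm (the (L k (R 1 w))))\<^sup>2) \<le> - 2 * inner (R 1 w) (the (Y (R 1 w)))"
      by (rule has_sum_mono2[OF has_sum_finite L_has_sum[OF dom]]) (use l in auto)
    also have "the (Y (R 1 w)) = R 1 w - w" using resY(2)[of 1 w] by (simp add: R_apply)
    also have "- 2 * inner (R 1 w) (R 1 w - w) = 2 * inner (R 1 w) w - 2 * (norm (R 1 w))\<^sup>2"
      by (simp add: inner_diff_right power2_norm_eq_inner)
    also have "\<dots> \<le> 2 * (norm (R 1 w) * norm w)"
      using norm_cauchy_schwarz[of "R 1 w" w] zero_le_power2[of "norm (R 1 w)"] by linarith
    also have "\<dots> \<le> 2 * (norm w * norm w)"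
      using resY(3)[of 1 w] by (intro mult_left_mono mult_right_mono) (auto simp: R_apply)
    also have "\<dots> \<le> (norm w * 2)\<^sup>2" by (simp add: power2_eq_square)
    finally have "(norm (?f w))\<^sup>2 \<le> (norm w * 2)\<^sup>2" by simp
    then show ?thesis by (rule power2_le_imp_le) simp
  qed
  then have "bounded_clinear ?f"
    unfolding bounded_clinear_def
    by (auto simp: scale add intro!: bounded_linear_intro[where K = 2] simp flip: scaleC_of_real)
  moreover have "(\<lambda>w. the (L l (resolvent 1 Y w))) = ?f" by (simp add: R_apply)
  ultimately show ?thesis by (simp only: K_def Bop_inverse mem_Collect_eq)
qed

text \<open>The dissipation equality at u = R(1,Y) w, where Y u = u - w.\<close>

lemma K_has_sum:
  "((\<lambda>l. (norm (K l w))\<^sup>2) has_sum 2 * inner (R 1 w) (w - R 1 w)) {1..}"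
proof -
  have dom: "R 1 w \<in> dom Y" and "the (Y (R 1 w)) = R 1 w - w"
    using resY(1,2)[of 1 w] by (simp_all add: R_apply)
  then have "2 * inner (R 1 w) (w - R 1 w) = - 2 * inner (R 1 w) (the (Y (R 1 w)))"
    by (simp add: inner_diff_right)
  with L_has_sum[OF dom]
  have "((\<lambda>l. (norm (the (L l (R 1 w))))\<^sup>2) has_sum 2 * inner (R 1 w) (w - R 1 w)) {1..}" by (simp only:)
  then show ?thesis by (rule has_sum_cong[THEN iffD2, rotated]) (simp add: K_apply)
qed

lemma K_bound: "2 * inner (R 1 w) (w - R 1 w) \<le> 2 * (norm w)\<^sup>2"
proof -
  have "inner (R 1 w) (w - R 1 w) \<le> norm (R 1 w) * norm w"
    using norm_cauchy_schwarz[of "R 1 w" w] inner_ge_zero[of "R 1 w"]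
    unfolding inner_diff_right by linarith
  then have "2 * inner (R 1 w) (w - R 1 w) \<le> 2 * (norm (R 1 w) * norm w)" by simp
  also have "\<dots> \<le> 2 * (norm w * norm w)"
    using resY(3)[of 1 w] by (intro mult_left_mono mult_right_mono) (auto simp: R_apply)
  finally show ?thesis by (simp add: power2_eq_square)
qed

subsection \<open>The series defining B on the core\<close>

text \<open>The bound is linear in \<rho>, so kets suffice, where it is a partial sum of
  \<open>K_has_sum\<close>. Uniformity in F yields absolute convergence of the series for
  \<open>\<Phi>\<close>.\<close>

lemma K_finite_bound:
  assumes "0 \<le> \<rho>" "finite F" "F \<subseteq> {1..}"
  shows "(\<Sum>l\<in>F. norm (sandwich (K l) \<rho>)) \<le> 2 * norm \<rho>"
proof -
  have "0 \<le> 2 * tsa_trace \<rho> - (\<Sum>l\<in>F. tsa_trace (sandwich (K l) \<rho>))"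
  proof (rule tsa_bounded_linear_nonneg[OF _ _ assms(1)])
    show "bounded_linear (\<lambda>\<rho>. 2 * tsa_trace \<rho> - (\<Sum>l\<in>F. tsa_trace (sandwich (K l) \<rho>)))"
      by (rule bounded_linear_sub[OF bounded_linear_const_mult[OF bounded_linear_tsa_trace]
            bounded_linear_sum[OF bounded_linear_compose[OF bounded_linear_tsa_trace bounded_linear_sandwich]]])
    show "0 \<le> 2 * tsa_trace (ket u) - (\<Sum>l\<in>F. tsa_trace (sandwich (K l) (ket u)))" for u
    proof -
      have "(\<Sum>l\<in>F. (norm (K l u))\<^sup>2) \<le> 2 * inner (R 1 u) (u - R 1 u)"
        by (rule has_sum_mono2[OF has_sum_finite K_has_sum]) (use assms in auto)
      then show ?thesis using K_bound[of u] by (simp add: tsa_trace_ket)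
    qed
  qed
  then show ?thesis by (simp add: norm_tsa_pos assms(1) sandwich_pos)
qed

text \<open>This is B composed with \<open>\<pi>\<close>, written without inverting
  \<open>\<pi>\<close> and therefore defined on all of \<open>tsa\<close>.\<close>

definition \<Phi> :: "'h tsa \<Rightarrow> 'h tsa" where
  "\<Phi> \<rho> = (\<Sum>\<^sub>\<infinity>l\<in>{1..}. sandwich (K l) \<rho>)"

lemma \<Phi>_abs_summable: "0 \<le> \<rho> \<Longrightarrow> (\<lambda>l. norm (sandwich (K l) \<rho>)) summable_on {1..}"
  by (rule nonneg_bdd_above_summable_on)
     (auto intro!: bdd_aboveI2[where M = "2 * norm \<rho>"] K_finite_bound)

lemma \<Phi>_has_sum: "((\<lambda>l. sandwich (K l) \<rho>) has_sum \<Phi> \<rho>) {1..}"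
proof -
  obtain p q where pq: "0 \<le> p" "0 \<le> q" "\<rho> = p - q" by (rule tsa_Jordan_decomposition)
  note summable = abs_summable_summable[OF \<Phi>_abs_summable]
  have "(\<lambda>l. sandwich (K l) p + - sandwich (K l) q) summable_on {1..}"
    by (rule summable_on_add[OF summable[OF pq(1)] summable_on_uminus[THEN iffD2, OF summable[OF pq(2)]]])
  then show ?thesis
    unfolding \<Phi>_def by (intro has_sum_infsum) (simp add: pq(3) linear_simps[OF bounded_linear_sandwich])
qed

lemma \<Phi>_bounded_linear: "bounded_linear \<Phi>"
proof (rule bounded_linear_intro[where K = 2])
  show add: "\<Phi> (\<rho> + \<sigma>) = \<Phi> \<rho> + \<Phi> \<sigma>" for \<rho> \<sigma>
    using has_sum_unique[OF \<Phi>_has_sum[of "\<rho> + \<sigma>"]] has_sum_add[OF \<Phi>_has_sum \<Phi>_has_sum, of \<rho> \<sigma>]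
    by (simp add: sandwich_add)
  show "\<Phi> (r *\<^sub>R \<rho>) = r *\<^sub>R \<Phi> \<rho>" for r \<rho>
    by (simp add: \<Phi>_def linear_simps[OF bounded_linear_sandwich] infsum_scaleR_right)
  have "norm (\<Phi> \<rho>) \<le> 2 * norm \<rho>" if "0 \<le> \<rho>" for \<rho>
  proof -
    have "norm (\<Phi> \<rho>) \<le> (\<Sum>\<^sub>\<infinity>l\<in>{1..}. norm (sandwich (K l) \<rho>))"
      unfolding \<Phi>_def by (rule norm_infsum_bound[OF \<Phi>_abs_summable[OF that]])
    also have "\<dots> \<le> 2 * norm \<rho>"
      by (rule infsum_le_finite_sums[OF \<Phi>_abs_summable[OF that] K_finite_bound[OF that]])
    finally show ?thesis .
  qed
  then show "norm (\<Phi> \<rho>) \<le> norm \<rho> * 2" for \<rho>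
    using norm_tsa_linear_bound[OF add, of 2 \<rho>] by (simp add: mult.commute)
qed

lemma \<Phi>_pos:
  assumes "0 \<le> \<rho>" shows "0 \<le> \<Phi> \<rho>"
proof (rule tsa_posI)
  fix u
  show "0 \<le> inner u (tsa_op (\<Phi> \<rho>) u)"
    by (rule has_sum_nonneg[OF has_sum_bounded_linear[OF bounded_linear_inner_tsa \<Phi>_has_sum]])
       (intro tsa_pos_inner sandwich_pos assms)
qed

abbreviation \<pi> :: "'h tsa \<Rightarrow> 'h tsa" where "\<pi> \<equiv> sandwich (R 1)"

text \<open>\<open>A\<pi> \<rho> = R(1,Y) \<rho> (Y R(1,Y))\<^sup>* + (Y R(1,Y)) \<rho> R(1,Y)\<^sup>*\<close>, written by polarization with
  \<open>Y R(1,Y) = R(1,Y) - 1\<close>.\<close>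

definition A\<pi> :: "'h tsa \<Rightarrow> 'h tsa" where
  "A\<pi> \<rho> = sandwich (R 1 + (R 1 - 1)) \<rho> - \<pi> \<rho> - sandwich (R 1 - 1) \<rho>"

lemma A\<pi>_bounded_linear: "bounded_linear A\<pi>"
  unfolding A\<pi>_def[abs_def] by (intro bounded_linear_sub bounded_linear_sandwich)

lemma A\<pi>_ket: "A\<pi> (ket w) = ket2 (R 1 w) (R 1 w - w)"
  by (simp add: A\<pi>_def ket2_def)

text \<open>On \<open>ket w\<close> both sides reduce to the series of \<open>K_has_sum\<close>. In
  terms of A and B this is Tr (A + B) = 0 on the core.\<close>

lemma tsa_trace_\<Phi>: "tsa_trace (\<Phi> \<rho>) = - tsa_trace (A\<pi> \<rho>)"
proof (rule tsa_bounded_linear_eqI[OF bounded_linear_compose[OF bounded_linear_tsa_trace \<Phi>_bounded_linear]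
      bounded_linear_minus[OF bounded_linear_compose[OF bounded_linear_tsa_trace A\<pi>_bounded_linear]] closure_UNIV])
  show "tsa_trace (\<Phi> (ket w)) = - tsa_trace (A\<pi> (ket w))" for w
  proof -
    have "((\<lambda>l. tsa_trace (sandwich (K l) (ket w))) has_sum tsa_trace (\<Phi> (ket w))) {1..}"
      by (rule has_sum_bounded_linear[OF bounded_linear_tsa_trace \<Phi>_has_sum])
    then have "((\<lambda>l. (norm (K l w))\<^sup>2) has_sum tsa_trace (\<Phi> (ket w))) {1..}"
      by (simp add: tsa_trace_ket)
    from has_sum_unique[OF this K_has_sum] show ?thesis
      by (simp add: A\<pi>_ket tsa_trace_ket2 inner_diff_right)
  qed
qed

section \<open>The semigroup generated by A and its action on the core\<close>

sublocale W: contraction_semigroup "\<lambda>t. sandwich (P t)"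
proof
  show "C0_semigroup (\<lambda>t. sandwich (P t))"
    unfolding C0_semigroup_def
  proof (intro conjI allI impI)
    show "sandwich (P 0) = id"
    proof
      have "P 0 = 1" by (rule bop_eqI) (simp add: V.zero)
      then show "sandwich (P 0) \<rho> = id \<rho>" for \<rho> by simp
    qed
    show "sandwich (P (s + t)) = sandwich (P s) \<circ> sandwich (P t)" if "0 \<le> s" "0 \<le> t" for s t
    proof -
      have "P (s + t) = P s * P t" by (rule bop_eqI) (simp add: V.add that)
      then show ?thesis by (simp add: fun_eq_iff sandwich_mult)
    qed
    show "continuous_on {0..} (\<lambda>t. sandwich (P t) \<rho>)" for \<rho>
      unfolding continuous_on_def
    proof (intro ballI sandwich_tendsto[where K = 1])
      fix t :: real assume t: "t \<in> {0..}"
      show "\<forall>\<^sub>F s in at t within {0..}. norm (P s) \<le> 1"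
        by (simp add: eventually_at_filter norm_P)
      show "norm (P t) \<le> 1" using t by (simp add: norm_P)
      show "((\<lambda>s. P s u) \<longlongrightarrow> P t u) (at t within {0..})" for u
        using V.C0 t by (auto simp: C0_semigroup_def continuous_on_def)
    qed
  qed (rule bounded_linear_sandwich)
  show "norm (sandwich (P t) \<rho>) \<le> norm \<rho>" if "0 \<le> t" for t \<rho>
  proof -
    have "norm (sandwich (P t) \<rho>) \<le> (norm (P t))\<^sup>2 * norm \<rho>" by (rule norm_sandwich)
    also have "\<dots> \<le> 1 * norm \<rho>"
      using norm_P[OF that] by (intro mult_right_mono power_le_one) auto
    finally show ?thesis by simp
  qed
qed

text \<open>On kets the derivative is computed through \<open>ket_diff\<close>. Since
  \<open>\<pi>\<close> and \<open>A\<pi>\<close> are bounded, closedness of A extends the formula to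
  all \<rho>.\<close>

lemma \<pi>_in_dom: "\<pi> \<rho> \<in> dom W.A \<and> the (W.A (\<pi> \<rho>)) = A\<pi> \<rho>"
proof -
  have ket: "\<pi> (ket w) \<in> dom W.A \<and> the (W.A (\<pi> (ket w))) = A\<pi> (ket w)" for w
  proof -
    define u where "u = R 1 w"
    have u: "u \<in> dom Y" "the (Y u) = u - w" using resY(1,2)[of 1 w] by (simp_all add: R_apply u_def)
    have 1: "((\<lambda>t. (1 / t) *\<^sub>R (P t u - u)) \<longlongrightarrow> u - w) (at_right 0)"
      using generatorD[of u "\<lambda>t. bop_apply (P t)"] u by (simp add: Y_eq)
    have "continuous_on {0..} (\<lambda>t. P t u)"
      using V.C0 by (simp add: C0_semigroup_def)
    then have "((\<lambda>t. P t u) \<longlongrightarrow> P 0 u) (at 0 within {0..})"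
      unfolding continuous_on_def by (rule bspec) simp
    then have 2: "((\<lambda>t. P t u) \<longlongrightarrow> u) (at_right 0)"
      unfolding V.zero by (rule tendsto_within_subset) auto
    have "((\<lambda>t. (1/2) *\<^sub>R ket2 ((1 / t) *\<^sub>R (P t u - u)) (P t u + u)) \<longlongrightarrow> (1/2) *\<^sub>R ket2 (u - w) (u + u)) (at_right 0)"
      by (intro tendsto_scaleR tendsto_const bounded_bilinear.tendsto[OF bounded_bilinear_ket2] tendsto_add 1 2)
    moreover have "(1/2) *\<^sub>R ket2 ((1 / t) *\<^sub>R (P t u - u)) (P t u + u) = (1 / t) *\<^sub>R (sandwich (P t) (\<pi> (ket w)) - \<pi> (ket w))" for t
      by (simp add: bounded_bilinear.scaleR_left[OF bounded_bilinear_ket2] ket_diff u_def)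
    moreover have "(1/2) *\<^sub>R ket2 (u - w) (u + u) = A\<pi> (ket w)"
      by (simp add: A\<pi>_ket ket2_commute[of "R 1 w - w"] bounded_bilinear.scaleR_right[OF bounded_bilinear_ket2] u_def flip: scaleR_2)
    ultimately show ?thesis using generatorI[where P = "\<lambda>t. sandwich (P t)"] by simp
  qed
  have "\<rho> \<in> {\<rho>. \<pi> \<rho> \<in> dom W.A \<and> the (W.A (\<pi> \<rho>)) = A\<pi> \<rho>}"
  proof (rule tsa_closed_subspace_eq_UNIV[OF _ _ closure_UNIV])
    show "subspace {\<rho>. \<pi> \<rho> \<in> dom W.A \<and> the (W.A (\<pi> \<rho>)) = A\<pi> \<rho>}"
    proof (rule subspaceI; unfold mem_Collect_eq linear_simps[OF bounded_linear_sandwich]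
        linear_simps[OF A\<pi>_bounded_linear])
      show "0 \<in> dom W.A \<and> the (W.A 0) = 0"
        using W.generator_scaleR[OF ket[of 0, THEN conjunct1], of 0] by (simp only: scaleR_zero_left simp_thms)
    qed (simp_all only: W.generator_add W.generator_scaleR simp_thms)
    show "closed {\<rho>. \<pi> \<rho> \<in> dom W.A \<and> the (W.A (\<pi> \<rho>)) = A\<pi> \<rho>}"
      unfolding closed_sequential_limits
    proof (intro allI impI, elim conjE)
      fix f \<rho> assume f: "\<forall>n. f n \<in> {\<rho>. \<pi> \<rho> \<in> dom W.A \<and> the (W.A (\<pi> \<rho>)) = A\<pi> \<rho>}" "f \<longlonglongrightarrow> \<rho>"
      have 1: "\<pi> (f n) \<in> dom W.A" for n using f(1) by blast
      have 2: "(\<lambda>n. \<pi> (f n)) \<longlonglongrightarrow> \<pi> \<rho>"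
        by (rule bounded_linear.tendsto[OF bounded_linear_sandwich f(2)])
      have 3: "(\<lambda>n. the (W.A (\<pi> (f n)))) \<longlonglongrightarrow> A\<pi> \<rho>"
        using bounded_linear.tendsto[OF A\<pi>_bounded_linear f(2)] f(1) by simp
      show "\<rho> \<in> {\<rho>. \<pi> \<rho> \<in> dom W.A \<and> the (W.A (\<pi> \<rho>)) = A\<pi> \<rho>}"
        using W.generator_closed[OF 1 2 3 sequentially_bot] by simp
    qed
    show "ket u \<in> {\<rho>. \<pi> \<rho> \<in> dom W.A \<and> the (W.A (\<pi> \<rho>)) = A\<pi> \<rho>}" for u
      using ket by blast
  qed
  then show ?thesis by blast
qed

section \<open>The resolvent R(1,A) and the bounded extension of B R(1,A)\<close>

abbreviation RA :: "'h tsa \<Rightarrow> 'h tsa" where "RA \<equiv> resolvent 1 W.A"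

lemma RA_bounded_linear: "bounded_linear RA"
  by (rule W.resolvent_bounded_linear) simp

lemma RA_\<pi>: "RA (\<pi> \<rho>) = \<pi> (RA \<rho>)"
  by (rule W.resolvent_commute[OF _ bounded_linear_sandwich])
     (simp_all add: sandwich_mult R_commute_P)

lemma RA_pos: "0 \<le> \<rho> \<Longrightarrow> 0 \<le> RA \<rho>"
  by (rule tsa_posI, rule W.resolvent_nonneg[OF _ bounded_linear_inner_tsa])
     (auto intro!: tsa_pos_inner sandwich_pos)

text \<open>The trace identity at R(1,A) \<rho>, with A R(1,A) = R(1,A) - 1. It serves twice: it
  bounds the approximants of \<open>J_1\<close> on positive operators, and it makes the loss
  vanish.\<close>

lemma trace_\<Phi>_RA: "tsa_trace (\<Phi> (RA \<rho>)) = tsa_trace (\<pi> \<rho>) - tsa_trace (\<pi> (RA \<rho>))"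
  using \<pi>_in_dom[of "RA \<rho>"] W.resolvent(2)[of 1 "\<pi> \<rho>"]
  by (simp add: tsa_trace_\<Phi> RA_\<pi> tsa_trace_simps)

lemma dom_Y_dense: "closure (dom Y) = UNIV"
  using V.dom_dense by (simp add: Y_eq)

text \<open>Hence the core contains the kets of a dense set, and the density principle applies to
  it.\<close>

lemma ket_dom_Y:
  assumes "u \<in> dom Y" obtains \<sigma> where "ket u = \<pi> \<sigma>"
proof -
  have "R 1 (u - the (Y u)) = u" using resY_inverse[of 1 u] assms by (simp add: R_apply)
  then have "ket u = \<pi> (ket (u - the (Y u)))" by simp
  then show ?thesis by (rule that)
qed

text \<open>Required to evaluate \<open>inv (pi_map Y)\<close>. R(1,Y) is injective and cancels on
  the left; taking adjoints turns the right factor into a left one.\<close>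

lemma \<pi>_inj: "inj \<pi>"
proof (rule linear_injective_0[THEN iffD2, OF bounded_linear.linear[OF bounded_linear_sandwich]], intro allI impI)
  have R0: "x = 0" if "R 1 x = 0" for x
    using resY(2)[of 1 x] V.generator_scaleR(2)[of _ 0] resY(1)[of 1 x] that by (simp add: R_apply Y_eq)
  fix \<rho> assume "\<pi> \<rho> = 0"
  then have "R 1 * tsa_op \<rho> * (R 1)\<^sup>\<dagger> = 0" by (simp add: sandwich.rep_eq[symmetric] zero_tsa.rep_eq)
  then have "R 1 (tsa_op \<rho> ((R 1)\<^sup>\<dagger> w)) = 0" for w
    by (metis bop_times_apply bop_zero_apply)
  then have 1: "tsa_op \<rho> ((R 1)\<^sup>\<dagger> w) = 0" for w using R0 by blast
  have "cinner (R 1 (tsa_op \<rho> v)) w = 0" for v w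
    by (simp only: adj[where x = "R 1", symmetric] selfadjoint_cinner[OF tsa_op_selfadjoint, symmetric] 1
        cinner_zero_right)
  then have "R 1 (tsa_op \<rho> v) = 0" for v
    using cinner_self[of "R 1 (tsa_op \<rho> v)"] by simp
  then have "tsa_op \<rho> v = 0" for v using R0 by blast
  then show "\<rho> = 0" by (intro tsa_eqI) (simp add: zero_tsa.rep_eq)
qed

lemma op_B_core: "op_B_core Y L (\<pi> \<rho>) = \<Phi> \<rho>"
proof -
  have "pi_map Y = \<pi>" by (simp add: pi_map_def R_def)
  then show ?thesis
    using inv_f_f[OF \<pi>_inj] by (simp add: op_B_core_def \<Phi>_def K_def)
qed

text \<open>Boundedness of \<open>\<pi> \<rho> \<mapsto> \<Phi> (R(1,A) \<rho>)\<close>: the positive and negative parts of \<open>\<pi> \<rho>\<close> need not lie in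
  the core, so they are first pushed into it by \<open>m R(m,Y) = R(1,Y) k\<^sub>m\<close>.\<close>

definition k :: "nat \<Rightarrow> 'h bop" where
  "k n = real (Suc n) *\<^sub>R ((1 - real (Suc n)) *\<^sub>R R (real (Suc n)) + 1)"

text \<open>The resolvent identity R(m) = R(1) (1 + (1 - m) R(m)) for m = Suc n.\<close>

lemma R_k: "R 1 * k n = real (Suc n) *\<^sub>R R (real (Suc n))" "k n * R 1 = R 1 * k n"
proof -
  let ?m = "real (Suc n)"
  have "R 1 ((1 - ?m) *\<^sub>R R ?m x + x) = R ?m x" for x
  proof -
    define v where "v = R ?m x"
    have v: "v \<in> dom Y" "the (Y v) = ?m *\<^sub>R v - x"
      using resY(1,2)[of ?m x] by (simp_all only: R_apply v_def of_nat_0_less_iff zero_less_Suc)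
    have "(1 - ?m) *\<^sub>R v + x = 1 *\<^sub>R v - the (Y v)" unfolding v(2) by (simp add: algebra_simps)
    then show ?thesis
      using resY_inverse[of 1 v] v(1) by (simp only: v_def[symmetric] R_apply zero_less_one)
  qed
  then show "R 1 * k n = ?m *\<^sub>R R ?m"
    by (intro bop_eqI) (simp add: k_def bop_simps)
  show "k n * R 1 = R 1 * k n"
    using R_commute[of 1 ?m] by (simp add: k_def algebra_simps)
qed

text \<open>With m = Suc n and C = m R(m,Y), this is B R(1,A) at the conjugate of \<rho> by C. That
  conjugate lies in the core, with \<open>sandwich (k n) \<rho>\<close> as its preimage under
  \<open>\<pi>\<close>.\<close>

definition J_approx :: "nat \<Rightarrow> 'h tsa \<Rightarrow> 'h tsa" where
  "J_approx n \<rho> = \<Phi> (RA (sandwich (k n) \<rho>))"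

lemma J_approx_bounded_linear: "bounded_linear (J_approx n)"
  unfolding J_approx_def[abs_def]
  by (rule bounded_linear_compose[OF \<Phi>_bounded_linear
        bounded_linear_compose[OF RA_bounded_linear bounded_linear_sandwich]])

text \<open>All maps involved preserve positivity, so on positive \<rho> the norm is a trace.
  \<open>trace_\<Phi>_RA\<close>, after dropping a nonnegative term, bounds it by the norm of a
  conjugate of \<rho> by the contraction m R(m,Y).\<close>

lemma norm_J_approx: "norm (J_approx n \<rho>) \<le> norm \<rho>"
proof -
  have "norm (J_approx n \<rho>) \<le> 1 * norm \<rho>"
  proof (rule norm_tsa_linear_bound[OF linear_simps(1)[OF J_approx_bounded_linear]])
    fix \<rho> :: "'h tsa" assume \<rho>: "0 \<le> \<rho>"
    let ?\<tau> = "sandwich (k n) \<rho>"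
    have \<tau>: "0 \<le> ?\<tau>" by (rule sandwich_pos[OF \<rho>])
    have "norm (J_approx n \<rho>) = tsa_trace (\<pi> ?\<tau>) - tsa_trace (\<pi> (RA ?\<tau>))"
      unfolding J_approx_def norm_tsa_pos[OF \<Phi>_pos[OF RA_pos[OF \<tau>]]] by (rule trace_\<Phi>_RA)
    also have "\<dots> \<le> norm (\<pi> ?\<tau>)"
      using norm_tsa_pos[OF sandwich_pos[OF \<tau>], of "R 1"] norm_tsa_pos[OF sandwich_pos[OF RA_pos[OF \<tau>]], of "R 1"]
        norm_ge_zero[of "\<pi> (RA ?\<tau>)"] by linarith
    also have "\<pi> ?\<tau> = sandwich (real (Suc n) *\<^sub>R R (real (Suc n))) \<rho>"
      by (simp only: sandwich_mult R_k)
    also have "norm \<dots> \<le> (norm (real (Suc n) *\<^sub>R R (real (Suc n))))\<^sup>2 * norm \<rho>"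
      by (rule norm_sandwich)
    also have "\<dots> \<le> 1 * norm \<rho>"
      by (intro mult_right_mono power_le_one norm_R) auto
    finally show "norm (J_approx n \<rho>) \<le> 1 * norm \<rho>" .
  qed
  then show ?thesis by simp
qed

text \<open>As \<open>k n\<close> commutes with \<open>R 1\<close>, on the core the factors combine
  to conjugation by m R(m,Y) of the preimage \<rho>, and m R(m,Y) tends strongly to the
  identity.\<close>

lemma J_approx_tendsto: "(\<lambda>n. J_approx n (\<pi> \<rho>)) \<longlonglongrightarrow> \<Phi> (RA \<rho>)"
proof -
  have "J_approx n (\<pi> \<rho>) = \<Phi> (RA (sandwich (real (Suc n) *\<^sub>R R (real (Suc n))) \<rho>))" for n
    by (simp only: J_approx_def sandwich_mult R_k)
  moreover have "(\<lambda>n. sandwich (real (Suc n) *\<^sub>R R (real (Suc n))) \<rho>) \<longlonglongrightarrow> sandwich 1 \<rho>"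
  proof (rule sandwich_tendsto[where K = 1])
    show "\<forall>\<^sub>F n in sequentially. norm (real (Suc n) *\<^sub>R R (real (Suc n))) \<le> 1"
      by (intro always_eventually allI norm_R) simp
    show "norm (1 :: 'h bop) \<le> 1" by (rule norm_bop_bound) simp_all
    show "(\<lambda>n. (real (Suc n) *\<^sub>R R (real (Suc n))) u) \<longlonglongrightarrow> (1 :: 'h bop) u" for u
      using V.resolvent_tendsto[of u] by (simp add: R_apply Y_eq del: of_nat_Suc)
  qed
  ultimately show ?thesis
    using bounded_linear.tendsto[OF bounded_linear_compose[OF \<Phi>_bounded_linear RA_bounded_linear]] by simp
qed

text \<open>Convergence on the core and the uniform bound give a limit of the approximants
  everywhere; density of the core shows that no other bounded operator qualifies, so the definite
  description selects this limit.\<close>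

lemma J_1: "bounded_linear (J_1 P Y L)" "J_1 P Y L (\<pi> \<rho>) = \<Phi> (RA \<rho>)"
proof -
  have "\<rho> \<in> {\<rho>. Cauchy (\<lambda>n. J_approx n \<rho>)}" for \<rho>
  proof (rule tsa_closed_subspace_eq_UNIV[OF _ _ dom_Y_dense])
    show "closed {\<rho>. Cauchy (\<lambda>n. J_approx n \<rho>)}"
    proof (rule closed_equicontinuous_Cauchy[where K = 1])
      show "dist (J_approx n \<rho>) (J_approx n \<sigma>) \<le> 1 * dist \<rho> \<sigma>" for n \<rho> \<sigma>
        using norm_J_approx[of n "\<rho> - \<sigma>"] by (simp add: dist_norm linear_simps[OF J_approx_bounded_linear])
    qed
    show "subspace {\<rho>. Cauchy (\<lambda>n. J_approx n \<rho>)}"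
      by (auto simp: subspace_def linear_simps[OF J_approx_bounded_linear] Cauchy_convergent_iff
          intro!: convergent_add convergent_const bounded_linear.convergent[OF bounded_linear_scaleR_right])
    show "ket u \<in> {\<rho>. Cauchy (\<lambda>n. J_approx n \<rho>)}" if u: "u \<in> dom Y" for u
      using ket_dom_Y[OF u] J_approx_tendsto LIMSEQ_imp_Cauchy by (metis mem_Collect_eq)
  qed
  then have "\<forall>\<rho>. \<exists>\<sigma>. (\<lambda>n. J_approx n \<rho>) \<longlonglongrightarrow> \<sigma>"
    by (simp add: Cauchy_convergent_iff convergent_def)
  then obtain J where J: "\<And>\<rho>. (\<lambda>n. J_approx n \<rho>) \<longlonglongrightarrow> J \<rho>" by metis
  have "bounded_linear J"
  proof (rule bounded_linear_intro[where K = 1])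
    show "J (\<rho> + \<sigma>) = J \<rho> + J \<sigma>" for \<rho> \<sigma>
      using LIMSEQ_unique[OF J[of "\<rho> + \<sigma>"]] tendsto_add[OF J[of \<rho>] J[of \<sigma>]]
      by (simp add: linear_simps[OF J_approx_bounded_linear])
    show "J (r *\<^sub>R \<rho>) = r *\<^sub>R J \<rho>" for r \<rho>
      using LIMSEQ_unique[OF J[of "r *\<^sub>R \<rho>"]] tendsto_scaleR[OF tendsto_const J[of \<rho>], of r]
      by (simp add: linear_simps[OF J_approx_bounded_linear])
    show "norm (J \<rho>) \<le> norm \<rho> * 1" for \<rho>
      using norm_J_approx LIMSEQ_le_const2[OF tendsto_norm[OF J[of \<rho>]]] by simp
  qed
  moreover have J\<pi>: "J (\<pi> \<rho>) = \<Phi> (RA \<rho>)" for \<rho>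
    by (rule LIMSEQ_unique[OF J J_approx_tendsto])
  have core: "core_Ds Y = range \<pi>" by (simp add: core_Ds_def pi_map_def R_def)
  have B: "op_B_core Y L (resolvent 1 (op_A P) (\<pi> \<rho>)) = \<Phi> (RA \<rho>)" for \<rho>
    by (simp add: op_A_def RA_\<pi> op_B_core)
  have "J_1 P Y L = J"
    unfolding J_1_def
  proof (rule the_equality)
    show "bounded_linear J \<and> (\<forall>\<rho>\<in>core_Ds Y. J \<rho> = op_B_core Y L (resolvent 1 (op_A P) \<rho>))"
      using \<open>bounded_linear J\<close> by (auto simp: core B J\<pi>)
    fix J' assume J': "bounded_linear J' \<and> (\<forall>\<rho>\<in>core_Ds Y. J' \<rho> = op_B_core Y L (resolvent 1 (op_A P) \<rho>))"
    show "J' = J"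
    proof (rule ext, rule tsa_bounded_linear_eqI[OF _ \<open>bounded_linear J\<close> dom_Y_dense])
      show "bounded_linear J'" using J' by simp
      fix u assume "u \<in> dom Y"
      then obtain \<sigma> where "ket u = \<pi> \<sigma>" by (rule ket_dom_Y)
      then show "J' (ket u) = J (ket u)" using J' by (simp add: core B J\<pi>)
    qed
  qed
  then show "bounded_linear (J_1 P Y L)" "J_1 P Y L (\<pi> \<rho>) = \<Phi> (RA \<rho>)"
    using \<open>bounded_linear J\<close> J\<pi> by simp_all
qed

section \<open>Vanishing of the loss functional\<close>

lemma loss_eq_0:
  assumes \<eta>: "\<eta> \<in> dom (op_A P)" shows "loss P Y L \<eta> = 0"
proof -
  \<comment> \<open>Substituting R(1,A) \<rho> for the argument replaces A by R(1,A) - 1 and B by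
    \<open>J_1\<close>, so the loss becomes a bounded functional of \<rho>, determined by its values
    on the core.\<close>
  have bl: "bounded_linear (\<lambda>\<rho>. - tsa_trace (RA \<rho> - \<rho> + J_1 P Y L \<rho>))"
    by (rule bounded_linear_minus[OF bounded_linear_compose[OF bounded_linear_tsa_trace
          bounded_linear_add[OF bounded_linear_sub[OF RA_bounded_linear bounded_linear_ident] J_1(1)]]])
  have 0: "- tsa_trace (RA \<rho> - \<rho> + J_1 P Y L \<rho>) = 0" for \<rho>
  proof (rule tsa_bounded_linear_eqI[OF bl bounded_linear_zero dom_Y_dense])
    fix u assume "u \<in> dom Y"
    then obtain \<sigma> where "ket u = \<pi> \<sigma>" by (rule ket_dom_Y)
    then show "- tsa_trace (RA (ket u) - ket u + J_1 P Y L (ket u)) = 0"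
      by (simp add: J_1 RA_\<pi> tsa_trace_simps trace_\<Phi>_RA)
  qed
  define \<rho> where "\<rho> = \<eta> - the (op_A P \<eta>)"
  have "RA \<rho> = \<eta>" "the (op_A P \<eta>) = \<eta> - \<rho>"
    using W.resolvent_inverse[of 1 \<eta>] \<eta> by (simp_all add: \<rho>_def op_A_def)
  then show ?thesis
    using 0[of \<rho>] \<eta> by (simp add: loss_def op_B_def \<rho>_def[symmetric])
qed

text \<open>Every series in the definition has zero terms, but the description is unique only if
  some pair of l and \<rho> represents \<eta>. Membership in the domain provides l = 1 and \<rho> =
  \<eta> - G \<eta>.\<close>

lemma loss_bar_eq_0:
  assumes G: "contraction_semigroup S" and \<eta>: "\<eta> \<in> dom (generator S)"
  shows "loss_bar P Y L (generator S) \<eta> = 0"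
proof -
  interpret G: contraction_semigroup S by (rule G)
  have loss: "loss P Y L (resolvent l (op_A P) \<rho>) = 0" if "0 < l" for l \<rho>
    by (rule loss_eq_0) (use W.resolvent(1)[OF that] in \<open>simp add: op_A_def\<close>)
  show ?thesis
    unfolding loss_bar_def
  proof (rule the_equality)
    fix c assume c: "\<forall>l>0. \<forall>\<rho>. \<eta> \<in> dom G.A \<and> resolvent l G.A \<rho> = \<eta> \<longrightarrow>
      (\<lambda>k. loss P Y L (resolvent l (op_A P) (((\<lambda>\<sigma>. the (op_B P Y L (resolvent l (op_A P) \<sigma>))) ^^ k) \<rho>))) sums c"
    have "(\<lambda>k. 0 :: real) sums c"
      using c[rule_format, of 1 "1 *\<^sub>R \<eta> - the (G.A \<eta>)"] \<eta> G.resolvent_inverse[of 1 \<eta>] by (simp add: loss)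
    then show "c = 0" using sums_unique2 sums_zero by blast
  qed (simp add: loss)
qed

end

theorem proposition6p2:
  fixes P :: "real \<Rightarrow> 'h::complex_hilbert bop"
    and Y :: "'h \<rightharpoonup> 'h" and L :: "nat \<Rightarrow> 'h \<rightharpoonup> 'h"
    and T S :: "real \<Rightarrow> 'h bop \<Rightarrow> 'h bop"
  assumes "premise P Y L"
    and "\<forall>u\<in>dom Y. cinner u (the (Y u)) + cinner (the (Y u)) u
           + (\<Sum>\<^sub>\<infinity>l\<in>{1..}. cinner (the (L l u)) (the (L l u))) = 0"
    and "minimal_qds Y L T"
    and "predual_semigroup T S"
  shows "conservative T \<longleftrightarrow> honest P Y L S"
proof -
  interpret dissipation_equality P Y L
    by unfold_locales (use assms in auto)
  interpret Q: sub_Markov_predual T S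
    by unfold_locales (use assms in \<open>auto simp: minimal_qds_def\<close>)
  have "Q.S' = (\<lambda>t. restrict_tsa (S t))" by (simp add: fun_eq_iff Q.S'_def)
  then have "loss_bar P Y L (generator (\<lambda>t. restrict_tsa (S t))) (integral {0..t} (\<lambda>s. restrict_tsa (S s) \<rho>)) = 0"
    if "0 \<le> t" for t \<rho>
    using loss_bar_eq_0[OF Q.S'.contraction_semigroup_axioms Q.S'.integral_in_dom[OF that]] by simp
  then show ?thesis
    by (simp add: honest_def Q.conservative_iff Q.S'_def)
qed

end
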